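(* Let $R(\lambda)=C(\lambda I_\ell-A)^{-1}B+\sum_{i=0}^dD_i\lambda^i$ be an $m\times n$ rational matrix with $\{A,B,C\}$ minimal and $D_d\ne0$, and let $S(\lambda)$ be a block Kronecker linearization of $R(\lambda)$ with parameters $(\epsilon,\eta)$, $\max(\epsilon,\eta)>0$. Let $\alpha=1+2\epsilon\max(1,\|A\|_2^\epsilon)$, $\beta=1+2\eta\max(1,\|A\|_2^\eta)$, $\gamma=\frac{\epsilon+\eta}{2\sqrt2}$, $s=\max(\alpha,\beta,\gamma)+\gamma(\beta\|B\|_2+\alpha\|C\|_2)$ and $$f_1=\frac{4\sqrt2\,s}{2-\sqrt3},\quad f_2=\frac{\sqrt2\,(4\max(\epsilon,\eta)-1)}{3},\quad f_3=\sqrt2\,[1+2\max(\eta,\epsilon)\max(1,\|A\|_2^{\max(\eta,\epsilon)})].$$ Let $\widehat S(\lambda)=S(\lambda)+\Delta_S(\lambda)$, where $\Delta_S(\lambda)$ is a pencil of the same size as $S(\lambda)$, and $\delta:=\|\Delta_S(\lambda)\|_F/\|S(\lambda)\|_F$. If $\|\Delta_S(\lambda)\|_F$ is sufficiently small, then $\widehat S(\lambda)$ is strictly equivalent to a block Kronecker linearization with the same parameters $\epsilon$ and $\eta$, $$\widetilde S(\lambda)=\begin{bmatrix}\widetilde M(\lambda)&\widehat K_2^T\widetilde C&K_2^T(\lambda)\\ \widetilde B\widehat K_1&\widetilde A-\lambda I_\ell&0\\ K_1(\lambda)&0&0\end{bmatrix};$$ that is, there exist constant matrices with $$\widetilde S(\lambda)=(I-X_3)(I-X_2)(I-X_1)\,\widehat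 S(\lambda)\,(I-Y_1)(I-Y_2)(I-Y_3),$$ all the factors $I-X_k$, $I-Y_k$ being invertible. Moreover, $\widetilde S(\lambda)=S(\lambda)+\Delta_3^{new}(\lambda)$ with $$\|\Delta_3^{new}(\lambda)\|_F\le(1+f_1\|S(\lambda)\|_2)(1+f_2\|S(\lambda)\|_2)(1+f_3\|S(\lambda)\|_2)\,\|\Delta_S(\lambda)\|_F+\mathcal O(\delta^2).$$
   Context: Let $\mathbb F$ be $\mathbb R$ or $\mathbb C$; all matrices have entries in $\mathbb F$; $m,n,\ell\ge1$ and $\epsilon,\eta\ge0$ are integers. For $k\ge0$ let $E_k=[\,I_k\ \ 0\,]$ and $F_k=[\,0\ \ I_k\,]$ (both $k\times(k+1)$), $L_k(\lambda):=E_k-\lambda F_k$, $\Lambda_k(\lambda):=[\lambda^k\ \cdots\ \lambda\ \ 1]^T$, and let $\mathbf e_k=[0\cdots0\ 1]^T\in\mathbb F^k$ be the last unit vector. Put $K_1(\lambda)=L_\epsilon(\lambda)\otimes I_n$, $\widehat K_1=\mathbf e_{\epsilon+1}^T\otimes I_n$, $K_2(\lambda)=L_\eta(\lambda)\otimes I_m$, $\widehat K_2=\mathbf e_{\eta+1}^T\otimes I_m$ ($K_1$, resp. $K_2$, is empty with zero rows if $\epsilon=0$, resp. $\eta=0$). A state-space triple $\{A,B,C\}$ ($A\in\mathbb F^{\ell\times\ell}$, $B\in\mathbb F^{\ell\times n}$, $C\in\mathbb F^{m\times\ell}$) is minimal if it is controllable and observable. A block Kronecker linearization with parameters $(\epsilon,\eta)$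 of $R(\lambda)=C(\lambda I_\ell-A)^{-1}B+D(\lambda)$, where $\{A,B,C\}$ is minimal and $D(\lambda)=\sum_{i=0}^dD_i\lambda^i$ has degree $d=\epsilon+\eta+1$, is a pencil $$S(\lambda)=\begin{bmatrix}M(\lambda)&\widehat K_2^TC&K_2^T(\lambda)\\ B\widehat K_1&A-\lambda I_\ell&0\\ K_1(\lambda)&0&0\end{bmatrix},$$ where $M(\lambda)$ is an $(\eta+1)m\times(\epsilon+1)n$ pencil (matrix polynomial of degree at most 1) with $D(\lambda)=(\Lambda_\eta(\lambda)\otimes I_m)^TM(\lambda)(\Lambda_\epsilon(\lambda)\otimes I_n)$. In the factored transformation, with respect to the $3\times3$ block partition of $S(\lambda)$ (block rows of sizes $(\eta+1)m,\ell,\epsilon n$ for $X_k$; block columns of sizes $(\epsilon+1)n,\ell,\eta m$ for $Y_k$), $X_1$ is strictly block lower triangular and $Y_1$ strictly block upper triangular, $X_2,Y_2$ are block diagonal, and $X_3$ is strictly block upper triangular with zero $(1,3)$ block and $Y_3$ strictly block lower triangular with zero $(3,1)$ block. Norms: for a pencil $S_a-\lambda S_b$, $\|S_a-\lambda S_b\|_F=(\|S_a\|_F^2+\|S_b\|_F^2)^{1/2}$ and $\|S_a-\lambda S_b\|_2=(\|S_a\|_2^2+\|S_b\|_2^2)^{1/2}$ (Frobenius and spectral norms of the coefficients). Convention: $S(\lambda)$ is fixed; "sufficiently small" together with the $\mathcal O(\delta^2)$ bound means that there are constants $\tau,K>0$ depending only on $S(\lambda)$ such that for every pencil $\Delta_S(\lambda)$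 with $\|\Delta_S\|_F<\tau$ such a transformation exists for which the inequality holds with $\mathcal O(\delta^2)$ replaced by $K\delta^2$. *)

theory Defs
  imports
    "HOL-Analysis.Euclidean_Space"
    "Jordan_Normal_Form.Char_Poly"
    "Jordan_Normal_Form.DL_Rank"
begin

(* The scalar field F (the reals or the complex numbers) is a type 'a of sort
   {real_normed_field, euclidean_space}. Both real and complex are instances, with norm the
   absolute value or modulus, and up to isometric isomorphism they are the only ones:
   a commutative, finite-dimensional real division algebra with multiplicative norm. *)

section \<open>Polynomial matrices and pencils\<close>

abbreviation const_mat :: "'a::zero mat \<Rightarrow> 'a poly mat" where
  "const_mat X \<equiv> map_mat (\<lambda>a. [:a:]) X"

definition coeff_mat :: "nat \<Rightarrow> 'a::zero poly mat \<Rightarrow> 'a mat" where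
  "coeff_mat k P = map_mat (\<lambda>p. coeff p k) P"

definition poly_mat_has_degree :: "'a::zero poly mat \<Rightarrow> nat \<Rightarrow> bool" where
  "poly_mat_has_degree P d \<longleftrightarrow>
     coeff_mat d P \<noteq> 0\<^sub>m (dim_row P) (dim_col P) \<and>
     (\<forall>k>d. coeff_mat k P = 0\<^sub>m (dim_row P) (dim_col P))"

definition pencil :: "'a::zero poly mat \<Rightarrow> bool" where
  "pencil P \<longleftrightarrow> (\<forall>k>1. coeff_mat k P = 0\<^sub>m (dim_row P) (dim_col P))"

section \<open>Norms\<close>

definition frobenius_norm :: "'a::real_normed_field mat \<Rightarrow> real" where
  "frobenius_norm X = L2_set (\<lambda>(i, j). norm (X $$ (i, j))) ({..<dim_row X} \<times> {..<dim_col X})"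

definition euclidean_norm :: "'a::real_normed_field vec \<Rightarrow> real" where
  "euclidean_norm v = L2_set (\<lambda>i. norm (v $ i)) {..<dim_vec v}"

(* The unit ball rather than the unit sphere, so that the supremum is over a nonempty set
   also for a matrix without columns. *)
definition spectral_norm :: "'a::real_normed_field mat \<Rightarrow> real" where
  "spectral_norm X =
     (SUP v \<in> {v \<in> carrier_vec (dim_col X). euclidean_norm v \<le> 1}. euclidean_norm (X *\<^sub>v v))"

(* A pencil S_a - lambda S_b has coefficients S_a and -S_b; the sign does not affect norms. *)
definition pencil_frobenius_norm :: "'a::real_normed_field poly mat \<Rightarrow> real" where
  "pencil_frobenius_norm P =
     sqrt ((frobenius_norm (coeff_mat 0 P))\<^sup>2 + (frobenius_norm (coeff_mat 1 P))\<^sup>2)"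

definition pencil_spectral_norm :: "'a::real_normed_field poly mat \<Rightarrow> real" where
  "pencil_spectral_norm P =
     sqrt ((spectral_norm (coeff_mat 0 P))\<^sup>2 + (spectral_norm (coeff_mat 1 P))\<^sup>2)"

section \<open>State-space triples\<close>

(* [B, A B, ..., A^(l-1) B] *)
definition controllability_mat :: "'a::semiring_1 mat \<Rightarrow> 'a mat \<Rightarrow> 'a mat" where
  "controllability_mat A B = mat (dim_row A) (dim_row A * dim_col B)
     (\<lambda>(i, j). (A ^\<^sub>m (j div dim_col B) * B) $$ (i, j mod dim_col B))"

(* C, C A, ..., C A^(l-1) stacked on top of each other *)
definition observability_mat :: "'a::semiring_1 mat \<Rightarrow> 'a mat \<Rightarrow> 'a mat" where
  "observability_mat A C = mat (dim_row A * dim_row C) (dim_row A)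
     (\<lambda>(i, j). (C * A ^\<^sub>m (i div dim_row C)) $$ (i mod dim_row C, j))"

definition controllable :: "'a::field mat \<Rightarrow> 'a mat \<Rightarrow> bool" where
  "controllable A B \<longleftrightarrow>
     vec_space.rank (dim_row (controllability_mat A B)) (controllability_mat A B) = dim_row A"

definition observable :: "'a::field mat \<Rightarrow> 'a mat \<Rightarrow> bool" where
  "observable A C \<longleftrightarrow>
     vec_space.rank (dim_row (observability_mat A C)) (observability_mat A C) = dim_row A"

definition minimal_triple :: "'a::field mat \<Rightarrow> 'a mat \<Rightarrow> 'a mat \<Rightarrow> bool" where
  "minimal_triple A B C \<longleftrightarrow> controllable A B \<and> observable A C"

(* C (lambda I - A)^(-1) B + D(lambda) over the field of rational functions;
   char_poly_matrix A is lambda I - A, which is invertible there. *)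
definition state_space_rational_mat ::
  "'a::field mat \<Rightarrow> 'a mat \<Rightarrow> 'a mat \<Rightarrow> 'a poly mat \<Rightarrow> 'a poly fract mat" where
  "state_space_rational_mat A B C D =
     map_mat to_fract (const_mat C) * the (mat_inverse (map_mat to_fract (char_poly_matrix A)))
       * map_mat to_fract (const_mat B) + map_mat to_fract D"

section \<open>Block matrices\<close>

definition append_cols :: "'a::zero mat \<Rightarrow> 'a mat \<Rightarrow> 'a mat" where
  "append_cols X Y = four_block_mat X Y (0\<^sub>m 0 (dim_col X)) (0\<^sub>m 0 (dim_col Y))"

definition block_mat_3 ::
  "'a::zero mat \<Rightarrow> 'a mat \<Rightarrow> 'a mat \<Rightarrow> 'a mat \<Rightarrow> 'a mat \<Rightarrow> 'a mat \<Rightarrow> 'a mat \<Rightarrow> 'a mat \<Rightarrow> 'a mat \<Rightarrow> 'a mat"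
where
  "block_mat_3 X11 X12 X13 X21 X22 X23 X31 X32 X33 =
     append_cols X11 (append_cols X12 X13)
       @\<^sub>r (append_cols X21 (append_cols X22 X23)
       @\<^sub>r append_cols X31 (append_cols X32 X33))"

definition strictly_block_lower :: "nat \<Rightarrow> nat \<Rightarrow> nat \<Rightarrow> 'a::zero mat \<Rightarrow> bool" where
  "strictly_block_lower p q r X \<longleftrightarrow>
     (\<exists>X21 \<in> carrier_mat q p. \<exists>X31 \<in> carrier_mat r p. \<exists>X32 \<in> carrier_mat r q.
        X = block_mat_3 (0\<^sub>m p p) (0\<^sub>m p q) (0\<^sub>m p r)
                        X21       (0\<^sub>m q q) (0\<^sub>m q r)
                        X31       X32       (0\<^sub>m r r))"

definition strictly_block_upper :: "nat \<Rightarrow> nat \<Rightarrow> nat \<Rightarrow> 'a::zero mat \<Rightarrow> bool" where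
  "strictly_block_upper p q r X \<longleftrightarrow>
     (\<exists>X12 \<in> carrier_mat p q. \<exists>X13 \<in> carrier_mat p r. \<exists>X23 \<in> carrier_mat q r.
        X = block_mat_3 (0\<^sub>m p p) X12       X13
                        (0\<^sub>m q p) (0\<^sub>m q q) X23
                        (0\<^sub>m r p) (0\<^sub>m r q) (0\<^sub>m r r))"

definition block_diagonal :: "nat \<Rightarrow> nat \<Rightarrow> nat \<Rightarrow> 'a::zero mat \<Rightarrow> bool" where
  "block_diagonal p q r X \<longleftrightarrow>
     (\<exists>X11 \<in> carrier_mat p p. \<exists>X22 \<in> carrier_mat q q. \<exists>X33 \<in> carrier_mat r r.
        X = block_mat_3 X11       (0\<^sub>m p q) (0\<^sub>m p r)
                        (0\<^sub>m q p) X22       (0\<^sub>m q r)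
                        (0\<^sub>m r p) (0\<^sub>m r q) X33)"

definition strictly_block_upper_no_corner :: "nat \<Rightarrow> nat \<Rightarrow> nat \<Rightarrow> 'a::zero mat \<Rightarrow> bool" where
  "strictly_block_upper_no_corner p q r X \<longleftrightarrow>
     (\<exists>X12 \<in> carrier_mat p q. \<exists>X23 \<in> carrier_mat q r.
        X = block_mat_3 (0\<^sub>m p p) X12       (0\<^sub>m p r)
                        (0\<^sub>m q p) (0\<^sub>m q q) X23
                        (0\<^sub>m r p) (0\<^sub>m r q) (0\<^sub>m r r))"

definition strictly_block_lower_no_corner :: "nat \<Rightarrow> nat \<Rightarrow> nat \<Rightarrow> 'a::zero mat \<Rightarrow> bool" where
  "strictly_block_lower_no_corner p q r X \<longleftrightarrow>
     (\<exists>X21 \<in> carrier_mat q p. \<exists>X32 \<in> carrier_mat r q.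
        X = block_mat_3 (0\<^sub>m p p) (0\<^sub>m p q) (0\<^sub>m p r)
                        X21       (0\<^sub>m q q) (0\<^sub>m q r)
                        (0\<^sub>m r p) X32       (0\<^sub>m r r))"

section \<open>Block Kronecker linearizations\<close>

definition kronecker_mat :: "'a::times mat \<Rightarrow> 'a mat \<Rightarrow> 'a mat" (infixl "\<otimes>\<^sub>K" 72) where
  "X \<otimes>\<^sub>K Y = mat (dim_row X * dim_row Y) (dim_col X * dim_col Y)
     (\<lambda>(i, j). X $$ (i div dim_row Y, j div dim_col Y) * Y $$ (i mod dim_row Y, j mod dim_col Y))"

definition E_mat :: "nat \<Rightarrow> 'a::{zero,one} mat" where
  "E_mat k = mat k (k + 1) (\<lambda>(i, j). if j = i then 1 else 0)"

definition F_mat :: "nat \<Rightarrow> 'a::{zero,one} mat" where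
  "F_mat k = mat k (k + 1) (\<lambda>(i, j). if j = i + 1 then 1 else 0)"

definition L_pencil :: "nat \<Rightarrow> 'a::comm_ring_1 poly mat" where
  "L_pencil k = const_mat (E_mat k) - [:0, 1:] \<cdot>\<^sub>m const_mat (F_mat k)"

definition Lambda_col :: "nat \<Rightarrow> 'a::comm_ring_1 poly mat" where
  "Lambda_col k = mat (k + 1) 1 (\<lambda>(i, j). monom 1 (k - i))"

definition last_unit_col :: "nat \<Rightarrow> 'a::{zero,one} mat" where
  "last_unit_col k = mat k 1 (\<lambda>(i, j). if i + 1 = k then 1 else 0)"

definition K_pencil :: "nat \<Rightarrow> nat \<Rightarrow> 'a::comm_ring_1 poly mat" where
  "K_pencil k n = L_pencil k \<otimes>\<^sub>K 1\<^sub>m n"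

definition K_hat :: "nat \<Rightarrow> nat \<Rightarrow> 'a::comm_ring_1 mat" where
  "K_hat k n = transpose_mat (last_unit_col (k + 1)) \<otimes>\<^sub>K 1\<^sub>m n"

definition block_Kronecker_pencil ::
  "nat \<Rightarrow> nat \<Rightarrow> nat \<Rightarrow> nat \<Rightarrow> nat \<Rightarrow> 'a::comm_ring_1 poly mat \<Rightarrow> 'a mat \<Rightarrow> 'a mat \<Rightarrow> 'a mat \<Rightarrow> 'a poly mat"
where
  "block_Kronecker_pencil m n l \<epsilon> \<eta> M A B C =
     block_mat_3
       M                          (const_mat (transpose_mat (K_hat \<eta> m) * C))   (transpose_mat (K_pencil \<eta> m))
       (const_mat (B * K_hat \<epsilon> n)) (const_mat A - [:0, 1:] \<cdot>\<^sub>m 1\<^sub>m l)               (0\<^sub>m l (\<eta> * m))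
       (K_pencil \<epsilon> n)              (0\<^sub>m (\<epsilon> * n) l)                                (0\<^sub>m (\<epsilon> * n) (\<eta> * m))"

definition block_Kronecker_linearization ::
  "nat \<Rightarrow> nat \<Rightarrow> nat \<Rightarrow> nat \<Rightarrow> nat \<Rightarrow> 'a::field poly fract mat \<Rightarrow>
   'a mat \<Rightarrow> 'a mat \<Rightarrow> 'a mat \<Rightarrow> 'a poly mat \<Rightarrow> 'a poly mat \<Rightarrow> 'a poly mat \<Rightarrow> bool"
where
  "block_Kronecker_linearization m n l \<epsilon> \<eta> R A B C D M S \<longleftrightarrow>
     A \<in> carrier_mat l l \<and> B \<in> carrier_mat l n \<and> C \<in> carrier_mat m l \<and>
     minimal_triple A B C \<and>
     D \<in> carrier_mat m n \<and> poly_mat_has_degree D (\<epsilon> + \<eta> + 1) \<and>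
     R = state_space_rational_mat A B C D \<and>
     M \<in> carrier_mat ((\<eta> + 1) * m) ((\<epsilon> + 1) * n) \<and> pencil M \<and>
     D = transpose_mat (Lambda_col \<eta> \<otimes>\<^sub>K 1\<^sub>m m) * M * (Lambda_col \<epsilon> \<otimes>\<^sub>K 1\<^sub>m n) \<and>
     S = block_Kronecker_pencil m n l \<epsilon> \<eta> M A B C"

end

theory Submission
  imports Defs "HOL-Analysis.Topology_Euclidean_Space"
begin

text \<open>A small perturbation of \<open>S\<close> has to be brought back to the shape of a block Kronecker pencil
  by a two-sided multiplication with constant matrices close to the identity. The three pairs of
  factors restore the shape in three stages. The first clears the blocks \<open>(2,3)\<close>, \<open>(3,2)\<close> and
  \<open>(3,3)\<close>. The second restores \<open>K\<^sub>1\<close>, \<open>K\<^sub>2\<^sup>T\<close> and the coefficient \<open>- I\<close> of \<open>\<lambda>\<close> in the block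
  \<open>(2,2)\<close>. The third moves the blocks \<open>(1,2)\<close> and \<open>(2,1)\<close> into the form of a new \<open>C\<close> and a
  new \<open>B\<close>. Block triangular factors of the right orientation keep what the earlier stages achieved.

  To first order, a stage has to solve \<open>\<Delta> = X S + S Y\<close> on the blocks it treats. Because
  \<open>L\<^sub>k(\<lambda>)\<close> is a difference of two shifts, comparing the coefficients of \<open>1\<close> and \<open>\<lambda>\<close> and
  eliminating one unknown leaves a substitution along the orbits of a shift, whose length is at most
  \<open>\<epsilon>\<close> or \<open>\<eta>\<close>. So every system has an explicit solution, with a norm bounded by a finite geometric
  sum (\<open>chain_bound\<close>); this gives \<open>solve_corner\<close>, \<open>solve_state_outer\<close>, \<open>solve_Kronecker_block\<close> and
  \<open>solve_state_inner\<close>. The bilinear term \<open>X T Y\<close> and the products of \<open>X\<close> and \<open>Y\<close> with the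
  perturbation are of second order, and an iteration that solves the same linear system for each
  remaining residual converges to an exact solution
  (\<open>perturbation_stage.exists_exact_transform\<close>). Hence a stage multiplies the size of the
  perturbation by \<open>1 + (norm X + norm Y) * norm S\<close>, up to a quadratic term, where \<open>X\<close> and \<open>Y\<close> solve the
  linear system for a perturbation of norm one.

  The factors obtained are \<open>1 + 5 s \<Sigma>\<close>, \<open>1 + 5 max \<epsilon> \<eta> \<Sigma>\<close> and \<open>1 + f\<^sub>3 \<Sigma>\<close>, where \<open>\<Sigma>\<close> is the
  spectral norm of \<open>S\<close>. The second one may exceed \<open>1 + f\<^sub>2 \<Sigma>\<close>, but \<open>f\<^sub>1 \<ge> 18 s\<close> leaves enough
  room for the product (\<open>amplification_le\<close>).

  The result is a linearization of the same kind because the remaining conditions are open: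
  minimality, since full rank is witnessed by a one-sided inverse (\<open>minimal_open\<close>), and the degree of
  \<open>D\<close>, since its leading coefficient is the coefficient of \<open>\<lambda>\<close> in the first block of \<open>M\<close>
  (\<open>degree_compressed_pencil_iff\<close>).\<close>

section \<open>Euclidean and operator norms\<close>

text \<open>All norm estimates for blocks, shifted blocks and blocks padded by zeros are instances of this one
  comparison: the nonzero entries of the first family occur, at distinct places, in the second.\<close>

lemma L2_set_reindex_le:
  assumes fin: "finite J" "finite K"
    and inj: "inj_on h {x \<in> J. g x}"
    and maps: "\<And>x. x \<in> J \<Longrightarrow> g x \<Longrightarrow> h x \<in> K"
    and le: "\<And>x. x \<in> J \<Longrightarrow> \<bar>f x\<bar> \<le> (if g x then F (h x) else 0)"
  shows "L2_set f J \<le> L2_set F K"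
proof -
  let ?G = "{x \<in> J. g x}"
  have "(\<Sum>x\<in>J. (f x)\<^sup>2) = (\<Sum>x\<in>?G. (f x)\<^sup>2)"
  proof (rule sum.mono_neutral_right[OF fin(1)])
    show "\<forall>i\<in>J - ?G. (f i)\<^sup>2 = 0"
    proof
      fix i assume "i \<in> J - ?G"
      with le[of i] show "(f i)\<^sup>2 = 0" by simp
    qed
  qed auto
  also have "\<dots> \<le> (\<Sum>x\<in>?G. (F (h x))\<^sup>2)"
  proof (rule sum_mono)
    fix x assume "x \<in> ?G"
    with le[of x] have "\<bar>f x\<bar> \<le> \<bar>F (h x)\<bar>" by auto
    then show "(f x)\<^sup>2 \<le> (F (h x))\<^sup>2" by (simp add: abs_le_square_iff)
  qed
  also have "\<dots> = (\<Sum>y\<in>h ` ?G. (F y)\<^sup>2)" using inj by (simp add: sum.reindex)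
  also have "\<dots> \<le> (\<Sum>y\<in>K. (F y)\<^sup>2)"
    by (rule sum_mono2[OF fin(2)]) (use maps in auto)
  finally show ?thesis unfolding L2_set_def by simp
qed

lemma L2_set_le_entrywise:
  assumes "finite J" "\<And>x. x \<in> J \<Longrightarrow> \<bar>f x\<bar> \<le> F x"
  shows "L2_set f J \<le> L2_set F J"
  by (rule L2_set_reindex_le[of J J id "\<lambda>_. True"]) (use assms in auto)

lemma L2_set_norm_add:
  fixes f g :: "'i \<Rightarrow> 'a::real_normed_vector"
  shows "L2_set (\<lambda>x. norm (f x + g x)) J \<le> L2_set (\<lambda>x. norm (f x)) J + L2_set (\<lambda>x. norm (g x)) J"
proof (cases "finite J")
  case True
  have "L2_set (\<lambda>x. norm (f x + g x)) J \<le> L2_set (\<lambda>x. norm (f x) + norm (g x)) J"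
    by (rule L2_set_le_entrywise[OF True]) (simp add: norm_triangle_ineq)
  also have "\<dots> \<le> L2_set (\<lambda>x. norm (f x)) J + L2_set (\<lambda>x. norm (g x)) J"
    by (rule L2_set_triangle_ineq)
  finally show ?thesis .
qed simp

lemma L2_set_norm_diff:
  fixes f g :: "'i \<Rightarrow> 'a::real_normed_vector"
  shows "L2_set (\<lambda>x. norm (f x - g x)) J \<le> L2_set (\<lambda>x. norm (f x)) J + L2_set (\<lambda>x. norm (g x)) J"
  using L2_set_norm_add[of f "\<lambda>x. - g x" J] by simp

lemma L2_set_power2: "(L2_set f J)\<^sup>2 = (\<Sum>x\<in>J. (f x)\<^sup>2)"
  unfolding L2_set_def by (simp add: sum_nonneg)

text \<open>A matrix is a function of two indices, and its size is passed separately. Blocks, among them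
  blocks without rows or columns, are then obtained by shifting indices, and no block
  operations are needed in the estimates.\<close>

definition op_bound :: "nat \<Rightarrow> nat \<Rightarrow> (nat \<Rightarrow> nat \<Rightarrow> 'a::real_normed_field) \<Rightarrow> real \<Rightarrow> bool" where
  "op_bound r c A \<rho> \<longleftrightarrow> 0 \<le> \<rho> \<and>
     (\<forall>v. L2_set (\<lambda>i. norm (\<Sum>a<c. A i a * v a)) {..<r} \<le> \<rho> * L2_set (\<lambda>a. norm (v a)) {..<c})"

lemma op_bound_nonneg: "op_bound r c A \<rho> \<Longrightarrow> 0 \<le> \<rho>"
  by (simp add: op_bound_def)

lemma L2_set_matrix_mult_le:
  assumes A: "op_bound r c A \<rho>" and J: "finite J"
  shows "L2_set (\<lambda>(i, x). norm (\<Sum>a<c. A i a * Z a x)) ({..<r} \<times> J)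
           \<le> \<rho> * L2_set (\<lambda>(a, x). norm (Z a x)) ({..<c} \<times> J)"
proof -
  have \<rho>: "0 \<le> \<rho>" using A by (simp add: op_bound_def)
  have "(L2_set (\<lambda>(i, x). norm (\<Sum>a<c. A i a * Z a x)) ({..<r} \<times> J))\<^sup>2
      = (\<Sum>x\<in>J. (L2_set (\<lambda>i. norm (\<Sum>a<c. A i a * Z a x)) {..<r})\<^sup>2)"
    unfolding L2_set_power2 by (subst sum.swap) (simp add: sum.cartesian_product case_prod_unfold)
  also have "\<dots> \<le> (\<Sum>x\<in>J. (\<rho> * L2_set (\<lambda>a. norm (Z a x)) {..<c})\<^sup>2)"
    by (rule sum_mono, rule power_mono) (use A in \<open>auto simp: op_bound_def\<close>)
  also have "\<dots> = \<rho>\<^sup>2 * (\<Sum>x\<in>J. \<Sum>a<c. (norm (Z a x))\<^sup>2)"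
    by (simp add: power_mult_distrib L2_set_power2 sum_distrib_left)
  also have "\<dots> = (\<rho> * L2_set (\<lambda>(a, x). norm (Z a x)) ({..<c} \<times> J))\<^sup>2"
    unfolding power_mult_distrib L2_set_power2
    by (subst sum.swap) (simp add: sum.cartesian_product case_prod_unfold)
  finally show ?thesis by (rule power2_le_imp_le) (simp add: \<rho>)
qed

lemma norm_sum_mult_le_L2_set:
  fixes f g :: "'i \<Rightarrow> 'a::real_normed_field"
  shows "norm (\<Sum>i\<in>J. f i * g i) \<le> L2_set (\<lambda>i. norm (f i)) J * L2_set (\<lambda>i. norm (g i)) J"
proof -
  have "norm (\<Sum>i\<in>J. f i * g i) \<le> (\<Sum>i\<in>J. \<bar>norm (f i)\<bar> * \<bar>norm (g i)\<bar>)"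
    by (rule order_trans[OF norm_sum]) (simp add: norm_mult)
  also have "\<dots> \<le> L2_set (\<lambda>i. norm (f i)) J * L2_set (\<lambda>i. norm (g i)) J"
    by (rule L2_set_mult_ineq)
  finally show ?thesis .
qed

text \<open>The transpose has the same operator norm over any field with a multiplicative norm: the
  role of the conjugate of \<open>u\<close> in \<open>u * cnj u = norm u ^ 2\<close> is played by \<open>norm u ^ 2 / u\<close>.\<close>

lemma op_bound_transpose:
  assumes A: "op_bound r c A \<rho>"
  shows "op_bound c r (\<lambda>i j. A j i) \<rho>"
  unfolding op_bound_def
proof (intro conjI allI)
  show \<rho>: "0 \<le> \<rho>" using A by (simp add: op_bound_def)
  fix v :: "nat \<Rightarrow> 'a"
  define u where "u j = (\<Sum>i<r. A i j * v i)" for j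
  define x where "x j = of_real ((norm (u j))\<^sup>2) / u j" for j
  let ?U = "L2_set (\<lambda>j. norm (u j)) {..<c}" and ?V = "L2_set (\<lambda>i. norm (v i)) {..<r}"
  have nx: "norm (x j) = norm (u j)" for j
    by (simp add: x_def norm_divide norm_mult power2_eq_square)
  have ux: "u j * x j = of_real ((norm (u j))\<^sup>2)" for j
    by (cases "u j = 0") (simp_all add: x_def)
  have "?U\<^sup>2 = norm (\<Sum>j<c. u j * x j)"
    unfolding ux by (simp only: of_real_sum[symmetric] norm_of_real L2_set_power2)
      (simp add: sum_nonneg)
  also have "(\<Sum>j<c. u j * x j) = (\<Sum>i<r. v i * (\<Sum>j<c. A i j * x j))"
    unfolding u_def sum_distrib_left sum_distrib_right
    by (subst sum.swap) (simp add: mult_ac)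
  also have "norm \<dots> \<le> ?V * L2_set (\<lambda>i. norm (\<Sum>j<c. A i j * x j)) {..<r}"
    by (rule norm_sum_mult_le_L2_set)
  also have "\<dots> \<le> ?V * (\<rho> * L2_set (\<lambda>j. norm (x j)) {..<c})"
    by (rule mult_left_mono) (use A in \<open>auto simp: op_bound_def\<close>)
  also have "\<dots> = (\<rho> * ?V) * ?U" by (simp add: nx)
  finally have "?U * ?U \<le> (\<rho> * ?V) * ?U" by (simp add: power2_eq_square)
  then have "?U \<le> \<rho> * ?V"
    using \<rho> L2_set_nonneg[of "\<lambda>j. norm (u j)" "{..<c}"]
    by (cases "?U = 0") (auto simp: mult_le_cancel_right order_less_le)
  then show "L2_set (\<lambda>i. norm (\<Sum>a<r. A a i * v a)) {..<c} \<le> \<rho> * ?V"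
    by (simp add: u_def)
qed

lemma op_bound_frobenius:
  "op_bound r c A (L2_set (\<lambda>(i, j). norm (A i j)) ({..<r} \<times> {..<c}))"
  unfolding op_bound_def
proof (intro conjI allI)
  fix v :: "nat \<Rightarrow> 'a"
  let ?V = "L2_set (\<lambda>a. norm (v a)) {..<c}"
  have "(L2_set (\<lambda>i. norm (\<Sum>a<c. A i a * v a)) {..<r})\<^sup>2
      \<le> (\<Sum>i<r. (L2_set (\<lambda>a. norm (A i a)) {..<c} * ?V)\<^sup>2)"
    unfolding L2_set_power2[of _ "{..<r}"]
    by (intro sum_mono power_mono norm_sum_mult_le_L2_set) auto
  also have "\<dots> = (\<Sum>i<r. \<Sum>a<c. (norm (A i a))\<^sup>2) * ?V\<^sup>2"
    by (simp add: power_mult_distrib L2_set_power2 sum_distrib_right)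
  also have "\<dots> = (L2_set (\<lambda>(i, j). norm (A i j)) ({..<r} \<times> {..<c}) * ?V)\<^sup>2"
    unfolding power_mult_distrib L2_set_power2
    by (simp add: sum.cartesian_product case_prod_unfold)
  finally show "L2_set (\<lambda>i. norm (\<Sum>a<c. A i a * v a)) {..<r}
      \<le> L2_set (\<lambda>(i, j). norm (A i j)) ({..<r} \<times> {..<c}) * ?V"
    by (rule power2_le_imp_le) simp
qed simp

text \<open>The Frobenius norm bounds the set under the supremum, so the supremum is an upper bound on the unit
  ball; scaling extends the estimate to all vectors.\<close>

lemma op_bound_spectral_norm:
  fixes X :: "'a::real_normed_field mat"
  assumes X: "X \<in> carrier_mat r c"
  shows "op_bound r c (\<lambda>i j. X $$ (i, j)) (spectral_norm X)"
proof -
  let ?A = "\<lambda>i j. X $$ (i, j)" and ?ball = "{v \<in> carrier_vec (dim_col X). euclidean_norm v \<le> 1}"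
  have app: "euclidean_norm (X *\<^sub>v Matrix.vec c v) = L2_set (\<lambda>i. norm (\<Sum>a<c. ?A i a * v a)) {..<r}" for v
    unfolding euclidean_norm_def using X
    by (auto intro!: L2_set_cong simp: scalar_prod_def row_def lessThan_atLeast0)
  have vn: "euclidean_norm (Matrix.vec c v) = L2_set (\<lambda>a. norm (v a)) {..<c}" for v :: "nat \<Rightarrow> 'a"
    unfolding euclidean_norm_def by (auto intro!: L2_set_cong)
  have fro: "L2_set (\<lambda>i. norm (\<Sum>a<c. ?A i a * v a)) {..<r}
      \<le> L2_set (\<lambda>(i, j). norm (?A i j)) ({..<r} \<times> {..<c}) * L2_set (\<lambda>a. norm (v a)) {..<c}" for v
    using op_bound_frobenius[of r c ?A] by (auto simp: op_bound_def)
  have bdd: "bdd_above ((\<lambda>v. euclidean_norm (X *\<^sub>v v)) ` ?ball)"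
  proof (rule bdd_aboveI2)
    fix v :: "'a Matrix.vec" assume v: "v \<in> ?ball"
    then have "v = Matrix.vec c (\<lambda>i. v $ i)" using X by auto
    with app[of "\<lambda>i. v $ i"] fro[of "\<lambda>i. v $ i"] vn[of "\<lambda>i. v $ i"] v
    show "euclidean_norm (X *\<^sub>v v) \<le> L2_set (\<lambda>(i, j). norm (?A i j)) ({..<r} \<times> {..<c}) * 1"
      by (metis (no_types, lifting) L2_set_nonneg mem_Collect_eq mult_left_mono order_trans)
  qed
  have up: "L2_set (\<lambda>i. norm (\<Sum>a<c. ?A i a * v a)) {..<r} \<le> spectral_norm X"
    if "L2_set (\<lambda>a. norm (v a)) {..<c} \<le> 1" for v
    unfolding app[symmetric] spectral_norm_def
    by (rule cSUP_upper[OF _ bdd]) (use that X in \<open>auto simp: vn\<close>)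
  show ?thesis unfolding op_bound_def
  proof (intro conjI allI)
    show "0 \<le> spectral_norm X" using up[of "\<lambda>_. 0"] by (simp add: L2_set_def)
    fix v :: "nat \<Rightarrow> 'a"
    let ?t = "L2_set (\<lambda>a. norm (v a)) {..<c}"
    show "L2_set (\<lambda>i. norm (\<Sum>a<c. ?A i a * v a)) {..<r} \<le> spectral_norm X * ?t"
    proof (cases "?t = 0")
      case True
      with fro[of v] show ?thesis by simp
    next
      case False
      then have t: "?t > 0" by (simp add: order_less_le)
      define w where "w a = of_real (1 / ?t) * v a" for a
      have "L2_set (\<lambda>a. norm (w a)) {..<c} = 1"
        using t L2_set_right_distrib[of "1 / ?t" "\<lambda>a. norm (v a)" "{..<c}"]
        by (simp add: w_def norm_mult norm_divide)
      from up[of w] this have "L2_set (\<lambda>i. norm (\<Sum>a<c. ?A i a * w a)) {..<r} \<le> spectral_norm X"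
        by simp
      also have "(\<lambda>i. norm (\<Sum>a<c. ?A i a * w a)) = (\<lambda>i. 1 / ?t * norm (\<Sum>a<c. ?A i a * v a))"
      proof
        fix i
        have "(\<Sum>a<c. ?A i a * w a) = of_real (1 / ?t) * (\<Sum>a<c. ?A i a * v a)"
          unfolding w_def sum_distrib_left by (simp add: mult_ac)
        then show "norm (\<Sum>a<c. ?A i a * w a) = 1 / ?t * norm (\<Sum>a<c. ?A i a * v a)"
          using t by (simp add: norm_mult norm_divide)
      qed
      finally show ?thesis using t
        using L2_set_right_distrib[of "1 / ?t" "\<lambda>i. norm (\<Sum>a<c. ?A i a * v a)" "{..<r}"]
        by (simp add: field_simps)
    qed
  qed
qed

section \<open>Chain equations\<close>

text \<open>The map \<open>h\<close> lowers the height \<open>ht\<close>, so unfolding the recursion stops after \<open>N\<close> steps and the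
  solution is \<open>H\<close> plus at most \<open>N - 1\<close> transported copies of it. Injectivity of \<open>h\<close> makes the
  transport a reindexing, so each step costs only the factor \<open>\<rho>\<close> in the Euclidean norm over the whole
  index set. The induction is on the height up to which the entries are counted.\<close>

lemma chain_bound:
  fixes A :: "nat \<Rightarrow> nat \<Rightarrow> 'a::real_normed_field" and X H :: "nat \<Rightarrow> 'c \<Rightarrow> 'a" and ht :: "'c \<Rightarrow> nat"
  assumes A: "op_bound l l A \<rho>" and J: "finite J"
    and step: "\<And>x. x \<in> J \<Longrightarrow> g x \<Longrightarrow> h x \<in> J \<and> ht (h x) < ht x"
    and inj: "inj_on h {x \<in> J. g x}"
    and ht: "\<And>x. x \<in> J \<Longrightarrow> ht x < N"
    and X: "\<And>i x. i < l \<Longrightarrow> x \<in> J \<Longrightarrow> X i x = H i x + (if g x then \<Sum>a<l. A i a * X a (h x) else 0)"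
  shows "L2_set (\<lambda>(i, x). norm (X i x)) ({..<l} \<times> J)
           \<le> (\<Sum>t<N. \<rho> ^ t) * L2_set (\<lambda>(i, x). norm (H i x)) ({..<l} \<times> J)"
proof -
  let ?H = "L2_set (\<lambda>(i, x). norm (H i x)) ({..<l} \<times> J)"
  have \<rho>: "0 \<le> \<rho>" using A by (simp add: op_bound_def)
  have "L2_set (\<lambda>(i, x). norm (X i x)) ({..<l} \<times> {x \<in> J. ht x < k}) \<le> (\<Sum>t<k. \<rho> ^ t) * ?H" for k
  proof (induction k)
    case 0
    then show ?case by simp
  next
    case (Suc k)
    let ?J = "\<lambda>k. {x \<in> J. ht x < k}"
    define U where "U i x = (if g x then \<Sum>a<l. A i a * X a (h x) else 0)" for i x
    have fin: "finite ({..<l} \<times> ?J k)" for k using J by auto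
    have "L2_set (\<lambda>(i, x). norm (X i x)) ({..<l} \<times> ?J (Suc k))
        = L2_set (\<lambda>z. norm (case_prod H z + case_prod U z)) ({..<l} \<times> ?J (Suc k))"
      by (rule L2_set_cong) (auto simp: X U_def)
    also have "\<dots> \<le> L2_set (\<lambda>z. norm (case_prod H z)) ({..<l} \<times> ?J (Suc k))
        + L2_set (\<lambda>z. norm (case_prod U z)) ({..<l} \<times> ?J (Suc k))"
      by (rule L2_set_norm_add)
    also have "L2_set (\<lambda>z. norm (case_prod H z)) ({..<l} \<times> ?J (Suc k)) \<le> ?H"
      by (rule L2_set_reindex_le[where h = id and g = "\<lambda>_. True"]) (use J in auto)
    also have "L2_set (\<lambda>z. norm (case_prod U z)) ({..<l} \<times> ?J (Suc k))
       \<le> L2_set (\<lambda>(i, x). norm (\<Sum>a<l. A i a * X a x)) ({..<l} \<times> ?J k)"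
    proof (rule L2_set_reindex_le[where h = "\<lambda>(i, x). (i, h x)" and g = "\<lambda>(i, x). g x"])
      show "inj_on (\<lambda>(i, x). (i, h x)) {x \<in> {..<l} \<times> ?J (Suc k). case x of (i, x) \<Rightarrow> g x}"
        using inj by (auto simp: inj_on_def)
      show "\<And>x. x \<in> {..<l} \<times> ?J (Suc k) \<Longrightarrow> (case x of (i, x) \<Rightarrow> g x) \<Longrightarrow>
         (case x of (i, x) \<Rightarrow> (i, h x)) \<in> {..<l} \<times> ?J k"
        using step by fastforce
    qed (auto simp: U_def J)
    also have "\<dots> \<le> \<rho> * L2_set (\<lambda>(a, x). norm (X a x)) ({..<l} \<times> ?J k)"
      by (rule L2_set_matrix_mult_le[OF A]) (use J in auto)
    also have "\<dots> \<le> \<rho> * ((\<Sum>t<k. \<rho> ^ t) * ?H)"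
      by (rule mult_left_mono[OF Suc.IH \<rho>])
    also have "?H + \<rho> * ((\<Sum>t<k. \<rho> ^ t) * ?H) = (\<Sum>t<Suc k. \<rho> ^ t) * ?H"
      by (subst sum.lessThan_Suc_shift) (simp add: sum_distrib_left algebra_simps)
    finally show ?case by simp
  qed
  from this[of N] have "L2_set (\<lambda>(i, x). norm (X i x)) ({..<l} \<times> {x \<in> J. ht x < N})
      \<le> (\<Sum>t<N. \<rho> ^ t) * ?H" .
  moreover have "{x \<in> J. ht x < N} = J" using ht by auto
  ultimately show ?thesis by simp
qed

text \<open>Iterating the right-hand side from zero becomes stationary at heights below \<open>k\<close> after \<open>k\<close> rounds.\<close>

lemma chain_exists:
  fixes A :: "nat \<Rightarrow> nat \<Rightarrow> 'a::comm_ring_1" and H :: "nat \<Rightarrow> 'c \<Rightarrow> 'a" and ht :: "'c \<Rightarrow> nat"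
  assumes step: "\<And>x. x \<in> J \<Longrightarrow> g x \<Longrightarrow> h x \<in> J \<and> ht (h x) < ht x"
    and ht: "\<And>x. x \<in> J \<Longrightarrow> ht x < N"
  shows "\<exists>X. \<forall>i<l. \<forall>x\<in>J. X i x = H i x + (if g x then \<Sum>a<l. A i a * X a (h x) else 0)"
proof -
  define F where "F Z = (\<lambda>i x. H i x + (if g x then \<Sum>a<l. A i a * Z a (h x) else 0))" for Z
  define Z where "Z k = (F ^^ k) (\<lambda>_ _. 0)" for k
  have Z: "Z (Suc k) = F (Z k)" for k by (simp add: Z_def)
  have "\<forall>x\<in>J. ht x < k \<longrightarrow> (\<forall>i. Z (Suc k) i x = Z k i x)" for k
  proof (induction k)
    case (Suc k)
    show ?case
    proof (intro ballI impI allI)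
      fix x i assume x: "x \<in> J" "ht x < Suc k"
      have "Z (Suc k) a (h x) = Z k a (h x)" if "g x" for a
        using Suc step[OF x(1) that] x by auto
      then have "F (Z (Suc k)) i x = F (Z k) i x" by (simp add: F_def)
      then show "Z (Suc (Suc k)) i x = Z (Suc k) i x" by (simp only: Z)
    qed
  qed simp
  then have "Z N i x = F (Z N) i x" if "x \<in> J" for i x using ht that Z by metis
  then show ?thesis unfolding F_def by blast
qed

section \<open>Two-sided perturbation of a pencil\<close>

abbreviation fro :: "nat \<Rightarrow> nat \<Rightarrow> (nat \<Rightarrow> nat \<Rightarrow> 'a::real_normed_vector) \<Rightarrow> real" where
  "fro r c X \<equiv> L2_set (\<lambda>(i, j). norm (X i j)) ({..<r} \<times> {..<c})"

text \<open>A pencil is given by its coefficients \<open>T 0\<close> and \<open>T 1\<close> of \<open>1\<close> and \<open>\<lambda>\<close>; other indices are ignored.\<close>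

definition pfro :: "nat \<Rightarrow> nat \<Rightarrow> (nat \<Rightarrow> nat \<Rightarrow> nat \<Rightarrow> 'a::real_normed_vector) \<Rightarrow> real" where
  "pfro r c T = L2_set (\<lambda>k. fro r c (T k)) {..<2}"

definition lmul :: "nat \<Rightarrow> (nat \<Rightarrow> nat \<Rightarrow> 'a::comm_ring_1) \<Rightarrow> (nat \<Rightarrow> nat \<Rightarrow> nat \<Rightarrow> 'a) \<Rightarrow> nat \<Rightarrow> nat \<Rightarrow> nat \<Rightarrow> 'a" where
  "lmul r X T k i j = (\<Sum>a<r. X i a * T k a j)"

definition rmul :: "nat \<Rightarrow> (nat \<Rightarrow> nat \<Rightarrow> nat \<Rightarrow> 'a::comm_ring_1) \<Rightarrow> (nat \<Rightarrow> nat \<Rightarrow> 'a) \<Rightarrow> nat \<Rightarrow> nat \<Rightarrow> nat \<Rightarrow> 'a" where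
  "rmul c T Y k i j = (\<Sum>b<c. T k i b * Y b j)"

text \<open>The entries of \<open>(I - X) T (I - Y)\<close>, multiplied out.\<close>

definition transform where
  "transform r c X T Y k i j =
     T k i j - lmul r X T k i j - rmul c T Y k i j + rmul c (lmul r X T) Y k i j"

text \<open>What remains of the perturbation \<open>\<Delta>\<close> of \<open>S\<close> after \<open>(I - X) (S + \<Delta>) (I - Y)\<close>, up to terms of second
  order.\<close>

definition linear_defect where
  "linear_defect r c S \<Delta> X Y k i j = \<Delta> k i j - lmul r X S k i j - rmul c S Y k i j"

text \<open>Prescribed zero patterns are encoded by predicates on the indices that may carry nonzero entries.\<close>

definition mat_supp where
  "mat_supp r c V X \<longleftrightarrow> (\<forall>i<r. \<forall>j<c. \<not> V i j \<longrightarrow> X i j = 0)"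

definition pencil_supp where
  "pencil_supp r c W T \<longleftrightarrow> (\<forall>k<2. \<forall>i<r. \<forall>j<c. \<not> W k i j \<longrightarrow> T k i j = 0)"

lemma pfro_nonneg [simp]: "0 \<le> pfro r c T"
  by (simp add: pfro_def)

lemma pfro_eq_sqrt: "pfro r c T = sqrt ((fro r c (T 0))\<^sup>2 + (fro r c (T 1))\<^sup>2)"
  by (simp add: pfro_def L2_set_def numeral_2_eq_2)

lemma fro_add: "fro r c (\<lambda>i j. X i j + Y i j) \<le> fro r c X + fro r c Y"
  using L2_set_norm_add[of "case_prod X" "case_prod Y" "{..<r} \<times> {..<c}"]
  by (simp add: case_prod_unfold)

lemma fro_mono:
  "(\<And>i j. i < r \<Longrightarrow> j < c \<Longrightarrow> norm (X i j) \<le> norm (Y i j)) \<Longrightarrow> fro r c X \<le> fro r c Y"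
  by (rule L2_set_le_entrywise) auto

lemma pfro_mono:
  assumes "\<And>k i j. k < 2 \<Longrightarrow> i < r \<Longrightarrow> j < c \<Longrightarrow> norm (T k i j) \<le> norm (U k i j)"
  shows "pfro r c T \<le> pfro r c U"
  unfolding pfro_def by (rule L2_set_mono[OF fro_mono]) (use assms in auto)

lemma pfro_add: "pfro r c (\<lambda>k i j. T k i j + U k i j) \<le> pfro r c T + pfro r c U"
proof -
  have "pfro r c (\<lambda>k i j. T k i j + U k i j) \<le> L2_set (\<lambda>k. fro r c (T k) + fro r c (U k)) {..<2}"
    unfolding pfro_def by (rule L2_set_mono) (auto intro: fro_add)
  also have "\<dots> \<le> pfro r c T + pfro r c U"
    unfolding pfro_def by (rule L2_set_triangle_ineq)
  finally show ?thesis .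
qed

lemma pfro_uminus [simp]: "pfro r c (\<lambda>k i j. - T k i j) = pfro r c T"
  by (simp add: pfro_def)

lemma pfro_diff: "pfro r c (\<lambda>k i j. T k i j - U k i j) \<le> pfro r c T + pfro r c U"
  using pfro_add[of r c T "\<lambda>k i j. - U k i j"] by simp

lemma norm_le_fro: "i < r \<Longrightarrow> j < c \<Longrightarrow> norm (X i j) \<le> fro r c X"
  using member_le_L2_set[of "{..<r} \<times> {..<c}" "(i, j)" "\<lambda>(i, j). norm (X i j)"] by simp

lemma fro_le_pfro: "k < 2 \<Longrightarrow> fro r c (T k) \<le> pfro r c T"
  unfolding pfro_def by (rule member_le_L2_set[of "{..<2}" k "\<lambda>k. fro r c (T k)", simplified])

lemma norm_le_pfro: "k < 2 \<Longrightarrow> i < r \<Longrightarrow> j < c \<Longrightarrow> norm (T k i j) \<le> pfro r c T"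
  using norm_le_fro[of i r j c "T k"] fro_le_pfro[of k T r c] by linarith

lemma fro_transpose: "fro r c (\<lambda>i j. X j i) = fro c r X"
  unfolding L2_set_def
  by (intro arg_cong[of _ _ sqrt] sum.reindex_bij_witness[of _ prod.swap prod.swap]) auto

lemma fro_mult_left_le:
  "op_bound r c' A \<rho> \<Longrightarrow> fro r c (\<lambda>i j. \<Sum>a<c'. A i a * Z a j) \<le> \<rho> * fro c' c Z"
  by (rule L2_set_matrix_mult_le) auto

lemma fro_mult_right_le:
  assumes "op_bound c' c A \<rho>"
  shows "fro r c (\<lambda>i j. \<Sum>a<c'. Z i a * A a j) \<le> \<rho> * fro r c' Z"
proof -
  have "fro r c (\<lambda>i j. \<Sum>a<c'. Z i a * A a j) = fro c r (\<lambda>j i. \<Sum>a<c'. A a j * Z i a)"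
    using fro_transpose[where r = c and c = r and X = "\<lambda>i j. \<Sum>a<c'. Z i a * A a j"] by (simp add: mult.commute)
  also have "\<dots> \<le> \<rho> * fro c' r (\<lambda>a i. Z i a)"
    by (rule fro_mult_left_le[OF op_bound_transpose[OF assms]])
  finally show ?thesis using fro_transpose[where r = c' and c = r and X = Z] by simp
qed

lemma pfro_lmul_spectral:
  assumes "\<And>k. k < 2 \<Longrightarrow> op_bound r c (S k) (\<sigma> k)"
  shows "pfro r c (lmul r X S) \<le> fro r r X * L2_set \<sigma> {..<2}"
proof -
  have "pfro r c (lmul r X S) \<le> L2_set (\<lambda>k. fro r r X * \<sigma> k) {..<2}"
    unfolding pfro_def lmul_def
    by (rule L2_set_mono) (use fro_mult_right_le[OF assms, where r = r and Z = X] in \<open>auto simp: mult.commute[of _ "fro r r X"]\<close>)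
  also have "\<dots> = fro r r X * L2_set \<sigma> {..<2}"
    by (simp add: L2_set_right_distrib)
  finally show ?thesis .
qed

lemma pfro_rmul_spectral:
  assumes "\<And>k. k < 2 \<Longrightarrow> op_bound r c (S k) (\<sigma> k)"
  shows "pfro r c (rmul c S Y) \<le> fro c c Y * L2_set \<sigma> {..<2}"
proof -
  have "pfro r c (rmul c S Y) \<le> L2_set (\<lambda>k. fro c c Y * \<sigma> k) {..<2}"
    unfolding pfro_def rmul_def
    by (rule L2_set_mono) (use fro_mult_left_le[OF assms, where c = c and Z = Y] in \<open>auto simp: mult.commute[of _ "fro c c Y"]\<close>)
  also have "\<dots> = fro c c Y * L2_set \<sigma> {..<2}"
    by (simp add: L2_set_right_distrib)
  finally show ?thesis .
qed

lemma pfro_lmul: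
  fixes X :: "nat \<Rightarrow> nat \<Rightarrow> 'a::real_normed_field"
  shows "pfro r c (lmul r X T) \<le> fro r r X * pfro r c T"
  using pfro_lmul_spectral[of r c T "\<lambda>k. fro r c (T k)" X] op_bound_frobenius
  by (auto simp: pfro_def)

lemma pfro_rmul:
  fixes Y :: "nat \<Rightarrow> nat \<Rightarrow> 'a::real_normed_field"
  shows "pfro r c (rmul c T Y) \<le> fro c c Y * pfro r c T"
  using pfro_rmul_spectral[of r c T "\<lambda>k. fro r c (T k)" Y] op_bound_frobenius
  by (auto simp: pfro_def)

text \<open>How an approximate transformation changes under a correction \<open>(U, V)\<close>: the linear
  response at \<open>S\<close>, and products of the correction with \<open>X\<close>, \<open>Y + V\<close> or \<open>\<Delta>\<close>.\<close>

lemma transform_add: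
  fixes T :: "nat \<Rightarrow> nat \<Rightarrow> nat \<Rightarrow> 'a::comm_ring_1"
  assumes T: "\<And>k i j. T k i j = S k i j + \<Delta> k i j"
  shows "transform r c (\<lambda>i a. X i a + U i a) T (\<lambda>b j. Y b j + V b j) k i j =
    transform r c X T Y k i j - lmul r U S k i j - rmul c S V k i j
    + (rmul c (lmul r U T) (\<lambda>b j. Y b j + V b j) k i j + rmul c (lmul r X T) V k i j
       - lmul r U \<Delta> k i j - rmul c \<Delta> V k i j)"
  unfolding transform_def lmul_def rmul_def T
  by (simp add: distrib_left distrib_right sum.distrib)

lemma tendsto_fro_le:
  assumes "\<And>i j. i < r \<Longrightarrow> j < c \<Longrightarrow> (\<lambda>k. Z k i j) \<longlonglongrightarrow> X i j" and "\<And>k. k \<ge> k0 \<Longrightarrow> fro r c (Z k) \<le> b"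
  shows "fro r c X \<le> b"
proof (rule LIMSEQ_le_const2)
  show "(\<lambda>k. fro r c (Z k)) \<longlonglongrightarrow> fro r c X"
    unfolding L2_set_def case_prod_unfold
    by (intro tendsto_intros) (use assms(1) in auto)
qed (use assms(2) in auto)

lemma tendsto_pfro_le:
  assumes "\<And>k i j. k < 2 \<Longrightarrow> i < r \<Longrightarrow> j < c \<Longrightarrow> (\<lambda>t. Z t k i j) \<longlonglongrightarrow> T k i j"
    and "\<And>t. t \<ge> t0 \<Longrightarrow> pfro r c (Z t) \<le> b"
  shows "pfro r c T \<le> b"
proof (rule LIMSEQ_le_const2)
  show "(\<lambda>t. pfro r c (Z t)) \<longlonglongrightarrow> pfro r c T"
    unfolding pfro_def L2_set_def case_prod_unfold
    by (intro tendsto_intros) (use assms(1) in auto)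
qed (use assms(2) in auto)

text \<open>One stage receives perturbations supported on \<open>D\<close> and leaves perturbations supported on \<open>W\<close>, using
  factors supported on \<open>VX\<close> and \<open>VY\<close>. Assumption \<open>linear\<close> is the solvability of the linearized problem
  with its norm bounds. The closure assumptions say that the second-order terms stay in the class \<open>D\<close> of
  perturbations for which the linearized problem can be solved, so that it can be applied to them
  again.\<close>

locale perturbation_stage =
  fixes r c :: nat
    and S :: "nat \<Rightarrow> nat \<Rightarrow> nat \<Rightarrow> 'a::{real_normed_field, banach}"
    and VX VY :: "nat \<Rightarrow> nat \<Rightarrow> bool" and D W :: "nat \<Rightarrow> nat \<Rightarrow> nat \<Rightarrow> bool"
    and b f :: real
  assumes b: "0 \<le> b" and f: "0 \<le> f"
    and linear: "\<And>\<Delta>. pencil_supp r c D \<Delta> \<Longrightarrow> \<exists>X Y. mat_supp r r VX X \<and> mat_supp c c VY Y \<and>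
        fro r r X \<le> b * pfro r c \<Delta> \<and> fro c c Y \<le> b * pfro r c \<Delta> \<and>
        pencil_supp r c W (linear_defect r c S \<Delta> X Y) \<and>
        pfro r c (linear_defect r c S \<Delta> X Y) \<le> f * pfro r c \<Delta>"
    and closed_l: "\<And>(X :: nat \<Rightarrow> nat \<Rightarrow> 'a) \<Delta>. mat_supp r r VX X \<Longrightarrow> pencil_supp r c D \<Delta> \<Longrightarrow> pencil_supp r c D (lmul r X \<Delta>)"
    and closed_r: "\<And>(Y :: nat \<Rightarrow> nat \<Rightarrow> 'a) \<Delta>. mat_supp c c VY Y \<Longrightarrow> pencil_supp r c D \<Delta> \<Longrightarrow> pencil_supp r c D (rmul c \<Delta> Y)"
    and closed_lr: "\<And>X Y. mat_supp r r VX X \<Longrightarrow> mat_supp c c VY Y \<Longrightarrow>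
        pencil_supp r c D (rmul c (lmul r X S) Y)"
begin

definition "rate = 4 * b\<^sup>2 * (pfro r c S + 1) + 2 * b"

lemma rate_nonneg: "0 \<le> rate"
  using b by (simp add: rate_def)

text \<open>The linearized problem at the fixed pencil \<open>S\<close> is solved repeatedly, each time for the residual \<open>E\<close> that
  is still to be treated; the corrections are added up in \<open>X\<close> and \<open>Y\<close>, and the part \<open>L\<close> of the result
  already supported on \<open>W\<close> is set aside. The new residual consists of products of the correction with
  \<open>X\<close>, \<open>Y\<close> or \<open>\<Delta>\<close>, so its norm is at most \<open>rate * d\<close> times that of the old one, and the corrections form
  a convergent series. Only the first solution contributes to \<open>L\<close> at first order: the later ones
  add at most twice \<open>f * e 1\<close>, which is quadratic in \<open>d\<close>.\<close>

lemma exists_exact_transform: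
  assumes \<Delta>: "pencil_supp r c D \<Delta>" and small: "pfro r c \<Delta> \<le> 1" "rate * pfro r c \<Delta> \<le> 1 / 2"
  shows "\<exists>X Y. mat_supp r r VX X \<and> mat_supp c c VY Y \<and>
      fro r r X \<le> 2 * b * pfro r c \<Delta> \<and> fro c c Y \<le> 2 * b * pfro r c \<Delta> \<and>
      pencil_supp r c W (\<lambda>k i j. transform r c X (\<lambda>k i j. S k i j + \<Delta> k i j) Y k i j - S k i j) \<and>
      pfro r c (\<lambda>k i j. transform r c X (\<lambda>k i j. S k i j + \<Delta> k i j) Y k i j - S k i j)
        \<le> f * pfro r c \<Delta> + 2 * f * rate * (pfro r c \<Delta>)\<^sup>2"
proof -
  define d where "d = pfro r c \<Delta>"
  define T where "T = (\<lambda>k i j. S k i j + \<Delta> k i j)"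
  have d0: "0 \<le> d" by (simp add: d_def)
  have "\<forall>E. \<exists>Z. pencil_supp r c D E \<longrightarrow> mat_supp r r VX (fst Z) \<and> mat_supp c c VY (snd Z) \<and>
      fro r r (fst Z) \<le> b * pfro r c E \<and> fro c c (snd Z) \<le> b * pfro r c E \<and>
      pencil_supp r c W (linear_defect r c S E (fst Z) (snd Z)) \<and>
      pfro r c (linear_defect r c S E (fst Z) (snd Z)) \<le> f * pfro r c E"
    using linear by auto
  from choice[OF this] obtain g where g: "\<forall>E. pencil_supp r c D E \<longrightarrow>
      mat_supp r r VX (fst (g E)) \<and> mat_supp c c VY (snd (g E)) \<and>
      fro r r (fst (g E)) \<le> b * pfro r c E \<and> fro c c (snd (g E)) \<le> b * pfro r c E \<and>
      pencil_supp r c W (linear_defect r c S E (fst (g E)) (snd (g E))) \<and>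
      pfro r c (linear_defect r c S E (fst (g E)) (snd (g E))) \<le> f * pfro r c E" ..
  define gX where "gX E = fst (g E)" for E
  define gY where "gY E = snd (g E)" for E
  have
    gX: "\<And>E. pencil_supp r c D E \<Longrightarrow> mat_supp r r VX (gX E)" and
    gY: "\<And>E. pencil_supp r c D E \<Longrightarrow> mat_supp c c VY (gY E)" and
    nX: "\<And>E. pencil_supp r c D E \<Longrightarrow> fro r r (gX E) \<le> b * pfro r c E" and
    nY: "\<And>E. pencil_supp r c D E \<Longrightarrow> fro c c (gY E) \<le> b * pfro r c E" and
    W: "\<And>E. pencil_supp r c D E \<Longrightarrow> pencil_supp r c W (linear_defect r c S E (gX E) (gY E))" and
    nW: "\<And>E. pencil_supp r c D E \<Longrightarrow> pfro r c (linear_defect r c S E (gX E) (gY E)) \<le> f * pfro r c E"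
    using g unfolding gX_def gY_def by simp_all
  define N where "N = (\<lambda>X Y U V k i j.
      rmul c (lmul r U T) (\<lambda>b j. Y b j + V b j) k i j + rmul c (lmul r X T) V k i j
       - lmul r U \<Delta> k i j - rmul c \<Delta> V k i j)"
  define step where "step = (\<lambda>(X, Y, E). ((\<lambda>i a. X i a + gX E i a), (\<lambda>b j. Y b j + gY E b j),
      N X Y (gX E) (gY E)))"
  define st where "st k = (step ^^ k) ((\<lambda>_ _. 0), (\<lambda>_ _. 0), \<Delta>)" for k
  define X where "X k = fst (st k)" for k
  define Y where "Y k = fst (snd (st k))" for k
  define E where "E k = snd (snd (st k))" for k
  define L where "L t k i j = transform r c (X t) T (Y t) k i j - S k i j - E t k i j" for t k i j
  have st: "st (Suc k) = step (st k)" for k by (simp add: st_def)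
  have X0: "X 0 = (\<lambda>_ _. 0)" and Y0: "Y 0 = (\<lambda>_ _. 0)" and E0: "E 0 = \<Delta>"
    by (simp_all add: X_def Y_def E_def st_def)
  have XS: "X (Suc k) = (\<lambda>i a. X k i a + gX (E k) i a)"
    and YS: "Y (Suc k) = (\<lambda>i a. Y k i a + gY (E k) i a)"
    and ES: "E (Suc k) = N (X k) (Y k) (gX (E k)) (gY (E k))" for k
    by (simp_all add: X_def Y_def E_def st step_def case_prod_unfold)
  have LS: "L (Suc t) k i j = L t k i j + linear_defect r c S (E t) (gX (E t)) (gY (E t)) k i j" for t k i j
    unfolding L_def XS YS
    by (subst transform_add[where S = S and \<Delta> = \<Delta>])
       (simp_all add: T_def ES N_def linear_defect_def)
  have L0: "L 0 k i j = 0" for k i j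
    by (simp add: L_def X0 Y0 E0 transform_def lmul_def rmul_def T_def)
  define e where "e k = pfro r c (E k)" for k
  have e0: "0 \<le> e k" for k by (simp add: e_def)
  have pT: "pfro r c T \<le> pfro r c S + 1"
    using pfro_add[of r c S \<Delta>] small(1) by (simp add: T_def)
  have addD: "pencil_supp r c D (\<lambda>k i j. P k i j + Q k i j)" "pencil_supp r c D (\<lambda>k i j. P k i j - Q k i j)"
    if "pencil_supp r c D P" "pencil_supp r c D Q" for P Q :: "nat \<Rightarrow> nat \<Rightarrow> nat \<Rightarrow> 'a"
    using that by (auto simp: pencil_supp_def)
  have addM: "mat_supp p q V (\<lambda>i j. P i j + Q i j)"
    if "mat_supp p q V P" "mat_supp p q V Q" for p q V and P Q :: "nat \<Rightarrow> nat \<Rightarrow> 'a"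
    using that by (auto simp: mat_supp_def)
  have lrT: "pencil_supp r c D (rmul c (lmul r U T) V)" if "mat_supp r r VX U" "mat_supp c c VY V" for U V
  proof -
    have "rmul c (lmul r U T) V = (\<lambda>k i j. rmul c (lmul r U S) V k i j + rmul c (lmul r U \<Delta>) V k i j)"
      by (simp add: rmul_def lmul_def T_def distrib_left distrib_right sum.distrib fun_eq_iff)
    then show ?thesis
      using addD(1)[OF closed_lr[OF that] closed_r[OF that(2) closed_l[OF that(1) \<Delta>]]] by simp
  qed
  \<comment> \<open>The slack \<open>2 * b * e k\<close> pays for all corrections still to come, as the residuals halve.\<close>
  have next_e: "e (Suc k) \<le> rate * d * e k"
    if supp: "mat_supp r r VX (X k)" "mat_supp c c VY (Y k)" "pencil_supp r c D (E k)"
      and bX: "fro r r (X k) + 2 * b * e k \<le> 2 * b * d" and bY: "fro c c (Y k) + 2 * b * e k \<le> 2 * b * d" for k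
  proof -
    let ?U = "gX (E k)" and ?V = "gY (E k)" and ?Y = "\<lambda>i j. Y k i j + gY (E k) i j"
    let ?s = "pfro r c S + 1"
    have s: "0 \<le> ?s" by (simp add: add_nonneg_nonneg)
    have U: "fro r r ?U \<le> b * e k" and V: "fro c c ?V \<le> b * e k"
      using nX[OF supp(3)] nY[OF supp(3)] by (simp_all add: e_def)
    have be: "0 \<le> b * e k" using b e0 by simp
    have bd: "0 \<le> 2 * b * d" using b d0 by simp
    have X': "fro r r (X k) \<le> 2 * b * d" using bX be by linarith
    have Y': "fro c c ?Y \<le> 2 * b * d" using fro_add[of "Y k" ?V c c] V bY be by linarith
    have 1: "pfro r c (rmul c (lmul r ?U T) ?Y) \<le> (2 * b * d) * ((b * e k) * ?s)"
      by (rule order_trans[OF pfro_rmul mult_mono[OF Y' order_trans[OF pfro_lmul mult_mono[OF U pT]]]])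
         (use be bd in auto)
    have 2: "pfro r c (rmul c (lmul r (X k) T) ?V) \<le> (b * e k) * ((2 * b * d) * ?s)"
      by (rule order_trans[OF pfro_rmul mult_mono[OF V order_trans[OF pfro_lmul mult_mono[OF X' pT]]]])
         (use be bd in auto)
    have 3: "pfro r c (lmul r ?U \<Delta>) \<le> (b * e k) * d"
      by (rule order_trans[OF pfro_lmul mult_mono[OF U]]) (use be in \<open>auto simp: d_def\<close>)
    have 4: "pfro r c (rmul c \<Delta> ?V) \<le> (b * e k) * d"
      by (rule order_trans[OF pfro_rmul mult_mono[OF V]]) (use be in \<open>auto simp: d_def\<close>)
    have "e (Suc k) \<le> pfro r c (rmul c (lmul r ?U T) ?Y) + pfro r c (rmul c (lmul r (X k) T) ?V)
        + pfro r c (lmul r ?U \<Delta>) + pfro r c (rmul c \<Delta> ?V)"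
      unfolding e_def ES N_def
      by (rule order_trans[OF pfro_diff add_right_mono[OF order_trans[OF pfro_diff add_right_mono[OF pfro_add]]]])
    also have "\<dots> \<le> (2 * b * d) * ((b * e k) * ?s) + (b * e k) * ((2 * b * d) * ?s) + (b * e k) * d + (b * e k) * d"
      using 1 2 3 4 by linarith
    also have "\<dots> = rate * d * e k"
      by (simp add: rate_def power2_eq_square algebra_simps)
    finally show ?thesis .
  qed
  have half: "e (Suc k) \<le> e k / 2" if "e (Suc k) \<le> rate * d * e k" for k
    using that mult_right_mono[OF small(2) e0[of k]] by (simp add: d_def)
  have inv: "mat_supp r r VX (X k) \<and> mat_supp c c VY (Y k) \<and> pencil_supp r c D (E k) \<and>
      fro r r (X k) + 2 * b * e k \<le> 2 * b * d \<and> fro c c (Y k) + 2 * b * e k \<le> 2 * b * d" for k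
  proof (induction k)
    case 0
    have "e 0 = d" by (simp add: e_def E0 d_def)
    then show ?case using \<Delta>
      by (auto simp: X0 Y0 E0 mat_supp_def L2_set_def)
  next
    case (Suc k)
    then have supp: "mat_supp r r VX (X k)" "mat_supp c c VY (Y k)" "pencil_supp r c D (E k)"
      and bX: "fro r r (X k) + 2 * b * e k \<le> 2 * b * d" and bY: "fro c c (Y k) + 2 * b * e k \<le> 2 * b * d"
      by auto
    have "e (Suc k) \<le> e k / 2" by (rule half[OF next_e[OF supp bX bY]])
    then have h: "2 * b * e (Suc k) \<le> b * e k" using mult_left_mono[of "e (Suc k)" "e k / 2" "2 * b"] b by simp
    have U: "fro r r (gX (E k)) \<le> b * e k" and V: "fro c c (gY (E k)) \<le> b * e k"
      using nX[OF supp(3)] nY[OF supp(3)] by (simp_all add: e_def)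
    have sX: "mat_supp r r VX (X (Suc k))" and sY: "mat_supp c c VY (Y (Suc k))"
      unfolding XS YS by (intro addM supp gX gY)+
    have "pencil_supp r c D (E (Suc k))"
      unfolding ES N_def
      by (rule addD(2)[OF addD(2)[OF addD(1)[OF lrT lrT] closed_l[OF _ \<Delta>]] closed_r[OF _ \<Delta>]])
        (rule gX gY supp sY[unfolded YS])+
    moreover have "fro r r (X (Suc k)) + 2 * b * e (Suc k) \<le> 2 * b * d"
      unfolding XS using fro_add[of "X k" "gX (E k)" r r] U bX h by linarith
    moreover have "fro c c (Y (Suc k)) + 2 * b * e (Suc k) \<le> 2 * b * d"
      unfolding YS using fro_add[of "Y k" "gY (E k)" c c] V bY h by linarith
    ultimately show ?case using sX sY by blast
  qed
  have suppE: "pencil_supp r c D (E k)" for k using inv by blast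
  have e_rate: "e (Suc k) \<le> rate * d * e k" for k using inv next_e by blast
  have e_half: "e (Suc k) \<le> e k / 2" for k by (rule half[OF e_rate])
  have e_pow: "e k \<le> d * (1 / 2) ^ k" for k
  proof (induction k)
    case (Suc k)
    then show ?case using e_half[of k] by simp
  qed (simp add: e_def E0 d_def)
  have LW: "pencil_supp r c W (L k)" for k
  proof (induction k)
    case (Suc k)
    then show ?case using W[OF suppE[of k]] by (simp add: pencil_supp_def LS)
  qed (simp add: pencil_supp_def L0)
  have LSn: "pfro r c (L (Suc k)) \<le> pfro r c (L k) + f * e k" for k
    using pfro_add[of r c "L k" "linear_defect r c S (E k) (gX (E k)) (gY (E k))"] nW[OF suppE[of k]]
    by (simp add: LS[abs_def] e_def)
  \<comment> \<open>The index is shifted by one so that \<open>e 1\<close>, already quadratic in \<open>d\<close>, starts the geometric sum.\<close>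
  have Ln: "pfro r c (L (Suc k)) + 2 * f * e (Suc k) \<le> f * d + 2 * f * rate * d\<^sup>2" for k
  proof (induction k)
    case 0
    have "pfro r c (L 0) = 0" by (simp add: pfro_def L2_set_def L0)
    moreover have "e 0 = d" by (simp add: e_def E0 d_def)
    moreover have "2 * f * e 1 \<le> 2 * f * (rate * d * d)"
      by (rule mult_left_mono) (use e_rate[of 0] \<open>e 0 = d\<close> f in auto)
    ultimately show ?case using LSn[of 0] by (simp add: power2_eq_square algebra_simps)
  next
    case (Suc k)
    have "2 * f * e (Suc (Suc k)) \<le> f * e (Suc k)"
      using mult_left_mono[OF e_half[of "Suc k"], of "2 * f"] f by simp
    then show ?case using Suc LSn[of "Suc k"] by linarith
  qed
  have conv: "\<exists>P. \<forall>i<p. \<forall>j<q. (\<lambda>k. Z k i j) \<longlonglongrightarrow> P i j"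
    if Z: "\<And>k. Z (Suc k) = (\<lambda>i j. Z k i j + G k i j)" "Z 0 = (\<lambda>_ _. 0)"
      and G: "\<And>k. fro p q (G k) \<le> b * e k" for p q and Z G :: "nat \<Rightarrow> nat \<Rightarrow> nat \<Rightarrow> 'a"
  proof -
    have Zsum: "Z k i j = (\<Sum>t<k. G t i j)" for k i j
    proof (induction k)
      case 0
      show ?case unfolding Z(2) by simp
    next
      case (Suc k)
      then show ?case unfolding Z(1)[of k] by simp
    qed
    have "(\<lambda>k. Z k i j) \<longlonglongrightarrow> (\<Sum>t. G t i j)" if ij: "i < p" "j < q" for i j
    proof -
      have "summable (\<lambda>t. G t i j)"
      proof (rule summable_comparison_test')
        show "summable (\<lambda>t. b * (d * (1 / 2) ^ t))" by (intro summable_mult summable_geometric) simp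
        fix t
        have "norm (G t i j) \<le> b * e t" using norm_le_fro[OF ij, of "G t"] G[of t] by linarith
        also have "\<dots> \<le> b * (d * (1 / 2) ^ t)" by (rule mult_left_mono[OF e_pow b])
        finally show "norm (G t i j) \<le> b * (d * (1 / 2) ^ t)" .
      qed
      from summable_LIMSEQ[OF this] show ?thesis by (simp add: Zsum)
    qed
    then show ?thesis by (intro exI[of _ "\<lambda>i j. \<Sum>t. G t i j"]) simp
  qed
  have "\<exists>P. \<forall>i<r. \<forall>j<r. (\<lambda>k. X k i j) \<longlonglongrightarrow> P i j"
    by (rule conv[OF XS X0]) (use nX[OF suppE] in \<open>simp add: e_def\<close>)
  then obtain PX where PX': "\<forall>i<r. \<forall>j<r. (\<lambda>k. X k i j) \<longlonglongrightarrow> PX i j" ..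
  have "\<exists>P. \<forall>i<c. \<forall>j<c. (\<lambda>k. Y k i j) \<longlonglongrightarrow> P i j"
    by (rule conv[OF YS Y0]) (use nY[OF suppE] in \<open>simp add: e_def\<close>)
  then obtain PY where PY': "\<forall>i<c. \<forall>j<c. (\<lambda>k. Y k i j) \<longlonglongrightarrow> PY i j" ..
  have PX: "i < r \<Longrightarrow> j < r \<Longrightarrow> (\<lambda>k. X k i j) \<longlonglongrightarrow> PX i j" for i j using PX' by simp
  have PY: "i < c \<Longrightarrow> j < c \<Longrightarrow> (\<lambda>k. Y k i j) \<longlonglongrightarrow> PY i j" for i j using PY' by simp
  have Elim: "(\<lambda>t. E t k i j) \<longlonglongrightarrow> 0" if "k < 2" "i < r" "j < c" for k i j
  proof (rule Lim_null_comparison)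
    have "norm (E t k i j) \<le> d * (1 / 2) ^ t" for t
      using norm_le_pfro[OF that, of "E t"] e_pow[of t] unfolding e_def by linarith
    then show "\<forall>\<^sub>F t in sequentially. norm (E t k i j) \<le> d * (1 / 2) ^ t" by simp
    show "(\<lambda>t. d * (1 / 2) ^ t) \<longlonglongrightarrow> 0"
      by (intro tendsto_mult_right_zero LIMSEQ_power_zero) simp
  qed
  define F where "F k i j = transform r c PX T PY k i j - S k i j" for k i j
  have Llim: "(\<lambda>t. L t k i j) \<longlonglongrightarrow> F k i j" if "k < 2" "i < r" "j < c" for k i j
  proof -
    have "(\<lambda>t. L t k i j) \<longlonglongrightarrow> transform r c PX T PY k i j - S k i j - 0"
      unfolding L_def transform_def lmul_def rmul_def
      by (intro tendsto_intros PX PY Elim) (use that in auto)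
    then show ?thesis by (simp add: F_def)
  qed
  have "mat_supp r r VX PX"
    unfolding mat_supp_def
  proof (intro allI impI)
    fix i j assume ij: "i < r" "j < r" "\<not> VX i j"
    then have "(\<lambda>k. X k i j) = (\<lambda>_. 0)" using inv by (auto simp: mat_supp_def)
    with PX[OF ij(1,2)] show "PX i j = 0" by (simp add: LIMSEQ_const_iff)
  qed
  moreover have "mat_supp c c VY PY"
    unfolding mat_supp_def
  proof (intro allI impI)
    fix i j assume ij: "i < c" "j < c" "\<not> VY i j"
    then have "(\<lambda>k. Y k i j) = (\<lambda>_. 0)" using inv by (auto simp: mat_supp_def)
    with PY[OF ij(1,2)] show "PY i j = 0" by (simp add: LIMSEQ_const_iff)
  qed
  moreover have "pencil_supp r c W F"
    unfolding pencil_supp_def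
  proof (intro allI impI)
    fix k i j assume ij: "k < 2" "i < r" "j < c" "\<not> W k i j"
    then have "(\<lambda>t. L t k i j) = (\<lambda>_. 0)" using LW by (auto simp: pencil_supp_def)
    with Llim[OF ij(1-3)] show "F k i j = 0" by (simp add: LIMSEQ_const_iff)
  qed
  moreover have "fro r r PX \<le> 2 * b * d"
  proof (rule tendsto_fro_le[OF PX])
    show "fro r r (X k) \<le> 2 * b * d" for k
      using inv[of k] mult_nonneg_nonneg[OF b e0[of k]] by linarith
  qed
  moreover have "fro c c PY \<le> 2 * b * d"
  proof (rule tendsto_fro_le[OF PY])
    show "fro c c (Y k) \<le> 2 * b * d" for k
      using inv[of k] mult_nonneg_nonneg[OF b e0[of k]] by linarith
  qed
  moreover have "pfro r c F \<le> f * d + 2 * f * rate * d\<^sup>2"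
  proof (rule tendsto_pfro_le[OF Llim])
    fix t :: nat assume "1 \<le> t"
    then obtain k where "t = Suc k" by (cases t) auto
    then show "pfro r c (L t) \<le> f * d + 2 * f * rate * d\<^sup>2"
      using Ln[of k] mult_nonneg_nonneg[OF f e0[of "Suc k"]] by simp
  qed
  ultimately show ?thesis unfolding F_def T_def d_def by blast
qed

end

section \<open>Pencil equations solved by chains\<close>

text \<open>Multiplying out first keeps the exponent at \<open>N\<close>: the extra factor \<open>\<rho>\<close> in front of \<open>q\<close> raises each power
  in the sum by one, from at most \<open>N - 1\<close> to at most \<open>N\<close>.\<close>

lemma geometric_sum_bound:
  fixes \<rho> p q :: real
  assumes "0 \<le> \<rho>" "0 \<le> p" "0 \<le> q"
  shows "(\<Sum>t<N. \<rho> ^ t) * (p + \<rho> * q) \<le> real N * max 1 (\<rho> ^ N) * (p + q)"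
proof -
  have pow: "\<rho> ^ t \<le> max 1 (\<rho> ^ N)" if "t \<le> N" for t
  proof (cases "\<rho> \<le> 1")
    case True
    then show ?thesis using power_le_one[of \<rho> t] assms(1) by (simp add: max.coboundedI1)
  next
    case False
    then show ?thesis using power_increasing[OF that, of \<rho>] by (simp add: max.coboundedI2)
  qed
  have "(\<Sum>t<N. \<rho> ^ t) * (p + \<rho> * q) = (\<Sum>t<N. \<rho> ^ t * p + \<rho> ^ Suc t * q)"
    by (simp add: sum_distrib_right sum_distrib_left distrib_left sum.distrib mult_ac)
  also have "\<dots> \<le> (\<Sum>t<N. max 1 (\<rho> ^ N) * p + max 1 (\<rho> ^ N) * q)"
    by (intro sum_mono add_mono mult_right_mono pow) (use assms in auto)
  finally show ?thesis by (simp add: algebra_simps)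
qed

text \<open>The common last step for the two equations with the state matrix \<open>A\<close>: after the elimination of one
  unknown, the other one satisfies this recursion along a shift of the columns.\<close>

lemma shift_chain_solution:
  fixes A :: "nat \<Rightarrow> nat \<Rightarrow> 'a::real_normed_field" and ht :: "nat \<Rightarrow> nat"
  assumes A: "op_bound l l A \<rho>"
    and step: "\<And>x. x < w \<Longrightarrow> g x \<Longrightarrow> h x < w \<and> ht (h x) < ht x"
    and inj: "inj_on h {x \<in> {..<w}. g x}"
    and ht: "\<And>x. x < w \<Longrightarrow> ht x < N"
  shows "\<exists>X. (\<forall>i<l. \<forall>c<w. X i c = P i c - (\<Sum>a<l. A i a * Q a c)
            + (if g c then \<Sum>a<l. A i a * X a (h c) else 0))
      \<and> fro l w X \<le> real N * max 1 (\<rho> ^ N) * (fro l w P + fro l w Q)"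
proof -
  let ?H = "\<lambda>i c. P i c - (\<Sum>a<l. A i a * Q a c)"
  obtain X where X: "\<forall>i<l. \<forall>c\<in>{..<w}. X i c = ?H i c + (if g c then \<Sum>a<l. A i a * X a (h c) else 0)"
    using chain_exists[where J = "{..<w}" and g = g and h = h and ht = ht and N = N and l = l and A = A and H = ?H]
      step ht by auto
  have \<rho>: "0 \<le> \<rho>" by (rule op_bound_nonneg[OF A])
  have H: "fro l w ?H \<le> fro l w P + \<rho> * fro l w Q"
    using L2_set_norm_diff[of "case_prod P" "\<lambda>(i, c). \<Sum>a<l. A i a * Q a c" "{..<l} \<times> {..<w}"]
      fro_mult_left_le[OF A, where c = w and Z = Q]
    by (simp add: case_prod_unfold)
  have "fro l w X \<le> (\<Sum>t<N. \<rho> ^ t) * fro l w ?H"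
    by (rule chain_bound[OF A _ _ inj]) (use step ht X in auto)
  also have "\<dots> \<le> (\<Sum>t<N. \<rho> ^ t) * (fro l w P + \<rho> * fro l w Q)"
    by (rule mult_left_mono[OF H]) (simp add: sum_nonneg \<rho>)
  also have "\<dots> \<le> real N * max 1 (\<rho> ^ N) * (fro l w P + fro l w Q)"
    by (rule geometric_sum_bound[OF \<rho>]) auto
  finally show ?thesis using X by (intro exI[of _ X]) simp
qed

text \<open>The coefficients of \<open>X K\<^sup>T + (A - \<lambda> I) Y = P - \<lambda> Q\<close>, where \<open>K = L\<^sub>N \<otimes> I\<close>. The second family of
  equations gives \<open>Y\<close>, and substituting it in the first expresses each block column of \<open>X\<close> by the
  next one. The last block column of \<open>X\<close> is free and is set to zero.\<close>

lemma solve_state_outer: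
  fixes A P Q :: "nat \<Rightarrow> nat \<Rightarrow> 'a::real_normed_field"
  assumes A: "op_bound l l A \<rho>" and m: "0 < m"
  shows "\<exists>X Y. (\<forall>i<l. \<forall>c<N * m. X i c + (\<Sum>a<l. A i a * Y a c) = P i c \<and> X i (c + m) + Y i c = Q i c)
      \<and> fro l ((N + 1) * m) X \<le> real N * max 1 (\<rho> ^ N) * (fro l (N * m) P + fro l (N * m) Q)
      \<and> fro l (N * m) Y \<le> fro l (N * m) Q + real N * max 1 (\<rho> ^ N) * (fro l (N * m) P + fro l (N * m) Q)"
proof -
  let ?b = "real N * max 1 (\<rho> ^ N) * (fro l (N * m) P + fro l (N * m) Q)"
  have "\<exists>Z. (\<forall>i<l. \<forall>c<N * m. Z i c = P i c - (\<Sum>a<l. A i a * Q a c)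
            + (if c + m < N * m then \<Sum>a<l. A i a * Z a (c + m) else 0)) \<and> fro l (N * m) Z \<le> ?b"
  proof (rule shift_chain_solution[OF A, where ht = "\<lambda>c. N - 1 - c div m"])
    fix c assume c: "c < N * m"
    then have "c div m < N" by (simp add: less_mult_imp_div_less)
    then show "N - 1 - c div m < N" by simp
    assume "c + m < N * m"
    then have "(c + m) div m < N" by (rule less_mult_imp_div_less)
    then have "c div m + 1 < N" using m by simp
    then show "c + m < N * m \<and> N - 1 - (c + m) div m < N - 1 - c div m"
      using \<open>c + m < N * m\<close> m by simp
  qed (auto simp: inj_on_def)
  then obtain Z where Z: "\<And>i c. i < l \<Longrightarrow> c < N * m \<Longrightarrow> Z i c = P i c - (\<Sum>a<l. A i a * Q a c)
            + (if c + m < N * m then \<Sum>a<l. A i a * Z a (c + m) else 0)" and nZ: "fro l (N * m) Z \<le> ?b"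
    by blast
  define X where "X i c = (if c < N * m then Z i c else 0)" for i c
  define Y where "Y i c = Q i c - X i (c + m)" for i c
  have nX: "fro l ((N + 1) * m) X \<le> fro l (N * m) Z"
    by (rule L2_set_reindex_le[where h = id and g = "\<lambda>(i, c). c < N * m"]) (auto simp: X_def)
  have nX': "fro l (N * m) (\<lambda>i c. X i (c + m)) \<le> fro l ((N + 1) * m) X"
    by (rule L2_set_reindex_le[where h = "\<lambda>(i, c). (i, c + m)" and g = "\<lambda>_. True"])
       (auto simp: inj_on_def)
  have nY: "fro l (N * m) Y \<le> fro l (N * m) Q + fro l (N * m) (\<lambda>i c. X i (c + m))"
    using L2_set_norm_diff[of "case_prod Q" "\<lambda>(i, c). X i (c + m)" "{..<l} \<times> {..<N * m}"]
    by (simp add: Y_def case_prod_unfold)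
  have "X i c + (\<Sum>a<l. A i a * Y a c) = P i c" if "i < l" "c < N * m" for i c
    using that Z[OF that] by (simp add: Y_def X_def right_diff_distrib sum_subtractf)
  then show ?thesis using nX nX' nY nZ
    by (intro exI[of _ X] exI[of _ Y]) (auto simp: Y_def)
qed

text \<open>The coefficients of \<open>X K + (A - \<lambda> I) Y = P - \<lambda> Q\<close>, except that the constant coefficient in the last
  block column is not prescribed: this is the place where a new \<open>B\<close> appears. Elimination of \<open>Y\<close>
  expresses each block column of \<open>X\<close> by the preceding one.\<close>

lemma solve_state_inner:
  fixes A P Q :: "nat \<Rightarrow> nat \<Rightarrow> 'a::real_normed_field"
  assumes A: "op_bound l l A \<rho>" and m: "0 < m"
  shows "\<exists>X Y. (\<forall>i<l. \<forall>c<N * m. X i c + (\<Sum>a<l. A i a * Y a c) = P i c)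
      \<and> (\<forall>i<l. \<forall>c<(N + 1) * m. Y i c + (if m \<le> c then X i (c - m) else 0) = Q i c)
      \<and> fro l (N * m) X \<le> real N * max 1 (\<rho> ^ N) * (fro l (N * m) P + fro l ((N + 1) * m) Q)
      \<and> fro l ((N + 1) * m) Y \<le> fro l ((N + 1) * m) Q
          + real N * max 1 (\<rho> ^ N) * (fro l (N * m) P + fro l ((N + 1) * m) Q)"
proof -
  let ?b = "\<lambda>q. real N * max 1 (\<rho> ^ N) * (fro l (N * m) P + fro l q Q)"
  have "\<exists>Z. (\<forall>i<l. \<forall>c<N * m. Z i c = P i c - (\<Sum>a<l. A i a * Q a c)
            + (if m \<le> c then \<Sum>a<l. A i a * Z a (c - m) else 0)) \<and> fro l (N * m) Z \<le> ?b (N * m)"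
  proof (rule shift_chain_solution[OF A, where ht = "\<lambda>c. c div m"])
    fix c assume c: "c < N * m"
    then show "c div m < N" by (simp add: less_mult_imp_div_less)
    assume "m \<le> c"
    then show "c - m < N * m \<and> (c - m) div m < c div m"
      using c m by (simp add: le_div_geq)
  qed (auto simp: inj_on_def)
  then obtain X where X: "\<And>i c. i < l \<Longrightarrow> c < N * m \<Longrightarrow> X i c = P i c - (\<Sum>a<l. A i a * Q a c)
            + (if m \<le> c then \<Sum>a<l. A i a * X a (c - m) else 0)" and nX: "fro l (N * m) X \<le> ?b (N * m)"
    by blast
  define Y where "Y i c = Q i c - (if m \<le> c then X i (c - m) else 0)" for i c
  have "fro l (N * m) Q \<le> fro l ((N + 1) * m) Q"
    by (rule L2_set_reindex_le[where h = id and g = "\<lambda>_. True"]) auto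
  then have "?b (N * m) \<le> ?b ((N + 1) * m)"
    by (intro mult_left_mono add_left_mono) auto
  then have nX': "fro l (N * m) X \<le> ?b ((N + 1) * m)" using nX by linarith
  have "fro l ((N + 1) * m) (\<lambda>i c. if m \<le> c then X i (c - m) else 0) \<le> fro l (N * m) X"
    by (rule L2_set_reindex_le[where h = "\<lambda>(i, c). (i, c - m)" and g = "\<lambda>(i, c). m \<le> c"])
       (auto simp: inj_on_def)
  then have nY: "fro l ((N + 1) * m) Y \<le> fro l ((N + 1) * m) Q + fro l (N * m) X"
    using L2_set_norm_diff[of "case_prod Q" "\<lambda>(i, c). if m \<le> c then X i (c - m) else 0"
        "{..<l} \<times> {..<(N + 1) * m}"]
    by (simp add: Y_def case_prod_unfold)
  have "X i c + (\<Sum>a<l. A i a * Y a c) = P i c" if "i < l" "c < N * m" for i c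
    using that X[OF that] by (simp add: Y_def right_diff_distrib sum_subtractf)
  then show ?thesis using nX' nY
    by (intro exI[of _ X] exI[of _ Y]) (auto simp: Y_def)
qed

lemma scalar_chain_bound:
  fixes X H :: "'c \<Rightarrow> 'a::real_normed_field" and ht :: "'c \<Rightarrow> nat"
  assumes J: "finite J"
    and step: "\<And>x. x \<in> J \<Longrightarrow> g x \<Longrightarrow> h x \<in> J \<and> ht (h x) < ht x"
    and inj: "inj_on h {x \<in> J. g x}"
    and ht: "\<And>x. x \<in> J \<Longrightarrow> ht x < N"
    and X: "\<And>x. x \<in> J \<Longrightarrow> X x = H x + (if g x then X (h x) else 0)"
  shows "L2_set (\<lambda>x. norm (X x)) J \<le> real N * L2_set (\<lambda>x. norm (H x)) J"
proof -
  have drop: "L2_set (\<lambda>(i::nat, x). norm (F x)) ({..<1} \<times> J) = L2_set (\<lambda>x. norm (F x)) J" for F :: "'c \<Rightarrow> 'a"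
    unfolding L2_set_def
    by (intro arg_cong[of _ _ sqrt] sum.reindex_bij_witness[of _ "\<lambda>x. (0, x)" snd]) auto
  have one: "op_bound 1 1 (\<lambda>_ _. 1 :: 'a) 1"
    by (simp add: op_bound_def L2_set_def)
  have "L2_set (\<lambda>(i, x). norm (X x)) ({..<1::nat} \<times> J)
      \<le> (\<Sum>t<N. 1 ^ t) * L2_set (\<lambda>(i, x). norm (H x)) ({..<1::nat} \<times> J)"
    by (rule chain_bound[OF one J _ inj, where ht = ht]) (use step ht X in \<open>auto\<close>)
  then show ?thesis unfolding drop by simp
qed

lemma scalar_chain_exists:
  fixes H :: "'c \<Rightarrow> 'a::comm_ring_1" and ht :: "'c \<Rightarrow> nat"
  assumes step: "\<And>x. x \<in> J \<Longrightarrow> g x \<Longrightarrow> h x \<in> J \<and> ht (h x) < ht x"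
    and ht: "\<And>x. x \<in> J \<Longrightarrow> ht x < N"
  shows "\<exists>X. \<forall>x\<in>J. X x = H x + (if g x then X (h x) else 0)"
proof -
  obtain X where "\<forall>i<(1::nat). \<forall>x\<in>J. X i x = H x + (if g x then \<Sum>a<(1::nat). 1 * X a (h x) else 0)"
    using chain_exists[where J = J and g = g and h = h and ht = ht and N = N and l = 1
        and A = "\<lambda>_ _. 1" and H = "\<lambda>_. H"] step ht by auto
  then show ?thesis by (intro exI[of _ "X 0"]) auto
qed

text \<open>The coefficients of \<open>X K\<^sub>2\<^sup>T + K\<^sub>1 Y = P - \<lambda> Q\<close>. Eliminating \<open>Y\<close> links an entry of \<open>X\<close> with the one
  a block row lower and a block column to the left, so the chains run along block antidiagonals and
  have length at most \<open>min \<epsilon> \<eta>\<close>. The free values, the first block column of \<open>X\<close> and the last block row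
  of \<open>Y\<close>, are set to zero. With this choice \<open>Y\<close> also satisfies a chain equation, of the same
  length, which bounds it as well as \<open>X\<close>; estimating \<open>Y = P - X\<close> directly would add
  the norm of \<open>P\<close>.\<close>

lemma solve_corner:
  fixes P Q :: "nat \<Rightarrow> nat \<Rightarrow> 'a::real_normed_field"
    and \<epsilon> \<eta> m n :: nat
  assumes m: "0 < m" and n: "0 < n"
  defines "w \<equiv> real (min \<epsilon> \<eta>) * (fro (\<epsilon> * n) (\<eta> * m) P + fro (\<epsilon> * n) (\<eta> * m) Q)"
  shows "\<exists>X Y. (\<forall>r<\<epsilon> * n. \<forall>c<\<eta> * m. X r c + Y r c = P r c \<and> X r (c + m) + Y (r + n) c = Q r c)
      \<and> fro (\<epsilon> * n) ((\<eta> + 1) * m) X \<le> w \<and> fro ((\<epsilon> + 1) * n) (\<eta> * m) Y \<le> w"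
proof -
  let ?J = "{..<\<epsilon> * n} \<times> {..<\<eta> * m}"
  let ?g = "\<lambda>(r, c). m \<le> c \<and> r + n < \<epsilon> * n" and ?h = "\<lambda>(r, c). (r + n, c - m)"
  define ht where "ht = (\<lambda>(r, c). if \<eta> \<le> \<epsilon> then c div m else \<epsilon> - 1 - r div n)"
  have step: "?h x \<in> ?J \<and> ht (?h x) < ht x" if "x \<in> ?J" "?g x" for x
  proof -
    obtain r c where x: "x = (r, c)" by force
    have "(r + n) div n < \<epsilon>" using that x by (intro less_mult_imp_div_less) auto
    then show ?thesis using that m n by (auto simp: x ht_def le_div_geq)
  qed
  have ht: "ht x < min \<epsilon> \<eta>" if "x \<in> ?J" for x
  proof -
    obtain r c where x: "x = (r, c)" by force
    have "r div n < \<epsilon>" "c div m < \<eta>" using that x by (auto intro: less_mult_imp_div_less)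
    then show ?thesis by (auto simp: x ht_def)
  qed
  have inj: "inj_on ?h {x \<in> ?J. ?g x}" by (auto simp: inj_on_def)
  define H where "H = (\<lambda>(r, c). Q r c - (if r + n < \<epsilon> * n then P (r + n) c else 0))"
  obtain Z where Z: "\<forall>x\<in>?J. Z x = H x + (if ?g x then Z (?h x) else 0)"
    using scalar_chain_exists[where J = ?J and g = ?g and h = ?h and ht = ht and H = H, OF step ht] by blast
  define X where "X r c = (if m \<le> c then Z (r, c - m) else 0)" for r c
  define Y where "Y r c = (if r < \<epsilon> * n then P r c - X r c else 0)" for r c
  define H' where "H' = (\<lambda>(r, c). P r c - (if m \<le> c then Q r (c - m) else 0))"
  have eq: "X r c + Y r c = P r c" "X r (c + m) + Y (r + n) c = Q r c" if "r < \<epsilon> * n" "c < \<eta> * m" for r c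
    using Z that by (auto simp: X_def Y_def H_def)
  have Y_chain: "case_prod Y x = H' x + (if ?g x then case_prod Y (?h x) else 0)" if "x \<in> ?J" for x
  proof -
    obtain r c where x: "x = (r, c)" by force
    have rc: "r < \<epsilon> * n" "c < \<eta> * m" using that x by auto
    show ?thesis
    proof (cases "m \<le> c")
      case True
      then have "X r c = Q r (c - m) - Y (r + n) (c - m)"
        using eq(2)[of r "c - m"] rc by (simp add: algebra_simps)
      then show ?thesis using True rc by (simp add: x H'_def Y_def)
    next
      case False
      then show ?thesis using rc by (simp add: x H'_def Y_def X_def)
    qed
  qed
  have "L2_set (\<lambda>x. norm (H x)) ?J \<le> L2_set (\<lambda>x. norm (case_prod Q x)) ?J
      + L2_set (\<lambda>x. norm (case x of (r, c) \<Rightarrow> if r + n < \<epsilon> * n then P (r + n) c else 0)) ?J"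
    unfolding H_def case_prod_unfold by (rule L2_set_norm_diff)
  also have "L2_set (\<lambda>x. norm (case x of (r, c) \<Rightarrow> if r + n < \<epsilon> * n then P (r + n) c else 0)) ?J
      \<le> fro (\<epsilon> * n) (\<eta> * m) P"
    by (rule L2_set_reindex_le[where h = "\<lambda>(r, c). (r + n, c)" and g = "\<lambda>(r, c). r + n < \<epsilon> * n"])
       (auto simp: inj_on_def)
  finally have nH: "L2_set (\<lambda>x. norm (H x)) ?J \<le> fro (\<epsilon> * n) (\<eta> * m) P + fro (\<epsilon> * n) (\<eta> * m) Q"
    by (simp add: case_prod_unfold)
  have "L2_set (\<lambda>x. norm (H' x)) ?J \<le> L2_set (\<lambda>x. norm (case_prod P x)) ?J
      + L2_set (\<lambda>x. norm (case x of (r, c) \<Rightarrow> if m \<le> c then Q r (c - m) else 0)) ?J"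
    unfolding H'_def case_prod_unfold by (rule L2_set_norm_diff)
  also have "L2_set (\<lambda>x. norm (case x of (r, c) \<Rightarrow> if m \<le> c then Q r (c - m) else 0)) ?J
      \<le> fro (\<epsilon> * n) (\<eta> * m) Q"
    by (rule L2_set_reindex_le[where h = "\<lambda>(r, c). (r, c - m)" and g = "\<lambda>(r, c). m \<le> c"])
       (auto simp: inj_on_def)
  finally have nH': "L2_set (\<lambda>x. norm (H' x)) ?J \<le> fro (\<epsilon> * n) (\<eta> * m) P + fro (\<epsilon> * n) (\<eta> * m) Q"
    by (simp add: case_prod_unfold)
  have "fro (\<epsilon> * n) ((\<eta> + 1) * m) X \<le> L2_set (\<lambda>x. norm (Z x)) ?J"
    by (rule L2_set_reindex_le[where h = "\<lambda>(r, c). (r, c - m)" and g = "\<lambda>(r, c). m \<le> c"])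
       (auto simp: inj_on_def X_def)
  also have "\<dots> \<le> real (min \<epsilon> \<eta>) * L2_set (\<lambda>x. norm (H x)) ?J"
    by (rule scalar_chain_bound[where X = Z and H = H, OF _ step inj ht]) (rule finite_cartesian_product[OF finite_lessThan finite_lessThan] | assumption | rule Z[rule_format])+
  also have "\<dots> \<le> w" unfolding w_def by (rule mult_left_mono[OF nH]) simp
  finally have X: "fro (\<epsilon> * n) ((\<eta> + 1) * m) X \<le> w" .
  have "fro ((\<epsilon> + 1) * n) (\<eta> * m) Y \<le> L2_set (\<lambda>x. norm (case_prod Y x)) ?J"
    by (rule L2_set_reindex_le[where h = id and g = "\<lambda>(r, c). r < \<epsilon> * n"])
       (auto simp: inj_on_def Y_def)
  also have "\<dots> \<le> real (min \<epsilon> \<eta>) * L2_set (\<lambda>x. norm (H' x)) ?J"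
    by (rule scalar_chain_bound[where X = "case_prod Y" and H = H', OF _ step inj ht]) (rule finite_cartesian_product[OF finite_lessThan finite_lessThan] | assumption | rule Y_chain)+
  also have "\<dots> \<le> w" unfolding w_def by (rule mult_left_mono[OF nH']) simp
  finally show ?thesis using X eq by (intro exI[of _ X] exI[of _ Y]) auto
qed

lemma L2_set_mask:
  fixes f :: "'i \<Rightarrow> 'a::real_normed_vector"
  assumes "finite B" "L \<subseteq> B"
  shows "L2_set (\<lambda>x. norm (if x \<in> L then f x else 0)) B \<le> L2_set (\<lambda>x. norm (f x)) L"
  by (rule L2_set_reindex_le[where h = id and g = "\<lambda>x. x \<in> L"])
     (use assms finite_subset in \<open>auto\<close>)

text \<open>The coefficients of \<open>X K + K Y = P - \<lambda> Q\<close>. Eliminating \<open>X\<close> links the entries of \<open>Y\<close> along block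
  diagonals. Strictly above the main block diagonal the last block column of the first family contains no
  \<open>X\<close>, so the substitution starts there and runs upwards. On and below the main block diagonal it runs
  downwards, starting in the first block column, where the second family contains no \<open>X\<close>; on the main
  block diagonal itself one value is free and set to zero. The index sets \<open>?low\<close> and \<open>?up\<close> separate the
  two directions.\<close>

lemma solve_Kronecker_block:
  fixes P Q :: "nat \<Rightarrow> nat \<Rightarrow> 'a::real_normed_field"
    and \<epsilon> n :: nat
  assumes n: "0 < n"
  defines "w \<equiv> real \<epsilon> * (fro (\<epsilon> * n) ((\<epsilon> + 1) * n) P + fro (\<epsilon> * n) ((\<epsilon> + 1) * n) Q)"
  shows "\<exists>X Y. (\<forall>r<\<epsilon> * n. \<forall>c<(\<epsilon> + 1) * n.
        Y r c + (if c < \<epsilon> * n then X r c else 0) = P r c \<and>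
        Y (r + n) c + (if n \<le> c then X r (c - n) else 0) = Q r c)
      \<and> fro (\<epsilon> * n) (\<epsilon> * n) X \<le> fro (\<epsilon> * n) ((\<epsilon> + 1) * n) P + 2 * w
      \<and> fro ((\<epsilon> + 1) * n) ((\<epsilon> + 1) * n) Y \<le> 2 * w"
proof -
  let ?q = "(\<epsilon> + 1) * n"
  let ?R = "{..<\<epsilon> * n} \<times> {..<?q}"
  let ?low = "{(r, c). n \<le> r \<and> r < ?q \<and> c < ?q \<and> c div n \<le> r div n}"
  let ?up = "{(r, c). r < \<epsilon> * n \<and> c < ?q \<and> r div n < c div n}"
  have le_q: "r < \<epsilon> * n \<Longrightarrow> r < ?q" for r by simp
  have sub: "?low \<subseteq> {..<?q} \<times> {..<?q}" "?up \<subseteq> {..<?q} \<times> {..<?q}"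
    using le_q by blast+
  have fin: "finite ?low" "finite ?up"
    by (rule finite_subset[OF sub(1)], simp, rule finite_subset[OF sub(2)], simp)
  have dplus: "(r + n) div n = r div n + 1" for r using n by simp
  have dminus: "(r - n) div n = r div n - 1" if "n \<le> r" for r using n that by (simp add: le_div_geq)
  have div_pos: "1 \<le> r div n" if "n \<le> r" for r using n that by (simp add: le_div_geq)
  have div_less: "r div n < k" if "r < k * n" for r k using that by (rule less_mult_imp_div_less)
  let ?gl = "\<lambda>(r, c). n \<le> c \<and> 2 * n \<le> r" and ?hl = "\<lambda>(r, c). (r - n, c - n)"
  let ?gu = "\<lambda>(r, c). c < \<epsilon> * n" and ?hu = "\<lambda>(r, c). (r + n, c + n)"
  have stepl: "?hl x \<in> ?low \<and> (case ?hl x of (r, c) \<Rightarrow> r div n - 1) < (case x of (r, c) \<Rightarrow> r div n - 1)"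
    if "x \<in> ?low" "?gl x" for x
  proof -
    obtain r c where x: "x = (r, c)" by force
    have rc: "n \<le> c" "2 * n \<le> r" "n \<le> r" "r < ?q" "c < ?q" "c div n \<le> r div n" using that x by auto
    have 1: "1 \<le> (r - n) div n" using rc by (intro div_pos) simp
    have 2: "r - n < ?q" "c - n < ?q" "n \<le> r - n" using rc by linarith+
    have 3: "(r - n) div n - 1 < r div n - 1" using 1 dminus[OF rc(3)] by linarith
    have 4: "(c - n) div n \<le> (r - n) div n" using rc dminus[OF rc(1)] dminus[OF rc(3)] by linarith
    show ?thesis unfolding x prod.case mem_Collect_eq using 2 3 4 by blast
  qed
  have htl: "(case x of (r, c) \<Rightarrow> r div n - 1) < \<epsilon>" if "x \<in> ?low" for x
  proof -
    obtain r c where x: "x = (r, c)" by force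
    have "r < ?q" "n \<le> r" using that x by auto
    then show ?thesis using div_less[of r "\<epsilon> + 1"] div_pos[of r] unfolding x prod.case by linarith
  qed
  have stepu: "?hu x \<in> ?up \<and> (case ?hu x of (r, c) \<Rightarrow> \<epsilon> - c div n) < (case x of (r, c) \<Rightarrow> \<epsilon> - c div n)"
    if "x \<in> ?up" "?gu x" for x
  proof -
    obtain r c where x: "x = (r, c)" by force
    have c: "c div n < \<epsilon>" using that x div_less by auto
    have "r + n < \<epsilon> * n"
    proof -
      have "r div n + 1 < \<epsilon>" using c that x by auto
      then have "(r + n) div n < \<epsilon>" by (simp add: dplus)
      then show ?thesis unfolding div_less_iff_less_mult[OF n] .
    qed
    then show ?thesis using that x c by (auto simp: dplus)
  qed
  have htu: "(case x of (r, c) \<Rightarrow> \<epsilon> - c div n) < \<epsilon>" if "x \<in> ?up" for x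
  proof -
    obtain r c where x: "x = (r, c)" by force
    have "r < \<epsilon> * n" "r div n < c div n" using that x by auto
    then show ?thesis using div_less[of r \<epsilon>] unfolding x prod.case by linarith
  qed
  have injl: "inj_on ?hl {x \<in> ?low. ?gl x}" and inju: "inj_on ?hu {x \<in> ?up. ?gu x}"
    by (auto simp: inj_on_def)
  define Hl where "Hl = (\<lambda>(r, c). Q (r - n) c - (if n \<le> c then P (r - n) (c - n) else 0))"
  define Hu where "Hu = (\<lambda>(r, c). P r c - (if c < \<epsilon> * n then Q r (c + n) else 0))"
  obtain L where L: "\<forall>x\<in>?low. L x = Hl x + (if ?gl x then L (?hl x) else 0)"
    using scalar_chain_exists[where J = ?low and g = ?gl and h = ?hl and H = Hl and N = \<epsilon>, OF stepl htl]
    by blast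
  obtain U where U: "\<forall>x\<in>?up. U x = Hu x + (if ?gu x then U (?hu x) else 0)"
    using scalar_chain_exists[where J = ?up and g = ?gu and h = ?hu and H = Hu and N = \<epsilon>, OF stepu htu]
    by blast
  have nP: "L2_set (\<lambda>x. norm (case_prod P x)) ?R = fro (\<epsilon> * n) ?q P"
    and nQ: "L2_set (\<lambda>x. norm (case_prod Q x)) ?R = fro (\<epsilon> * n) ?q Q" by (simp_all add: case_prod_unfold)
  have "L2_set (\<lambda>x. norm (Hl x)) ?low \<le> L2_set (\<lambda>x. norm (case x of (r, c) \<Rightarrow> Q (r - n) c)) ?low
      + L2_set (\<lambda>x. norm (case x of (r, c) \<Rightarrow> if n \<le> c then P (r - n) (c - n) else 0)) ?low"
    unfolding Hl_def case_prod_unfold by (rule L2_set_norm_diff)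
  also have "\<dots> \<le> fro (\<epsilon> * n) ?q Q + fro (\<epsilon> * n) ?q P"
  proof (rule add_mono)
    show "L2_set (\<lambda>x. norm (case x of (r, c) \<Rightarrow> Q (r - n) c)) ?low \<le> fro (\<epsilon> * n) ?q Q"
      by (rule L2_set_reindex_le[where h = "\<lambda>(r, c). (r - n, c)" and g = "\<lambda>_. True"])
         (use fin in \<open>auto simp: inj_on_def\<close>)
    show "L2_set (\<lambda>x. norm (case x of (r, c) \<Rightarrow> if n \<le> c then P (r - n) (c - n) else 0)) ?low
        \<le> fro (\<epsilon> * n) ?q P"
      by (rule L2_set_reindex_le[where h = ?hl and g = "\<lambda>(r, c). n \<le> c"])
         (use fin in \<open>auto simp: inj_on_def\<close>)
  qed
  finally have nHl: "L2_set (\<lambda>x. norm (Hl x)) ?low \<le> fro (\<epsilon> * n) ?q P + fro (\<epsilon> * n) ?q Q" by simp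
  have "L2_set (\<lambda>x. norm (Hu x)) ?up \<le> L2_set (\<lambda>x. norm (case_prod P x)) ?up
      + L2_set (\<lambda>x. norm (case x of (r, c) \<Rightarrow> if c < \<epsilon> * n then Q r (c + n) else 0)) ?up"
    unfolding Hu_def case_prod_unfold by (rule L2_set_norm_diff)
  also have "\<dots> \<le> fro (\<epsilon> * n) ?q P + fro (\<epsilon> * n) ?q Q"
  proof (rule add_mono)
    show "L2_set (\<lambda>x. norm (case_prod P x)) ?up \<le> fro (\<epsilon> * n) ?q P"
      by (rule L2_set_reindex_le[where h = id and g = "\<lambda>_. True"])
         (use fin in \<open>auto simp: inj_on_def\<close>)
    show "L2_set (\<lambda>x. norm (case x of (r, c) \<Rightarrow> if c < \<epsilon> * n then Q r (c + n) else 0)) ?up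
        \<le> fro (\<epsilon> * n) ?q Q"
      by (rule L2_set_reindex_le[where h = "\<lambda>(r, c). (r, c + n)" and g = "\<lambda>(r, c). c < \<epsilon> * n"])
         (use fin in \<open>auto simp: inj_on_def\<close>)
  qed
  finally have nHu: "L2_set (\<lambda>x. norm (Hu x)) ?up \<le> fro (\<epsilon> * n) ?q P + fro (\<epsilon> * n) ?q Q" .
  have "L2_set (\<lambda>x. norm (L x)) ?low \<le> real \<epsilon> * L2_set (\<lambda>x. norm (Hl x)) ?low"
    by (rule scalar_chain_bound[where X = L and H = Hl, OF fin(1) stepl injl htl]) (assumption | rule L[rule_format])+
  also have "\<dots> \<le> w" unfolding w_def by (rule mult_left_mono[OF nHl]) simp
  finally have nL: "L2_set (\<lambda>x. norm (L x)) ?low \<le> w" .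
  have "L2_set (\<lambda>x. norm (U x)) ?up \<le> real \<epsilon> * L2_set (\<lambda>x. norm (Hu x)) ?up"
    by (rule scalar_chain_bound[where X = U and H = Hu, OF fin(2) stepu inju htu]) (assumption | rule U[rule_format])+
  also have "\<dots> \<le> w" unfolding w_def by (rule mult_left_mono[OF nHu]) simp
  finally have nU: "L2_set (\<lambda>x. norm (U x)) ?up \<le> w" .
  define YL where "YL r c = (if (r, c) \<in> ?low then L (r, c) else 0)" for r c
  define YU where "YU r c = (if (r, c) \<in> ?up then U (r, c) else 0)" for r c
  define Y where "Y r c = YL r c + YU r c" for r c
  define X where "X r c = P r c - Y r c" for r c
  have "fro ?q ?q YL \<le> L2_set (\<lambda>x. norm (L x)) ?low"
    using L2_set_mask[OF _ sub(1), of L] by (simp add: YL_def case_prod_unfold cong: if_cong del: mem_Collect_eq)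
  moreover have "fro ?q ?q YU \<le> L2_set (\<lambda>x. norm (U x)) ?up"
    using L2_set_mask[OF _ sub(2), of U] by (simp add: YU_def case_prod_unfold cong: if_cong del: mem_Collect_eq)
  ultimately have nY: "fro ?q ?q Y \<le> 2 * w"
    using fro_add[of YL YU ?q ?q] nL nU by (simp add: Y_def)
  have "fro (\<epsilon> * n) (\<epsilon> * n) P \<le> fro (\<epsilon> * n) ?q P" and "fro (\<epsilon> * n) (\<epsilon> * n) Y \<le> fro ?q ?q Y"
    by (rule L2_set_reindex_le[where h = id and g = "\<lambda>_. True"]; auto)+
  then have nX: "fro (\<epsilon> * n) (\<epsilon> * n) X \<le> fro (\<epsilon> * n) ?q P + 2 * w"
    using L2_set_norm_diff[of "case_prod P" "case_prod Y" "{..<\<epsilon> * n} \<times> {..<\<epsilon> * n}"] nY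
    by (simp add: X_def case_prod_unfold)
  have eq1: "Y r c + (if c < \<epsilon> * n then X r c else 0) = P r c" if rc: "r < \<epsilon> * n" "c < ?q" for r c
  proof (cases "c < \<epsilon> * n")
    case False
    then have "\<epsilon> \<le> c div n" using n by (metis div_less_iff_less_mult not_le)
    then have "r div n < c div n" using div_less[OF rc(1)] by simp
    then have "(r, c) \<in> ?up" "(r, c) \<notin> ?low" using rc by auto
    then show ?thesis using False U by (simp add: Y_def YL_def YU_def Hu_def)
  qed (simp add: X_def)
  have eq2: "Y (r + n) c + (if n \<le> c then X r (c - n) else 0) = Q r c" if rc: "r < \<epsilon> * n" "c < ?q" for r c
  proof (cases "c div n \<le> r div n + 1")
    case True
    then have low: "(r + n, c) \<in> ?low" and up: "(r + n, c) \<notin> ?up" using rc by (auto simp: dplus)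
    have Lrn: "Y (r + n) c = Q r c - (if n \<le> c then P r (c - n) else 0)
        + (if n \<le> c \<and> n \<le> r then L (r, c - n) else 0)"
      using L[rule_format, OF low] low up by (simp add: Y_def YL_def YU_def Hl_def del: mem_Collect_eq)
    show ?thesis
    proof (cases "n \<le> c")
      case n_le: True
      have d: "(c - n) div n \<le> r div n" using True dminus[OF n_le] by linarith
      have nup: "(r, c - n) \<notin> ?up" using d by simp
      have "c - n < ?q" "r < ?q" using rc by auto
      then have "(r, c - n) \<in> ?low \<longleftrightarrow> n \<le> r" using d by simp
      then have "Y r (c - n) = (if n \<le> r then L (r, c - n) else 0)"
        using nup by (simp add: Y_def YL_def YU_def del: mem_Collect_eq)
      then show ?thesis using Lrn n_le by (simp add: X_def)
    qed (simp add: Lrn)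
  next
    case False
    have c: "n \<le> c"
    proof (rule ccontr)
      assume "\<not> n \<le> c"
      then show False using False by simp
    qed
    have d: "(c - n) div n = c div n - 1" by (rule dminus[OF c])
    have up: "(r, c - n) \<in> ?up" and nlow: "(r, c - n) \<notin> ?low" "(r + n, c) \<notin> ?low"
      using False rc d by (auto simp: dplus)
    have cn: "c - n < \<epsilon> * n" using rc c by auto
    have up': "(r + n, c) \<in> ?up" using stepu[OF up] cn c by simp
    have "Y r (c - n) = P r (c - n) - Q r c + U (r + n, c)"
      using U[rule_format, OF up] up nlow cn c
      by (simp add: Y_def YL_def YU_def Hu_def del: mem_Collect_eq)
    moreover have "Y (r + n) c = U (r + n, c)"
      using up' nlow by (simp add: Y_def YL_def YU_def del: mem_Collect_eq)
    ultimately show ?thesis using c by (simp add: X_def)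
  qed
  show ?thesis by (intro exI[of _ X] exI[of _ Y] conjI allI impI eq1 eq2 nX nY)
qed

section \<open>Block structure of the linearization\<close>

text \<open>Extraction of a block starting at row \<open>x\<close> and column \<open>y\<close>, and placement of a block there.\<close>

definition blk where
  "blk x y T k i j = T k (x + i) (y + j)"

definition place :: "nat \<Rightarrow> nat \<Rightarrow> nat \<Rightarrow> nat \<Rightarrow> (nat \<Rightarrow> nat \<Rightarrow> 'a::zero) \<Rightarrow> nat \<Rightarrow> nat \<Rightarrow> 'a" where
  "place x r y c Z i j = (if x \<le> i \<and> i < x + r \<and> y \<le> j \<and> j < y + c then Z (i - x) (j - y) else 0)"

lemma fro_place: "fro r' c' (place x r y c Z) \<le> fro r c Z"
  by (rule L2_set_reindex_le[where h = "\<lambda>(i, j). (i - x, j - y)"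
        and g = "\<lambda>(i, j). x \<le> i \<and> i < x + r \<and> y \<le> j \<and> j < y + c"])
     (auto simp: place_def inj_on_def split: if_splits)

lemma sum_split3:
  fixes f :: "nat \<Rightarrow> 'b::comm_monoid_add"
  shows "(\<Sum>a<x + y + z. f a) = (\<Sum>a<x. f a) + (\<Sum>a<y. f (x + a)) + (\<Sum>a<z. f (x + y + a))"
proof -
  have two: "(\<Sum>a<x + y. g a) = (\<Sum>a<x. g a) + (\<Sum>a<y. g (x + a))" for g :: "nat \<Rightarrow> 'b" and x y
    by (induction y) (simp_all add: add.assoc)
  show ?thesis by (simp only: two)
qed

lemma pfro_power2: "(pfro r c T)\<^sup>2 = (\<Sum>k<2. \<Sum>i<r. \<Sum>j<c. (norm (T k i j))\<^sup>2)"
  unfolding pfro_def L2_set_power2 by (simp add: sum.cartesian_product case_prod_unfold)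

lemma pfro_blocks:
  "(pfro (p + l + v) (q + l' + u) T)\<^sup>2 =
    (pfro p q T)\<^sup>2 + (pfro p l' (blk 0 q T))\<^sup>2 + (pfro p u (blk 0 (q + l') T))\<^sup>2
    + (pfro l q (blk p 0 T))\<^sup>2 + (pfro l l' (blk p q T))\<^sup>2 + (pfro l u (blk p (q + l') T))\<^sup>2
    + (pfro v q (blk (p + l) 0 T))\<^sup>2 + (pfro v l' (blk (p + l) q T))\<^sup>2
    + (pfro v u (blk (p + l) (q + l') T))\<^sup>2"
  unfolding pfro_power2 blk_def sum_split3 sum.distrib by (simp add: add_ac)

lemma fro_coeff_sum_le: "fro r c (T 0) + fro r c (T 1) \<le> sqrt 2 * pfro r c T"
proof (rule power2_le_imp_le)
  have "0 \<le> (fro r c (T 0) - fro r c (T 1))\<^sup>2" by simp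
  moreover have "(pfro r c T)\<^sup>2 = (fro r c (T 0))\<^sup>2 + (fro r c (T 1))\<^sup>2"
    by (simp add: pfro_eq_sqrt)
  ultimately show "(fro r c (T 0) + fro r c (T 1))\<^sup>2 \<le> (sqrt 2 * pfro r c T)\<^sup>2"
    by (simp add: power_mult_distrib power2_sum power2_diff)
qed simp

lemma pfro_const: "pfro r c (\<lambda>k. if k = 0 then Z else (\<lambda>_ _. 0)) = fro r c Z"
  by (simp add: pfro_eq_sqrt L2_set_def sum_nonneg)

lemma fro_shift_le: "x + r \<le> r' \<Longrightarrow> y + c \<le> c' \<Longrightarrow> fro r c (\<lambda>i j. Z (x + i) (y + j)) \<le> fro r' c' Z"
  by (rule L2_set_reindex_le[where h = "\<lambda>(i, j). (x + i, y + j)" and g = "\<lambda>_. True"])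
     (auto simp: inj_on_def)

text \<open>The coefficients of a block Kronecker pencil, block by block. The block \<open>(1,1)\<close> is arbitrary, so the
  locale describes exactly the entries fixed by the shape. The real parameters bound the operator norms of the
  state-space matrices and of the two coefficients of \<open>S\<close>, and \<open>\<Sigma>\<close> combines the latter into a bound
  for the pencil.\<close>

locale kron_pencil =
  fixes m n l u v p q \<epsilon> \<eta> :: nat
    and S :: "nat \<Rightarrow> nat \<Rightarrow> nat \<Rightarrow> 'a::{real_normed_field, banach}"
    and A B C :: "nat \<Rightarrow> nat \<Rightarrow> 'a" and \<rho>A \<rho>B \<rho>C :: real and \<sigma> :: "nat \<Rightarrow> real"
  assumes dims: "u = \<eta> * m" "v = \<epsilon> * n" "p = u + m" "q = v + n"
    and pos: "0 < m" "0 < n"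
    and s12: "\<And>i j. i < p \<Longrightarrow> j < l \<Longrightarrow> S 0 i (q + j) = (if u \<le> i then C (i - u) j else 0)"
      "\<And>i j. i < p \<Longrightarrow> j < l \<Longrightarrow> S 1 i (q + j) = 0"
    and s13: "\<And>i j. i < p \<Longrightarrow> j < u \<Longrightarrow> S 0 i (q + l + j) = (if i = j then 1 else 0)"
      "\<And>i j. i < p \<Longrightarrow> j < u \<Longrightarrow> S 1 i (q + l + j) = (if i = j + m then - 1 else 0)"
    and s21: "\<And>i j. i < l \<Longrightarrow> j < q \<Longrightarrow> S 0 (p + i) j = (if v \<le> j then B i (j - v) else 0)"
      "\<And>i j. i < l \<Longrightarrow> j < q \<Longrightarrow> S 1 (p + i) j = 0"
    and s22: "\<And>i j. i < l \<Longrightarrow> j < l \<Longrightarrow> S 0 (p + i) (q + j) = A i j"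
      "\<And>i j. i < l \<Longrightarrow> j < l \<Longrightarrow> S 1 (p + i) (q + j) = (if i = j then - 1 else 0)"
    and s31: "\<And>i j. i < v \<Longrightarrow> j < q \<Longrightarrow> S 0 (p + l + i) j = (if j = i then 1 else 0)"
      "\<And>i j. i < v \<Longrightarrow> j < q \<Longrightarrow> S 1 (p + l + i) j = (if j = i + n then - 1 else 0)"
    and s23: "\<And>k i j. k < 2 \<Longrightarrow> i < l \<Longrightarrow> j < u \<Longrightarrow> S k (p + i) (q + l + j) = 0"
    and s32: "\<And>k i j. k < 2 \<Longrightarrow> i < v \<Longrightarrow> j < l \<Longrightarrow> S k (p + l + i) (q + j) = 0"
    and s33: "\<And>k i j. k < 2 \<Longrightarrow> i < v \<Longrightarrow> j < u \<Longrightarrow> S k (p + l + i) (q + l + j) = 0"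
    and A: "op_bound l l A \<rho>A" and B: "op_bound l n B \<rho>B" and C: "op_bound m l C \<rho>C"
    and S_bound: "\<And>k. k < 2 \<Longrightarrow> op_bound (p + l + v) (q + l + u) (S k) (\<sigma> k)"
begin

abbreviation "R \<equiv> p + l + v"
abbreviation "K \<equiv> q + l + u"
abbreviation "\<Sigma> \<equiv> L2_set \<sigma> {..<2}"

text \<open>Transposition exchanges the roles of \<open>(\<epsilon>, n, B)\<close> and \<open>(\<eta>, m, C)\<close>, so that a statement on block columns
  of \<open>X S\<close> yields the one on block rows of \<open>S Y\<close>.\<close>

lemma transposed:
  "kron_pencil n m l v u q p \<eta> \<epsilon> (\<lambda>k i j. S k j i) (\<lambda>i j. A j i) (\<lambda>i j. C j i) (\<lambda>i j. B j i) \<rho>A \<rho>C \<rho>B \<sigma>"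
  by unfold_locales
     (assumption | rule dims pos s12 s13 s21 s22(1) s31 s23 s32 s33 S_bound
        op_bound_transpose[OF A] op_bound_transpose[OF B] op_bound_transpose[OF C]
        op_bound_transpose[OF S_bound]
      | simp add: s13 s22(2) eq_commute[of _ "_ :: nat"] del: One_nat_def)+

lemma rmul_transpose:
  "rmul c T Y k i j = lmul c (\<lambda>a b. Y b a) (\<lambda>k a b. T k b a) k j i"
  by (simp add: rmul_def lmul_def mult.commute)

lemma lmul_col3:
  assumes "c < u"
  shows "lmul R X S 0 i (q + l + c) = X i c" "lmul R X S 1 i (q + l + c) = - X i (c + m)"
proof -
  have c: "c < p" "c + m < p" using assms dims(3) by auto
  have "(\<Sum>a<p. X i a * S 0 a (q + l + c)) = (\<Sum>a<p. if a = c then X i a else 0)"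
    by (rule sum.cong) (use assms in \<open>auto simp: s13\<close>)
  then show "lmul R X S 0 i (q + l + c) = X i c"
    unfolding lmul_def sum_split3 using assms c by (simp add: s23 s33)
  have "(\<Sum>a<p. X i a * S 1 a (q + l + c)) = (\<Sum>a<p. if a = c + m then - X i a else 0)"
    by (rule sum.cong) (use assms in \<open>auto simp: s13(2) simp del: One_nat_def\<close>)
  then show "lmul R X S 1 i (q + l + c) = - X i (c + m)"
    unfolding lmul_def sum_split3 using assms c by (simp add: s23 s33)
qed

lemma lmul_col2:
  assumes "j < l"
  shows "lmul R X S 0 i (q + j) = (\<Sum>a<m. X i (u + a) * C a j) + (\<Sum>a<l. X i (p + a) * A a j)"
    and "lmul R X S 1 i (q + j) = - X i (p + j)"
proof -
  have "(\<Sum>a<p. X i a * S 0 a (q + j)) = (\<Sum>a<u + m + 0. X i a * (if u \<le> a then C (a - u) j else 0))"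
    using assms by (simp add: dims(3)[symmetric] s12)
  also have "\<dots> = (\<Sum>a<m. X i (u + a) * C a j)"
    unfolding sum_split3 by simp
  finally show "lmul R X S 0 i (q + j) = (\<Sum>a<m. X i (u + a) * C a j) + (\<Sum>a<l. X i (p + a) * A a j)"
    unfolding lmul_def sum_split3 using assms by (simp add: s22 s32)
  have "(\<Sum>a<l. X i (p + a) * S 1 (p + a) (q + j)) = (\<Sum>a<l. if a = j then - X i (p + a) else 0)"
    by (rule sum.cong) (use assms in \<open>auto simp: s22(2) simp del: One_nat_def\<close>)
  then show "lmul R X S 1 i (q + j) = - X i (p + j)"
    unfolding lmul_def sum_split3 using assms by (simp add: s12(2) s32 del: One_nat_def)
qed

lemma lmul_col1:
  assumes j: "j < q" and X: "\<And>a. a < p + l \<Longrightarrow> X i a = 0"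
  shows "lmul R X S 0 i j = (if j < v then X i (p + l + j) else 0)"
    and "lmul R X S 1 i j = (if n \<le> j then - X i (p + l + (j - n)) else 0)"
proof -
  have "(\<Sum>a<v. X i (p + l + a) * S 0 (p + l + a) j) = (\<Sum>a<v. if a = j then X i (p + l + a) else 0)"
    by (rule sum.cong) (use j in \<open>auto simp: s31\<close>)
  then show "lmul R X S 0 i j = (if j < v then X i (p + l + j) else 0)"
    unfolding lmul_def sum_split3 by (simp add: X)
  have "(\<Sum>a<v. X i (p + l + a) * S 1 (p + l + a) j)
      = (\<Sum>a<v. if a = j - n then (if n \<le> j then - X i (p + l + a) else 0) else 0)"
    by (rule sum.cong) (use j in \<open>auto simp: s31(2) simp del: One_nat_def\<close>)
  moreover have "j - n < v" if "n \<le> j" using that j dims(4) by auto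
  ultimately show "lmul R X S 1 i j = (if n \<le> j then - X i (p + l + (j - n)) else 0)"
    unfolding lmul_def sum_split3 by (auto simp: X simp del: One_nat_def)
qed

lemma rmul_row3:
  assumes "r < v"
  shows "rmul K S Y 0 (p + l + r) j = Y r j" "rmul K S Y 1 (p + l + r) j = - Y (r + n) j"
proof -
  interpret T: kron_pencil n m l v u q p \<eta> \<epsilon> "\<lambda>k i j. S k j i" "\<lambda>i j. A j i" "\<lambda>i j. C j i" "\<lambda>i j. B j i" \<rho>A \<rho>C \<rho>B \<sigma>
    by (rule transposed)
  show "rmul K S Y 0 (p + l + r) j = Y r j" "rmul K S Y 1 (p + l + r) j = - Y (r + n) j"
    unfolding rmul_transpose by (rule T.lmul_col3[OF assms])+
qed

lemma rmul_row2:
  assumes "i < l"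
  shows "rmul K S Y 0 (p + i) j = (\<Sum>b<n. B i b * Y (v + b) j) + (\<Sum>b<l. A i b * Y (q + b) j)"
    and "rmul K S Y 1 (p + i) j = - Y (q + i) j"
proof -
  interpret T: kron_pencil n m l v u q p \<eta> \<epsilon> "\<lambda>k i j. S k j i" "\<lambda>i j. A j i" "\<lambda>i j. C j i" "\<lambda>i j. B j i" \<rho>A \<rho>C \<rho>B \<sigma>
    by (rule transposed)
  show "rmul K S Y 0 (p + i) j = (\<Sum>b<n. B i b * Y (v + b) j) + (\<Sum>b<l. A i b * Y (q + b) j)"
    unfolding rmul_transpose T.lmul_col2(1)[OF assms] by (simp add: mult.commute)
  show "rmul K S Y 1 (p + i) j = - Y (q + i) j"
    unfolding rmul_transpose by (rule T.lmul_col2(2)[OF assms])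
qed

lemma rmul_row1:
  assumes "i < p" "\<And>b. b < q + l \<Longrightarrow> Y b j = 0"
  shows "rmul K S Y 0 i j = (if i < u then Y (q + l + i) j else 0)"
    and "rmul K S Y 1 i j = (if m \<le> i then - Y (q + l + (i - m)) j else 0)"
proof -
  interpret T: kron_pencil n m l v u q p \<eta> \<epsilon> "\<lambda>k i j. S k j i" "\<lambda>i j. A j i" "\<lambda>i j. C j i" "\<lambda>i j. B j i" \<rho>A \<rho>C \<rho>B \<sigma>
    by (rule transposed)
  show "rmul K S Y 0 i j = (if i < u then Y (q + l + i) j else 0)"
    "rmul K S Y 1 i j = (if m \<le> i then - Y (q + l + (i - m)) j else 0)"
    unfolding rmul_transpose using assms by (auto simp: T.lmul_col1 simp del: One_nat_def)
qed

lemma pfro_linear_defect: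
  "pfro R K (linear_defect R K S \<Delta> X Y) \<le> pfro R K \<Delta> + (fro R R X + fro K K Y) * \<Sigma>"
proof -
  have "pfro R K (linear_defect R K S \<Delta> X Y)
      \<le> pfro R K \<Delta> + pfro R K (lmul R X S) + pfro R K (rmul K S Y)"
    unfolding linear_defect_def
    by (rule order_trans[OF pfro_diff add_right_mono[OF pfro_diff]])
  also have "\<dots> \<le> pfro R K \<Delta> + fro R R X * \<Sigma> + fro K K Y * \<Sigma>"
    by (intro add_mono order_refl pfro_lmul_spectral pfro_rmul_spectral S_bound)
  finally show ?thesis by (simp add: algebra_simps)
qed

end

section \<open>Zero patterns of the three stages\<close>

text \<open>Patterns of the factors, for a partition into blocks of sizes \<open>x\<close>, \<open>y\<close> and the rest. Those of the
  right factors are the transposed ones.\<close>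

definition lower_mask :: "nat \<Rightarrow> nat \<Rightarrow> nat \<Rightarrow> nat \<Rightarrow> bool" where
  "lower_mask x y i j \<longleftrightarrow> x \<le> i \<and> j < x \<or> x + y \<le> i \<and> j < x + y"

definition diag_mask :: "nat \<Rightarrow> nat \<Rightarrow> nat \<Rightarrow> nat \<Rightarrow> bool" where
  "diag_mask x y i j \<longleftrightarrow> i < x \<and> j < x \<or> x \<le> i \<and> i < x + y \<and> x \<le> j \<and> j < x + y \<or> x + y \<le> i \<and> x + y \<le> j"

definition upper_band_mask :: "nat \<Rightarrow> nat \<Rightarrow> nat \<Rightarrow> nat \<Rightarrow> bool" where
  "upper_band_mask x y i j \<longleftrightarrow> i < x \<and> x \<le> j \<and> j < x + y \<or> x \<le> i \<and> i < x + y \<and> x + y \<le> j"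

lemma split_index:
  fixes i :: nat
  assumes "i < x + y + z"
  obtains "i < x" | i' where "i = x + i'" "i' < y" | i' where "i = x + y + i'" "i' < z"
proof (cases "i < x")
  case True then show thesis by (rule that(1))
next
  case ge: False
  show thesis
  proof (cases "i < x + y")
    case True then show thesis using ge by (intro that(2)[of "i - x"]) auto
  next
    case False then show thesis using ge assms by (intro that(3)[of "i - (x + y)"]) auto
  qed
qed

lemma less_2_cases_nat: "(k::nat) < 2 \<Longrightarrow> k = 0 \<or> k = 1"
  by auto

text \<open>Where a perturbation may differ from \<open>S\<close> after each of the stages: outside the blocks \<open>(2,3)\<close>, \<open>(3,2)\<close>,
  \<open>(3,3)\<close>; then also outside \<open>(1,3)\<close>, \<open>(3,1)\<close> and the coefficient of \<open>\<lambda>\<close> in \<open>(2,2)\<close>; and finally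
  only in \<open>M\<close> and at the places of \<open>A\<close>, \<open>B\<close> and \<open>C\<close>.\<close>

definition zero_mask :: "nat \<Rightarrow> nat \<Rightarrow> nat \<Rightarrow> nat \<Rightarrow> nat \<Rightarrow> nat \<Rightarrow> bool" where
  "zero_mask p q l k i j \<longleftrightarrow> i < p \<or> j < q \<or> i < p + l \<and> j < q + l"

definition normalized_mask :: "nat \<Rightarrow> nat \<Rightarrow> nat \<Rightarrow> nat \<Rightarrow> nat \<Rightarrow> nat \<Rightarrow> bool" where
  "normalized_mask p q l k i j \<longleftrightarrow> i < p \<and> j < q + l \<or> i < p + l \<and> j < q \<or> k = 0 \<and> i < p + l \<and> j < q + l"

definition Kronecker_mask :: "nat \<Rightarrow> nat \<Rightarrow> nat \<Rightarrow> nat \<Rightarrow> nat \<Rightarrow> nat \<Rightarrow> nat \<Rightarrow> nat \<Rightarrow> bool" where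
  "Kronecker_mask p q l u v k i j \<longleftrightarrow> i < p \<and> j < q \<or> k = 0 \<and> u \<le> i \<and> i < p + l \<and> v \<le> j \<and> j < q + l"

section \<open>Solutions of the linearized stages\<close>

text \<open>The Cauchy-Schwarz inequality, with \<open>4\<^sup>2 + 2\<^sup>2 + 2\<^sup>2 = 24\<close> rounded up to \<open>5\<^sup>2\<close>.\<close>

lemma weighted_sum_le:
  fixes a b c d :: real
  assumes "a\<^sup>2 + b\<^sup>2 + c\<^sup>2 \<le> d\<^sup>2" "0 \<le> d"
  shows "4 * a + 2 * b + 2 * c \<le> 5 * d"
proof (rule power2_le_imp_le)
  have "(4 * a + 2 * b + 2 * c)\<^sup>2 + (4 * b - 2 * a)\<^sup>2 + (4 * c - 2 * a)\<^sup>2 + (2 * c - 2 * b)\<^sup>2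
      = 24 * (a\<^sup>2 + b\<^sup>2 + c\<^sup>2)"
    by (simp add: power2_eq_square algebra_simps)
  then have "(4 * a + 2 * b + 2 * c)\<^sup>2 \<le> 24 * (a\<^sup>2 + b\<^sup>2 + c\<^sup>2)"
    using zero_le_power2[of "4 * b - 2 * a"] zero_le_power2[of "4 * c - 2 * a"]
      zero_le_power2[of "2 * c - 2 * b"] by linarith
  also have "\<dots> \<le> 24 * d\<^sup>2" using assms(1) by (rule mult_left_mono) simp
  also have "\<dots> \<le> 25 * d\<^sup>2" by simp
  finally show "(4 * a + 2 * b + 2 * c)\<^sup>2 \<le> (5 * d)\<^sup>2" by (simp add: power_mult_distrib)
qed (use assms(2) in simp)

context kron_pencil
begin

definition "\<alpha> = 1 + 2 * real \<epsilon> * max 1 (\<rho>A ^ \<epsilon>)"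
definition "\<beta> = 1 + 2 * real \<eta> * max 1 (\<rho>A ^ \<eta>)"
definition "\<gamma> = real (\<epsilon> + \<eta>) / (2 * sqrt 2)"
definition "s = max \<alpha> (max \<beta> \<gamma>) + \<gamma> * (\<beta> * \<rho>B + \<alpha> * \<rho>C)"

lemma rho_nonneg: "0 \<le> \<rho>A" "0 \<le> \<rho>B" "0 \<le> \<rho>C"
  using A B C by (auto dest: op_bound_nonneg)

lemma block_dims: "(\<eta> + 1) * m = p" "(\<epsilon> + 1) * n = q" "\<eta> * m = u" "\<epsilon> * n = v"
  using dims by auto

text \<open>The bounds of the equations with the state matrix take the form of the constants \<open>\<alpha>\<close> and \<open>\<beta>\<close>.\<close>

lemma state_bound:
  fixes N r c :: nat and T :: "nat \<Rightarrow> nat \<Rightarrow> nat \<Rightarrow> 'a"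
  defines "w \<equiv> real N * max 1 (\<rho>A ^ N) * (fro r c (T 0) + fro r c (T 1))"
  shows "w \<le> (1 + 2 * real N * max 1 (\<rho>A ^ N)) * pfro r c T"
    and "fro r c (T 1) + w \<le> (1 + 2 * real N * max 1 (\<rho>A ^ N)) * pfro r c T"
proof -
  let ?k = "real N * max 1 (\<rho>A ^ N)"
  have "fro r c (T 0) + fro r c (T 1) \<le> 2 * pfro r c T"
    using fro_coeff_sum_le[where r = r and c = c and T = T] mult_right_mono[OF sqrt2_less_2[THEN less_imp_le] pfro_nonneg[of r c T]]
    by linarith
  then have "w \<le> ?k * (2 * pfro r c T)" unfolding w_def by (rule mult_left_mono) simp
  then show "w \<le> (1 + 2 * real N * max 1 (\<rho>A ^ N)) * pfro r c T"
    "fro r c (T 1) + w \<le> (1 + 2 * real N * max 1 (\<rho>A ^ N)) * pfro r c T"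
  proof -
    have "(1 + 2 * real N * max 1 (\<rho>A ^ N)) * pfro r c T = pfro r c T + ?k * (2 * pfro r c T)"
      by (simp add: algebra_simps)
    moreover have "fro r c (T 1) \<le> pfro r c T" by (rule fro_le_pfro) simp
    moreover note pfro_nonneg[of r c T] and \<open>w \<le> ?k * (2 * pfro r c T)\<close>
    ultimately show "w \<le> (1 + 2 * real N * max 1 (\<rho>A ^ N)) * pfro r c T"
      "fro r c (T 1) + w \<le> (1 + 2 * real N * max 1 (\<rho>A ^ N)) * pfro r c T"
      by linarith+
  qed
qed

text \<open>The corner block \<open>(3,3)\<close> is cleared first; its unknowns enter the equations for \<open>(2,3)\<close> and \<open>(3,2)\<close> only
  through \<open>B\<close> and \<open>C\<close>. So these two equations, transposes of each other, can then be solved with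
  correspondingly modified right-hand sides \<open>G\<close> and \<open>H\<close>.\<close>

lemma clear_blocks_solution:
  "\<exists>X Y. mat_supp R R (lower_mask p l) X \<and> mat_supp K K (\<lambda>i j. lower_mask q l j i) Y \<and>
     fro R R X + fro K K Y \<le> 5 * s * pfro R K \<Delta> \<and>
     pencil_supp R K (zero_mask p q l) (linear_defect R K S \<Delta> X Y)"
proof -
  let ?d = "pfro R K \<Delta>"
  define \<Delta>33 where "\<Delta>33 = blk (p + l) (q + l) \<Delta>"
  define \<Delta>23 where "\<Delta>23 = blk p (q + l) \<Delta>"
  define \<Delta>32 where "\<Delta>32 = blk (p + l) q \<Delta>"
  let ?d33 = "pfro v u \<Delta>33" and ?d23 = "pfro l u \<Delta>23" and ?d32 = "pfro v l \<Delta>32"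
  have pyth: "?d33\<^sup>2 + ?d23\<^sup>2 + ?d32\<^sup>2 \<le> ?d\<^sup>2"
    unfolding pfro_blocks[of p l v q l u \<Delta>] \<Delta>33_def \<Delta>23_def \<Delta>32_def
    by (simp add: add_nonneg_nonneg)
  have d33: "?d33 \<le> ?d"
    by (rule power2_le_imp_le) (use pyth zero_le_power2[of ?d23] zero_le_power2[of ?d32] in \<open>linarith, simp\<close>)
  define t where "t = 2 * \<gamma> * ?d33"
  obtain X31 Y13 where
    e33: "\<And>r c. r < v \<Longrightarrow> c < u \<Longrightarrow> X31 r c + Y13 r c = \<Delta>33 0 r c \<and> X31 r (c + m) + Y13 (r + n) c = - \<Delta>33 1 r c"
    and n31: "fro v p X31 \<le> real (min \<epsilon> \<eta>) * (fro v u (\<Delta>33 0) + fro v u (\<Delta>33 1))"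
    and n13: "fro q u Y13 \<le> real (min \<epsilon> \<eta>) * (fro v u (\<Delta>33 0) + fro v u (\<Delta>33 1))"
    using solve_corner[OF pos, of \<epsilon> \<eta> "\<Delta>33 0" "\<lambda>r c. - \<Delta>33 1 r c"] unfolding block_dims by auto
  have corner: "real (min \<epsilon> \<eta>) * (fro v u (\<Delta>33 0) + fro v u (\<Delta>33 1)) \<le> t"
  proof -
    have "real (min \<epsilon> \<eta>) * (fro v u (\<Delta>33 0) + fro v u (\<Delta>33 1)) \<le> (real (\<epsilon> + \<eta>) / 2) * (sqrt 2 * ?d33)"
      by (rule mult_mono) (use fro_coeff_sum_le[where r = v and c = u and T = \<Delta>33] in \<open>auto simp: min_def\<close>)
    also have "sqrt 2 = 2 / sqrt 2" by (simp add: real_div_sqrt)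
    finally have "real (min \<epsilon> \<eta>) * (fro v u (\<Delta>33 0) + fro v u (\<Delta>33 1))
        \<le> (real (\<epsilon> + \<eta>) / 2) * ((2 / sqrt 2) * ?d33)" .
    also have "x / 2 * (2 / sqrt 2 * y) = 2 * (x / (2 * sqrt 2)) * y" for x y :: real by simp
    finally show ?thesis by (simp only: t_def \<gamma>_def)
  qed
  have t31: "fro v p X31 \<le> t" and t13: "fro q u Y13 \<le> t" using n31 n13 corner by linarith+
  define G where "G = (\<lambda>k i c. \<Delta>23 k i c - (if k = 0 then (\<lambda>i c. \<Sum>b<n. B i b * Y13 (v + b) c) else (\<lambda>_ _. 0)) i c)"
  have G: "pfro l u G \<le> ?d23 + \<rho>B * t"
  proof -
    have "pfro l u G \<le> ?d23 + fro l u (\<lambda>i c. \<Sum>b<n. B i b * Y13 (v + b) c)"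
      unfolding G_def by (rule order_trans[OF pfro_diff]) (simp add: pfro_const)
    also have "fro l u (\<lambda>i c. \<Sum>b<n. B i b * Y13 (v + b) c) \<le> \<rho>B * fro n u (\<lambda>b c. Y13 (v + b) c)"
      by (rule fro_mult_left_le[OF B])
    also have "\<dots> \<le> \<rho>B * t"
      using fro_shift_le[of v n q 0 u u Y13] t13 rho_nonneg dims(4) by (intro mult_left_mono) auto
    finally show ?thesis by simp
  qed
  obtain X21 Y23 where
    e23: "\<And>i c. i < l \<Longrightarrow> c < u \<Longrightarrow> X21 i c + (\<Sum>a<l. A i a * Y23 a c) = G 0 i c \<and> X21 i (c + m) + Y23 i c = - G 1 i c"
    and n21: "fro l p X21 \<le> real \<eta> * max 1 (\<rho>A ^ \<eta>) * (fro l u (G 0) + fro l u (G 1))"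
    and n23: "fro l u Y23 \<le> fro l u (G 1) + real \<eta> * max 1 (\<rho>A ^ \<eta>) * (fro l u (G 0) + fro l u (G 1))"
    using solve_state_outer[OF A pos(1), of \<eta> "G 0" "\<lambda>i c. - G 1 i c"] unfolding block_dims by auto
  note GG = state_bound[where r = l and c = u and T = G and N = \<eta>, folded \<beta>_def]
  have t21: "fro l p X21 \<le> \<beta> * pfro l u G" using n21 GG(1) by linarith
  have t23: "fro l u Y23 \<le> \<beta> * pfro l u G" using n23 GG(2) by linarith
  define H where "H = (\<lambda>k i c. \<Delta>32 k c i - (if k = 0 then (\<lambda>i c. \<Sum>b<m. C b i * X31 c (u + b)) else (\<lambda>_ _. 0)) i c)"
  have flip: "pfro l v (\<lambda>k i c. \<Delta>32 k c i) = ?d32"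
  proof -
    have "fro l v (\<lambda>i c. \<Delta>32 k c i) = fro v l (\<Delta>32 k)" for k by (rule fro_transpose)
    then show ?thesis by (simp add: pfro_def)
  qed
  have H: "pfro l v H \<le> ?d32 + \<rho>C * t"
  proof -
    have "pfro l v H \<le> ?d32 + fro l v (\<lambda>i c. \<Sum>b<m. C b i * X31 c (u + b))"
      unfolding H_def by (rule order_trans[OF pfro_diff]) (simp add: pfro_const flip)
    also have "fro l v (\<lambda>i c. \<Sum>b<m. C b i * X31 c (u + b)) \<le> \<rho>C * fro m v (\<lambda>b c. X31 c (u + b))"
      by (rule fro_mult_left_le[OF op_bound_transpose[OF C]])
    also have "fro m v (\<lambda>b c. X31 c (u + b)) = fro v m (\<lambda>c b. X31 c (u + b))"
      by (rule fro_transpose)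
    also have "\<rho>C * \<dots> \<le> \<rho>C * t"
      using fro_shift_le[of 0 v v u m p X31] t31 rho_nonneg dims(3) by (intro mult_left_mono) auto
    finally show ?thesis by simp
  qed
  obtain Y12 X32 where
    e32: "\<And>i c. i < l \<Longrightarrow> c < v \<Longrightarrow> Y12 i c + (\<Sum>a<l. A a i * X32 a c) = H 0 i c \<and> Y12 i (c + n) + X32 i c = - H 1 i c"
    and n12: "fro l q Y12 \<le> real \<epsilon> * max 1 (\<rho>A ^ \<epsilon>) * (fro l v (H 0) + fro l v (H 1))"
    and n32: "fro l v X32 \<le> fro l v (H 1) + real \<epsilon> * max 1 (\<rho>A ^ \<epsilon>) * (fro l v (H 0) + fro l v (H 1))"
    using solve_state_outer[OF op_bound_transpose[OF A] pos(2), of \<epsilon> "H 0" "\<lambda>i c. - H 1 i c"]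
    unfolding block_dims by auto
  note HH = state_bound[where r = l and c = v and T = H and N = \<epsilon>, folded \<alpha>_def]
  have t12: "fro q l (\<lambda>i j. Y12 j i) \<le> \<alpha> * pfro l v H" using fro_transpose[where r = q and c = l and X = Y12] n12 HH(1) by simp
  have t32: "fro v l (\<lambda>i j. X32 j i) \<le> \<alpha> * pfro l v H"
    using fro_transpose[where r = v and c = l and X = X32] n32 HH(2) by simp
  define X where "X = (\<lambda>i j. place (p + l) v 0 p X31 i j + place p l 0 p X21 i j
      + place (p + l) v p l (\<lambda>i j. X32 j i) i j)"
  define Y where "Y = (\<lambda>i j. place 0 q (q + l) u Y13 i j + place q l (q + l) u Y23 i j
      + place 0 q q l (\<lambda>i j. Y12 j i) i j)"
  have nX: "fro R R X \<le> t + \<beta> * pfro l u G + \<alpha> * pfro l v H"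
    unfolding X_def
    by (intro order_trans[OF fro_add] add_mono) (rule order_trans[OF fro_place]; rule t31 t21 t32)+
  have nY: "fro K K Y \<le> t + \<beta> * pfro l u G + \<alpha> * pfro l v H"
    unfolding Y_def
    by (intro order_trans[OF fro_add] add_mono) (rule order_trans[OF fro_place]; rule t13 t23 t12)+
  have pos': "0 \<le> \<alpha>" "0 \<le> \<beta>" "0 \<le> \<gamma>" by (simp_all add: \<alpha>_def \<beta>_def \<gamma>_def)
  have "fro R R X + fro K K Y \<le> 2 * t + 2 * (\<beta> * pfro l u G) + 2 * (\<alpha> * pfro l v H)"
    using nX nY by linarith
  also have "\<dots> \<le> 2 * t + 2 * (\<beta> * (?d23 + \<rho>B * t)) + 2 * (\<alpha> * (?d32 + \<rho>C * t))"
    using mult_left_mono[OF G pos'(2)] mult_left_mono[OF H pos'(1)] by linarith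
  also have "\<dots> = 4 * (\<gamma> * ?d33) + 2 * (\<beta> * ?d23) + 2 * (\<alpha> * ?d32) + 4 * (\<gamma> * (\<beta> * \<rho>B + \<alpha> * \<rho>C)) * ?d33"
    by (simp add: t_def algebra_simps)
  also have "\<dots> \<le> 5 * s * ?d"
  proof -
    let ?M = "max \<alpha> (max \<beta> \<gamma>)" and ?c = "\<gamma> * (\<beta> * \<rho>B + \<alpha> * \<rho>C)"
    have c: "0 \<le> ?c" using pos' rho_nonneg by simp
    have "\<gamma> * ?d33 \<le> ?M * ?d33" "\<beta> * ?d23 \<le> ?M * ?d23" "\<alpha> * ?d32 \<le> ?M * ?d32"
      by (rule mult_right_mono; simp)+
    then have "4 * (\<gamma> * ?d33) + 2 * (\<beta> * ?d23) + 2 * (\<alpha> * ?d32) \<le> ?M * (4 * ?d33 + 2 * ?d23 + 2 * ?d32)"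
      by (simp add: algebra_simps)
    also have "\<dots> \<le> ?M * (5 * ?d)"
      by (rule mult_left_mono[OF weighted_sum_le[OF pyth]]) (use pos' in auto)
    finally have 1: "4 * (\<gamma> * ?d33) + 2 * (\<beta> * ?d23) + 2 * (\<alpha> * ?d32) \<le> ?M * (5 * ?d)" .
    have "4 * ?c * ?d33 \<le> 5 * ?c * ?d" by (rule mult_mono) (use c d33 in auto)
    with 1 show ?thesis by (simp add: s_def algebra_simps)
  qed
  finally have norm: "fro R R X + fro K K Y \<le> 5 * s * ?d" .
  have suppX: "mat_supp R R (lower_mask p l) X"
    by (auto simp: mat_supp_def X_def place_def lower_mask_def)
  have suppY: "mat_supp K K (\<lambda>i j. lower_mask q l j i) Y"
    by (auto simp: mat_supp_def Y_def place_def lower_mask_def)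
  have X2: "X (p + i) c = X21 i c" if "i < l" "c < p" for i c using that by (simp add: X_def place_def)
  have X31: "X (p + l + r) c = X31 r c" if "r < v" "c < p" for r c using that by (simp add: X_def place_def)
  have X32: "X (p + l + r) (p + a) = X32 a r" if "r < v" "a < l" for r a using that by (simp add: X_def place_def)
  have Y13: "Y b (q + l + c) = Y13 b c" if "b < q" "c < u" for b c using that by (simp add: Y_def place_def)
  have Y23: "Y (q + b) (q + l + c) = Y23 b c" if "b < l" "c < u" for b c using that by (simp add: Y_def place_def)
  have Y12: "Y b (q + j) = Y12 j b" if "b < q" "j < l" for b j using that by (simp add: Y_def place_def)
  have up: "c < p" "c + m < p" if "c < u" for c using that dims(3) by auto
  have vq: "r < q" "r + n < q" if "r < v" for r using that dims(4) by auto
  have Bq: "v + b < q" if "b < n" for b using that dims(4) by auto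
  have Cp: "u + a < p" if "a < m" for a using that dims(3) by auto
  have z23: "linear_defect R K S \<Delta> X Y k (p + i) (q + l + c) = 0" if "k < 2" "i < l" "c < u" for k i c
  proof -
    have "linear_defect R K S \<Delta> X Y 0 (p + i) (q + l + c)
        = \<Delta>23 0 i c - X21 i c - ((\<Sum>b<n. B i b * Y13 (v + b) c) + (\<Sum>a<l. A i a * Y23 a c))"
      and "linear_defect R K S \<Delta> X Y 1 (p + i) (q + l + c) = \<Delta>23 1 i c + (X21 i (c + m) + Y23 i c)"
      using that by (simp_all add: linear_defect_def lmul_col3 rmul_row2 X2 Y13 Y23 up Bq \<Delta>23_def blk_def
          del: One_nat_def)
    with less_2_cases_nat[OF that(1)] e23[OF that(2,3)] show ?thesis
      by (elim disjE) (simp add: G_def algebra_simps del: One_nat_def, simp add: G_def del: One_nat_def)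
  qed
  have z32: "linear_defect R K S \<Delta> X Y k (p + l + r) (q + j) = 0" if "k < 2" "r < v" "j < l" for k r j
  proof -
    have "linear_defect R K S \<Delta> X Y 0 (p + l + r) (q + j)
        = \<Delta>32 0 r j - ((\<Sum>b<m. C b j * X31 r (u + b)) + (\<Sum>a<l. A a j * X32 a r)) - Y12 j r"
      and "linear_defect R K S \<Delta> X Y 1 (p + l + r) (q + j) = \<Delta>32 1 r j + (Y12 j (r + n) + X32 j r)"
      using that by (simp_all add: linear_defect_def lmul_col2 rmul_row3 X31 X32 Y12 vq Cp \<Delta>32_def blk_def
          mult.commute del: One_nat_def)
    with less_2_cases_nat[OF that(1)] e32[OF that(3,2)] show ?thesis
      by (elim disjE) (simp add: H_def algebra_simps del: One_nat_def, simp add: H_def del: One_nat_def)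
  qed
  have z33: "linear_defect R K S \<Delta> X Y k (p + l + r) (q + l + c) = 0" if "k < 2" "r < v" "c < u" for k r c
  proof -
    have "linear_defect R K S \<Delta> X Y 0 (p + l + r) (q + l + c) = \<Delta>33 0 r c - X31 r c - Y13 r c"
      and "linear_defect R K S \<Delta> X Y 1 (p + l + r) (q + l + c) = \<Delta>33 1 r c + X31 r (c + m) + Y13 (r + n) c"
      using that by (simp_all add: linear_defect_def lmul_col3 rmul_row3 X31 Y13 vq up \<Delta>33_def blk_def
          del: One_nat_def)
    with less_2_cases_nat[OF that(1)] e33[OF that(2,3)] show ?thesis
      by (auto simp: algebra_simps simp del: One_nat_def)
  qed
  have "pencil_supp R K (zero_mask p q l) (linear_defect R K S \<Delta> X Y)"
    unfolding pencil_supp_def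
  proof (intro allI impI)
    fix k i j assume k: "k < 2" and i: "i < R" and j: "j < K" and nz: "\<not> zero_mask p q l k i j"
    show "linear_defect R K S \<Delta> X Y k i j = 0"
      using i
    proof (cases rule: split_index)
      case 1 then show ?thesis using nz by (simp add: zero_mask_def)
    next
      case (2 i') show ?thesis
        using j by (cases rule: split_index) (use 2 nz k z23 in \<open>auto simp: zero_mask_def\<close>)
    next
      case (3 i') show ?thesis
        using j by (cases rule: split_index) (use 3 nz k z32 z33 in \<open>auto simp: zero_mask_def\<close>)
    qed
  qed
  then show ?thesis using suppX suppY norm by blast
qed

end

lemma pfro_flip: "pfro c r (\<lambda>k i j. T k j i) = pfro r c T"
proof -
  have "fro c r (\<lambda>i j. T k j i) = fro r c (T k)" for k by (rule fro_transpose)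
  then show ?thesis by (simp add: pfro_def)
qed

lemma sum_two_le:
  fixes a b d :: real
  assumes "a\<^sup>2 + b\<^sup>2 \<le> d\<^sup>2" "0 \<le> d"
  shows "a + b \<le> sqrt 2 * d"
proof (rule power2_le_imp_le)
  have "(a + b)\<^sup>2 \<le> 2 * (a\<^sup>2 + b\<^sup>2)"
    using zero_le_power2[of "a - b"] by (simp add: power2_eq_square algebra_simps)
  also have "\<dots> \<le> 2 * d\<^sup>2" using assms(1) by simp
  finally show "(a + b)\<^sup>2 \<le> (sqrt 2 * d)\<^sup>2" by (simp add: power_mult_distrib)
qed (use assms(2) in simp)

context kron_pencil
begin

text \<open>The three equations decouple: \<open>(3,1)\<close> contains only \<open>X\<^sub>3\<^sub>3\<close> and \<open>Y\<^sub>1\<^sub>1\<close>, \<open>(1,3)\<close> only \<open>X\<^sub>1\<^sub>1\<close> and \<open>Y\<^sub>3\<^sub>3\<close>,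
  and in \<open>(2,2)\<close> the choice \<open>Y\<^sub>2\<^sub>2 = 0\<close> leaves one matrix to be read off. The bound of the defect is better
  than that of the factors because \<open>X\<^sub>3\<^sub>3\<close> and \<open>Y\<^sub>3\<^sub>3\<close> act on the third block row and column only, where the
  defect vanishes; they are left out of \<open>X'\<close> and \<open>Y'\<close>.\<close>

lemma normalize_blocks_solution:
  assumes pos_N: "0 < max \<epsilon> \<eta>" and \<Delta>: "pencil_supp R K (zero_mask p q l) \<Delta>"
  shows "\<exists>X Y. mat_supp R R (diag_mask p l) X \<and> mat_supp K K (diag_mask q l) Y \<and>
     fro R R X + fro K K Y \<le> 20 * real (max \<epsilon> \<eta>) * pfro R K \<Delta> \<and>
     pencil_supp R K (normalized_mask p q l) (linear_defect R K S \<Delta> X Y) \<and>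
     pfro R K (linear_defect R K S \<Delta> X Y) \<le> (1 + 5 * real (max \<epsilon> \<eta>) * \<Sigma>) * pfro R K \<Delta>"
proof -
  let ?d = "pfro R K \<Delta>" and ?N = "real (max \<epsilon> \<eta>)"
  define \<Delta>31 where "\<Delta>31 = blk (p + l) 0 \<Delta>"
  define \<Delta>13 where "\<Delta>13 = blk 0 (q + l) \<Delta>"
  define \<Delta>22 where "\<Delta>22 = blk p q \<Delta>"
  let ?d31 = "pfro v q \<Delta>31" and ?d13 = "pfro p u \<Delta>13" and ?d22 = "pfro l l \<Delta>22"
  have pyth: "?d31\<^sup>2 + ?d13\<^sup>2 + ?d22\<^sup>2 \<le> ?d\<^sup>2"
    unfolding pfro_blocks[of p l v q l u \<Delta>] \<Delta>31_def \<Delta>13_def \<Delta>22_def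
    by (simp add: add_nonneg_nonneg)
  have d22: "?d22 \<le> ?d"
    by (rule power2_le_imp_le) (use pyth zero_le_power2[of ?d31] zero_le_power2[of ?d13] in \<open>linarith, simp\<close>)
  have d31: "?d31 + ?d13 \<le> sqrt 2 * ?d"
    by (rule sum_two_le) (use pyth zero_le_power2[of ?d22] in \<open>linarith, simp\<close>)
  have N1: "1 \<le> ?N" using pos_N by linarith
  obtain X33 Y11 where
    e31: "\<And>r c. r < v \<Longrightarrow> c < q \<Longrightarrow> Y11 r c + (if c < v then X33 r c else 0) = \<Delta>31 0 r c \<and>
        Y11 (r + n) c + (if n \<le> c then X33 r (c - n) else 0) = - \<Delta>31 1 r c"
    and n33: "fro v v X33 \<le> fro v q (\<Delta>31 0) + 2 * (real \<epsilon> * (fro v q (\<Delta>31 0) + fro v q (\<Delta>31 1)))"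
    and n11: "fro q q Y11 \<le> 2 * (real \<epsilon> * (fro v q (\<Delta>31 0) + fro v q (\<Delta>31 1)))"
    using solve_Kronecker_block[OF pos(2), of \<epsilon> "\<Delta>31 0" "\<lambda>r c. - \<Delta>31 1 r c"] unfolding block_dims
    by auto
  define \<Delta>13t where "\<Delta>13t = (\<lambda>k c i. \<Delta>13 k i c)"
  have flip: "pfro u p \<Delta>13t = ?d13" unfolding \<Delta>13t_def by (rule pfro_flip)
  obtain Y33 X11 where
    e13: "\<And>c i. c < u \<Longrightarrow> i < p \<Longrightarrow> X11 c i + (if i < u then Y33 c i else 0) = \<Delta>13t 0 c i \<and>
        X11 (c + m) i + (if m \<le> i then Y33 c (i - m) else 0) = - \<Delta>13t 1 c i"
    and n33': "fro u u Y33 \<le> fro u p (\<Delta>13t 0) + 2 * (real \<eta> * (fro u p (\<Delta>13t 0) + fro u p (\<Delta>13t 1)))"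
    and n11': "fro p p X11 \<le> 2 * (real \<eta> * (fro u p (\<Delta>13t 0) + fro u p (\<Delta>13t 1)))"
    using solve_Kronecker_block[OF pos(1), of \<eta> "\<Delta>13t 0" "\<lambda>r c. - \<Delta>13t 1 r c"] unfolding block_dims
    by auto
  have chain: "2 * (real k * (fro a b (T 0) + fro a b (T 1))) \<le> 2 * sqrt 2 * ?N * pfro a b T"
    if "k \<le> max \<epsilon> \<eta>" for k a b and T :: "nat \<Rightarrow> nat \<Rightarrow> nat \<Rightarrow> 'a"
  proof -
    have "real k * (fro a b (T 0) + fro a b (T 1)) \<le> ?N * (sqrt 2 * pfro a b T)"
      by (rule mult_mono[OF _ fro_coeff_sum_le]) (use that in auto)
    moreover have "2 * (?N * (sqrt 2 * pfro a b T)) = 2 * sqrt 2 * ?N * pfro a b T" by simp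
    ultimately show ?thesis by linarith
  qed
  have b11: "fro q q Y11 \<le> 2 * sqrt 2 * ?N * ?d31" using n11 chain[where k = \<epsilon> and a = v and b = q and T = \<Delta>31] by simp
  have b11': "fro p p X11 \<le> 2 * sqrt 2 * ?N * ?d13" using n11' chain[where k = \<eta> and a = u and b = p and T = \<Delta>13t] flip by simp
  have b33: "fro v v X33 \<le> ?d31 + 2 * sqrt 2 * ?N * ?d31"
    using n33 chain[where k = \<epsilon> and a = v and b = q and T = \<Delta>31] fro_le_pfro[of 0 \<Delta>31 v q] by simp
  have b33': "fro u u Y33 \<le> ?d13 + 2 * sqrt 2 * ?N * ?d13"
    using n33' chain[where k = \<eta> and a = u and b = p and T = \<Delta>13t] fro_le_pfro[of 0 \<Delta>13t u p] flip by simp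
  define X22 where "X22 i j = - \<Delta>22 1 i j" for i j
  have b22: "fro l l X22 \<le> ?d22" using fro_le_pfro[of 1 \<Delta>22 l l] by (simp add: X22_def)
  define X' where "X' = (\<lambda>i j. place 0 p 0 p (\<lambda>i j. X11 j i) i j + place p l p l X22 i j)"
  define X where "X = (\<lambda>i j. X' i j + place (p + l) v (p + l) v X33 i j)"
  define Y' where "Y' = place 0 q 0 q Y11"
  define Y where "Y = (\<lambda>i j. Y' i j + place (q + l) u (q + l) u (\<lambda>i j. Y33 j i) i j)"
  have f11: "fro p p (\<lambda>i j. X11 j i) = fro p p X11" by (rule fro_transpose)
  have f33: "fro u u (\<lambda>i j. Y33 j i) = fro u u Y33" by (rule fro_transpose)
  have nX': "fro R R X' \<le> fro p p X11 + fro l l X22"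
    unfolding X'_def f11[symmetric] by (intro order_trans[OF fro_add] add_mono fro_place)
  have nX: "fro R R X \<le> fro R R X' + fro v v X33"
    unfolding X_def by (intro order_trans[OF fro_add] add_mono fro_place order_refl)
  have nY': "fro K K Y' \<le> fro q q Y11" unfolding Y'_def by (rule fro_place)
  have nY: "fro K K Y \<le> fro K K Y' + fro u u Y33"
    unfolding Y_def f33[symmetric] by (intro order_trans[OF fro_add] add_mono fro_place order_refl)
  have b5: "fro R R X' + fro K K Y' \<le> 5 * ?N * ?d"
  proof -
    have "fro R R X' + fro K K Y' \<le> 2 * sqrt 2 * ?N * (?d31 + ?d13) + ?d22"
      using nX' nY' b11 b11' b22 by (simp add: algebra_simps)
    also have "\<dots> \<le> 2 * sqrt 2 * ?N * (sqrt 2 * ?d) + ?d22"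
      using mult_left_mono[OF d31, of "2 * sqrt 2 * ?N"] by simp
    also have "\<dots> = 4 * ?N * ?d + ?d22" by simp
    also have "\<dots> \<le> 5 * ?N * ?d" using d22 mult_right_mono[OF N1 pfro_nonneg[of R K \<Delta>]] by simp
    finally show ?thesis .
  qed
  have "fro v v X33 + fro u u Y33 \<le> (1 + 2 * sqrt 2 * ?N) * (?d31 + ?d13)"
    using b33 b33' by (simp add: algebra_simps)
  also have "\<dots> \<le> (1 + 2 * sqrt 2 * ?N) * (sqrt 2 * ?d)"
    by (rule mult_left_mono[OF d31]) simp
  also have "\<dots> = (sqrt 2 + 4 * ?N) * ?d" by (simp add: algebra_simps)
  also have "\<dots> \<le> (6 * ?N) * ?d"
    by (rule mult_right_mono) (use N1 sqrt2_less_2 in \<open>linarith, simp\<close>)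
  finally have "fro v v X33 + fro u u Y33 \<le> (6 * ?N) * ?d" .
  moreover have "0 \<le> ?N * ?d" by simp
  ultimately have norm: "fro R R X + fro K K Y \<le> 20 * ?N * ?d"
    using nX nY b5 by linarith
  have suppX: "mat_supp R R (diag_mask p l) X"
    by (auto simp: mat_supp_def X_def X'_def place_def diag_mask_def)
  have suppY: "mat_supp K K (diag_mask q l) Y"
    by (auto simp: mat_supp_def Y_def Y'_def place_def diag_mask_def)
  have x11: "X i c = X11 c i" if "i < p" "c < p" for i c using that by (simp add: X_def X'_def place_def)
  have x22: "X (p + i) (p + j) = X22 i j" if "i < l" "j < l" for i j using that by (simp add: X_def X'_def place_def)
  have x33: "X (p + l + i) (p + l + j) = X33 i j" if "i < v" "j < v" for i j using that by (simp add: X_def X'_def place_def)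
  have x21: "X (p + i) c = 0" if "c < p" "i < l" for i c using that by (simp add: X_def X'_def place_def)
  have x3: "X (p + l + i) c = 0" if "c < p + l" for i c using that by (simp add: X_def X'_def place_def)
  have y11: "Y i c = Y11 i c" if "i < q" "c < q" for i c using that by (simp add: Y_def Y'_def place_def)
  have y22: "Y i (q + j) = 0" if "j < l" for i j using that by (simp add: Y_def Y'_def place_def)
  have y33: "Y (q + l + i) (q + l + j) = Y33 j i" if "i < u" "j < u" for i j using that by (simp add: Y_def Y'_def place_def)
  have y3: "Y b (q + l + j) = 0" if "b < q + l" for b j using that by (simp add: Y_def Y'_def place_def)
  have up: "c < p" "c + m < p" if "c < u" for c using that dims(3) by auto
  have vq: "r < q" "r + n < q" if "r < v" for r using that dims(4) by auto
  have Bq: "v + b < q" if "b < n" for b using that dims(4) by auto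
  have Cp: "u + a < p" if "a < m" for a using that dims(3) by auto
  have um: "i - m < u" if "i < p" "m \<le> i" for i using that dims(3) by auto
  have vn: "i - n < v" if "i < q" "n \<le> i" for i using that dims(4) by auto
  have y33m: "Y (q + l + i - m) (q + l + c) = Y33 c (i - m)" if "i < p" "m \<le> i" "c < u" for i c
    using y33[of "i - m" c] um[of i] that by simp
  have x33n: "X (p + l + r) (p + l + j - n) = X33 r (j - n)" if "j < q" "n \<le> j" "r < v" for r j
    using x33[of r "j - n"] vn[of j] that by simp
  let ?T = "linear_defect R K S \<Delta> X Y"
  have z13: "?T k i (q + l + c) = 0" if "k < 2" "i < p" "c < u" for k i c
  proof -
    have "?T 0 i (q + l + c) = \<Delta>13t 0 c i - (X11 c i + (if i < u then Y33 c i else 0))"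
      and "?T 1 i (q + l + c) = \<Delta>13t 1 c i + (X11 (c + m) i + (if m \<le> i then Y33 c (i - m) else 0))"
      using that by (simp_all add: linear_defect_def lmul_col3 rmul_row1 x11 y3 y33 y33m up um \<Delta>13t_def \<Delta>13_def blk_def
          del: One_nat_def)
    with less_2_cases_nat[OF that(1)] e13[OF that(3,2)] show ?thesis
      by (elim disjE) (simp_all only:, simp_all)
  qed
  have z31: "?T k (p + l + r) j = 0" if "k < 2" "r < v" "j < q" for k r j
  proof -
    have "?T 0 (p + l + r) j = \<Delta>31 0 r j - (Y11 r j + (if j < v then X33 r j else 0))"
      and "?T 1 (p + l + r) j = \<Delta>31 1 r j + (Y11 (r + n) j + (if n \<le> j then X33 r (j - n) else 0))"
      using that by (simp_all add: linear_defect_def lmul_col1 rmul_row3 x3 x33 x33n y11 vq vn \<Delta>31_def blk_def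
          del: One_nat_def)
    with less_2_cases_nat[OF that(1)] e31[OF that(2,3)] show ?thesis
      by (elim disjE) (simp_all only:, simp_all)
  qed
  have z22: "?T 1 (p + i) (q + j) = 0" if "i < l" "j < l" for i j
    using that by (simp add: linear_defect_def lmul_col2 rmul_row2 x22 y22 X22_def \<Delta>22_def blk_def del: One_nat_def)
  have zero: "\<Delta> k i j = 0" if "k < 2" "i < R" "j < K" "\<not> zero_mask p q l k i j" for k i j
    using \<Delta> that by (simp add: pencil_supp_def)
  have z23: "?T k (p + i) (q + l + c) = 0" if "k < 2" "i < l" "c < u" for k i c
  proof -
    have "\<Delta> k (p + i) (q + l + c) = 0" by (rule zero) (use that in \<open>auto simp: zero_mask_def\<close>)
    then show ?thesis using that less_2_cases_nat[OF that(1)]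
      by (auto simp: linear_defect_def lmul_col3 rmul_row2 x21 y3 up Bq trans_less_add1 simp del: One_nat_def)
  qed
  have z32: "?T k (p + l + r) (q + j) = 0" if "k < 2" "r < v" "j < l" for k r j
  proof -
    have "\<Delta> k (p + l + r) (q + j) = 0" by (rule zero) (use that in \<open>auto simp: zero_mask_def\<close>)
    then show ?thesis using that less_2_cases_nat[OF that(1)] Cp
      by (auto simp: linear_defect_def lmul_col2 rmul_row3 x3 y22 trans_less_add1 simp del: One_nat_def)
  qed
  have z33: "?T k (p + l + r) (q + l + c) = 0" if "k < 2" "r < v" "c < u" for k r c
  proof -
    have "\<Delta> k (p + l + r) (q + l + c) = 0" by (rule zero) (use that in \<open>auto simp: zero_mask_def\<close>)
    then show ?thesis using that less_2_cases_nat[OF that(1)]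
      by (auto simp: linear_defect_def lmul_col3 rmul_row3 x3 y3 up vq trans_less_add1 simp del: One_nat_def)
  qed
  have supp: "pencil_supp R K (normalized_mask p q l) ?T"
    unfolding pencil_supp_def
  proof (intro allI impI)
    fix k i j assume k: "k < 2" and i: "i < R" and j: "j < K" and nz: "\<not> normalized_mask p q l k i j"
    show "?T k i j = 0"
      using i
    proof (cases rule: split_index)
      case 1 show ?thesis
        using j by (cases rule: split_index) (use 1 nz k z13 in \<open>auto simp: normalized_mask_def\<close>)
    next
      case (2 i') show ?thesis
        using j by (cases rule: split_index)
          (use 2 nz less_2_cases_nat[OF k] z22 z23 in \<open>auto simp: normalized_mask_def\<close>)
    next
      case (3 i') show ?thesis
        using j by (cases rule: split_index) (use 3 nz k z31 z32 z33 in \<open>auto simp: normalized_mask_def\<close>)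
    qed
  qed
  have "pfro R K ?T \<le> pfro R K (linear_defect R K S \<Delta> X' Y')"
  proof (rule pfro_mono)
    fix k i j assume kij: "k < (2::nat)" "i < R" "j < K"
    show "norm (?T k i j) \<le> norm (linear_defect R K S \<Delta> X' Y' k i j)"
    proof (cases "normalized_mask p q l k i j")
      case True
      then have "i < p + l" "j < q + l" by (auto simp: normalized_mask_def)
      then have "X i a = X' i a" "Y b j = Y' b j" for a b by (simp_all add: X_def Y_def place_def)
      then show ?thesis by (simp add: linear_defect_def lmul_def rmul_def)
    next
      case False
      then show ?thesis using supp kij by (simp add: pencil_supp_def)
    qed
  qed
  also have "\<dots> \<le> ?d + (fro R R X' + fro K K Y') * \<Sigma>" by (rule pfro_linear_defect)
  also have "\<dots> \<le> ?d + (5 * ?N * ?d) * \<Sigma>" by (intro add_left_mono mult_right_mono b5) simp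
  finally have "pfro R K ?T \<le> (1 + 5 * ?N * \<Sigma>) * ?d" by (simp add: algebra_simps)
  then show ?thesis using suppX suppY norm supp by blast
qed

text \<open>The blocks \<open>(2,1)\<close> and \<open>(1,2)\<close> lead to two independent equations, transposes of each other. Again the
  defect is estimated with fewer blocks: \<open>X\<^sub>2\<^sub>3 K\<^sub>1\<close> and \<open>K\<^sub>2\<^sup>T Y\<^sub>3\<^sub>2\<close> have no constant coefficient at the places
  of \<open>B\<close> and \<open>C\<close>, where the defect survives, so only \<open>X\<^sub>1\<^sub>2\<close> and \<open>Y\<^sub>2\<^sub>1\<close> count.\<close>

lemma collapse_blocks_solution:
  assumes \<Delta>: "pencil_supp R K (normalized_mask p q l) \<Delta>"
  defines "w \<equiv> 1 + 2 * real (max \<eta> \<epsilon>) * max 1 (\<rho>A ^ max \<eta> \<epsilon>)"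
  shows "\<exists>X Y. mat_supp R R (upper_band_mask p l) X \<and> mat_supp K K (\<lambda>i j. upper_band_mask q l j i) Y \<and>
     fro R R X + fro K K Y \<le> 4 * w * pfro R K \<Delta> \<and>
     pencil_supp R K (Kronecker_mask p q l u v) (linear_defect R K S \<Delta> X Y) \<and>
     pfro R K (linear_defect R K S \<Delta> X Y) \<le> (1 + sqrt 2 * w * \<Sigma>) * pfro R K \<Delta>"
proof -
  let ?d = "pfro R K \<Delta>"
  define \<Delta>21 where "\<Delta>21 = blk p 0 \<Delta>"
  define \<Delta>12 where "\<Delta>12 = blk 0 q \<Delta>"
  let ?d21 = "pfro l q \<Delta>21" and ?d12 = "pfro p l \<Delta>12"
  have pyth: "?d12\<^sup>2 + ?d21\<^sup>2 \<le> ?d\<^sup>2"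
    unfolding pfro_blocks[of p l v q l u \<Delta>] \<Delta>21_def \<Delta>12_def
    by (simp add: add_nonneg_nonneg)
  have d12: "?d12 + ?d21 \<le> sqrt 2 * ?d" by (rule sum_two_le[OF pyth]) simp
  have \<alpha>_le: "1 + 2 * real k * max 1 (\<rho>A ^ k) \<le> w" if "k \<le> max \<eta> \<epsilon>" for k
  proof -
    have "\<rho>A ^ k \<le> max 1 (\<rho>A ^ max \<eta> \<epsilon>)"
    proof (cases "\<rho>A \<le> 1")
      case True
      then show ?thesis using power_le_one[OF rho_nonneg(1) True, of k] by (simp add: max.coboundedI1)
    next
      case False
      then show ?thesis using power_increasing[OF that, of \<rho>A] by (simp add: max.coboundedI2)
    qed
    then have "real k * max 1 (\<rho>A ^ k) \<le> real (max \<eta> \<epsilon>) * max 1 (\<rho>A ^ max \<eta> \<epsilon>)"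
      by (intro mult_mono) (use that in auto)
    then show ?thesis by (simp add: w_def)
  qed
  have "\<exists>X Y. (\<forall>i<l. \<forall>c<v. X i c + (\<Sum>a<l. A i a * Y a c) = \<Delta>21 0 i c)
      \<and> (\<forall>i<l. \<forall>c<q. Y i c + (if n \<le> c then X i (c - n) else 0) = - \<Delta>21 1 i c)
      \<and> fro l v X \<le> real \<epsilon> * max 1 (\<rho>A ^ \<epsilon>) * (fro l v (\<Delta>21 0) + fro l q (\<Delta>21 1))
      \<and> fro l q Y \<le> fro l q (\<Delta>21 1) + real \<epsilon> * max 1 (\<rho>A ^ \<epsilon>) * (fro l v (\<Delta>21 0) + fro l q (\<Delta>21 1))"
    using solve_state_inner[OF A pos(2), of \<epsilon> "\<Delta>21 0" "\<lambda>i c. - \<Delta>21 1 i c"] unfolding block_dims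
    by (simp del: One_nat_def)
  then obtain X23 Y21 where
    e21': "\<forall>i<l. \<forall>c<v. X23 i c + (\<Sum>a<l. A i a * Y21 a c) = \<Delta>21 0 i c"
      "\<forall>i<l. \<forall>c<q. Y21 i c + (if n \<le> c then X23 i (c - n) else 0) = - \<Delta>21 1 i c"
    and n23: "fro l v X23 \<le> real \<epsilon> * max 1 (\<rho>A ^ \<epsilon>) * (fro l v (\<Delta>21 0) + fro l q (\<Delta>21 1))"
    and n21: "fro l q Y21 \<le> fro l q (\<Delta>21 1) + real \<epsilon> * max 1 (\<rho>A ^ \<epsilon>) * (fro l v (\<Delta>21 0) + fro l q (\<Delta>21 1))"
    by (elim exE conjE)
  note e21 = e21'[rule_format]
  define \<Delta>12t where "\<Delta>12t = (\<lambda>k c i. \<Delta>12 k i c)"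
  have flip: "pfro l p \<Delta>12t = ?d12" unfolding \<Delta>12t_def by (rule pfro_flip)
  have "\<exists>X Y. (\<forall>j<l. \<forall>i<u. X j i + (\<Sum>a<l. A a j * Y a i) = \<Delta>12t 0 j i)
      \<and> (\<forall>j<l. \<forall>i<p. Y j i + (if m \<le> i then X j (i - m) else 0) = - \<Delta>12t 1 j i)
      \<and> fro l u X \<le> real \<eta> * max 1 (\<rho>A ^ \<eta>) * (fro l u (\<Delta>12t 0) + fro l p (\<Delta>12t 1))
      \<and> fro l p Y \<le> fro l p (\<Delta>12t 1) + real \<eta> * max 1 (\<rho>A ^ \<eta>) * (fro l u (\<Delta>12t 0) + fro l p (\<Delta>12t 1))"
    using solve_state_inner[OF op_bound_transpose[OF A] pos(1), of \<eta> "\<Delta>12t 0" "\<lambda>i c. - \<Delta>12t 1 i c"]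
    unfolding block_dims by (simp del: One_nat_def)
  then obtain Y32 X12 where
    e12': "\<forall>j<l. \<forall>i<u. Y32 j i + (\<Sum>a<l. A a j * X12 a i) = \<Delta>12t 0 j i"
      "\<forall>j<l. \<forall>i<p. X12 j i + (if m \<le> i then Y32 j (i - m) else 0) = - \<Delta>12t 1 j i"
    and n32: "fro l u Y32 \<le> real \<eta> * max 1 (\<rho>A ^ \<eta>) * (fro l u (\<Delta>12t 0) + fro l p (\<Delta>12t 1))"
    and n12: "fro l p X12 \<le> fro l p (\<Delta>12t 1) + real \<eta> * max 1 (\<rho>A ^ \<eta>) * (fro l u (\<Delta>12t 0) + fro l p (\<Delta>12t 1))"
    by (elim exE conjE)
  note e12 = e12'[rule_format]
  have bound: "real k * max 1 (\<rho>A ^ k) * (fro l b (T 0) + fro l c (T 1)) \<le> w * pfro l c T"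
    "fro l c (T 1) + real k * max 1 (\<rho>A ^ k) * (fro l b (T 0) + fro l c (T 1)) \<le> w * pfro l c T"
    if "k \<le> max \<eta> \<epsilon>" "b \<le> c" for k b c and T :: "nat \<Rightarrow> nat \<Rightarrow> nat \<Rightarrow> 'a"
  proof -
    have "fro l b (T 0) \<le> fro l c (T 0)"
      using fro_shift_le[of 0 l l 0 b c "T 0"] that(2) by simp
    then have "real k * max 1 (\<rho>A ^ k) * (fro l b (T 0) + fro l c (T 1))
        \<le> real k * max 1 (\<rho>A ^ k) * (fro l c (T 0) + fro l c (T 1))"
      by (intro mult_left_mono) auto
    moreover have "(1 + 2 * real k * max 1 (\<rho>A ^ k)) * pfro l c T \<le> w * pfro l c T"
      by (rule mult_right_mono[OF \<alpha>_le[OF that(1)]]) simp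
    moreover note state_bound[where r = l and c = c and T = T and N = k]
    ultimately show "real k * max 1 (\<rho>A ^ k) * (fro l b (T 0) + fro l c (T 1)) \<le> w * pfro l c T"
      "fro l c (T 1) + real k * max 1 (\<rho>A ^ k) * (fro l b (T 0) + fro l c (T 1)) \<le> w * pfro l c T"
      by linarith+
  qed
  have vq': "v \<le> q" "u \<le> p" using dims by auto
  have b23: "fro l v X23 \<le> w * ?d21" and b21: "fro l q Y21 \<le> w * ?d21"
    using n23 n21 bound[where k = \<epsilon> and b = v and c = q and T = \<Delta>21] vq' by (meson max.cobounded2 order_trans)+
  have b32: "fro l u Y32 \<le> w * ?d12" and b12: "fro l p X12 \<le> w * ?d12"
    using n32 n12 bound[where k = \<eta> and b = u and c = p and T = \<Delta>12t] vq'
    unfolding flip by (meson max.cobounded1 order_trans)+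
  define X' where "X' = place 0 p p l (\<lambda>i j. X12 j i)"
  define X where "X = (\<lambda>i j. X' i j + place p l (p + l) v X23 i j)"
  define Y' where "Y' = place q l 0 q Y21"
  define Y where "Y = (\<lambda>i j. Y' i j + place (q + l) u q l (\<lambda>i j. Y32 j i) i j)"
  have f12: "fro p l (\<lambda>i j. X12 j i) = fro l p X12" by (rule fro_transpose)
  have f32: "fro u l (\<lambda>i j. Y32 j i) = fro l u Y32" by (rule fro_transpose)
  have nX': "fro R R X' \<le> fro l p X12" unfolding X'_def f12[symmetric] by (rule fro_place)
  have nX: "fro R R X \<le> fro R R X' + fro l v X23"
    unfolding X_def by (intro order_trans[OF fro_add] add_mono fro_place order_refl)
  have nY': "fro K K Y' \<le> fro l q Y21" unfolding Y'_def by (rule fro_place)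
  have nY: "fro K K Y \<le> fro K K Y' + fro l u Y32"
    unfolding Y_def f32[symmetric] by (intro order_trans[OF fro_add] add_mono fro_place order_refl)
  have w0: "0 \<le> w" by (simp add: w_def)
  have b': "w * ?d12 + w * ?d21 \<le> sqrt 2 * w * ?d"
    using mult_left_mono[OF d12 w0] by (simp add: algebra_simps)
  have b5: "fro R R X' + fro K K Y' \<le> sqrt 2 * w * ?d"
    using nX' nY' b12 b21 b' by linarith
  have "sqrt 2 * (w * ?d) \<le> 2 * (w * ?d)"
    using sqrt2_less_2 w0 by (intro mult_right_mono) auto
  then have norm: "fro R R X + fro K K Y \<le> 4 * w * ?d"
    using nX nY b5 b23 b32 b' by linarith
  have suppX: "mat_supp R R (upper_band_mask p l) X"
    by (auto simp: mat_supp_def X_def X'_def place_def upper_band_mask_def)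
  have suppY: "mat_supp K K (\<lambda>i j. upper_band_mask q l j i) Y"
    by (auto simp: mat_supp_def Y_def Y'_def place_def upper_band_mask_def)
  have x1: "X i c = 0" if "c < p" for i c using that by (simp add: X_def X'_def place_def)
  have x12: "X i (p + a) = X12 a i" if "i < p" "a < l" for i a using that by (simp add: X_def X'_def place_def)
  have x22: "X (p + i) a = 0" if "i < l" "a < p + l" for i a using that by (simp add: X_def X'_def place_def)
  have x23: "X (p + i) (p + l + a) = X23 i a" if "i < l" "a < v" for i a using that by (simp add: X_def X'_def place_def)
  have x3: "X (p + l + i) a = 0" for i a by (simp add: X_def X'_def place_def)
  have x2': "X' (p + i) a = 0" for i a by (simp add: X'_def place_def)
  have y1: "Y b j = 0" if "b < q" for b j using that by (simp add: Y_def Y'_def place_def)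
  have y21: "Y (q + b) j = Y21 b j" if "b < l" "j < q" for b j using that by (simp add: Y_def Y'_def place_def)
  have y22: "Y b (q + j) = 0" if "b < q + l" for b j using that by (simp add: Y_def Y'_def place_def)
  have y32: "Y (q + l + i) (q + j) = Y32 j i" if "i < u" "j < l" for i j using that by (simp add: Y_def Y'_def place_def)
  have y3: "Y b (q + l + j) = 0" for b j by (simp add: Y_def Y'_def place_def)
  have y2': "Y' b (q + j) = 0" for b j by (simp add: Y'_def place_def)
  have up: "c < p" "c + m < p" if "c < u" for c using that dims(3) by auto
  have vq: "r < q" "r + n < q" if "r < v" for r using that dims(4) by auto
  have Bq: "v + b < q" if "b < n" for b using that dims(4) by auto
  have Cp: "u + a < p" if "a < m" for a using that dims(3) by auto
  have um: "i - m < u" if "i < p" "m \<le> i" for i using that dims(3) by auto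
  have vn: "i - n < v" if "i < q" "n \<le> i" for i using that dims(4) by auto
  have y32m: "Y (q + l + i - m) (q + j) = Y32 j (i - m)" if "i < p" "m \<le> i" "j < l" for i j
    using y32[of "i - m" j] um[of i] that by simp
  have x23n: "X (p + i) (p + l + j - n) = X23 i (j - n)" if "j < q" "n \<le> j" "i < l" for i j
    using x23[of i "j - n"] vn[of j] that by simp
  let ?T = "linear_defect R K S \<Delta> X Y"
  have zero: "\<Delta> k i j = 0" if "k < 2" "i < R" "j < K" "\<not> normalized_mask p q l k i j" for k i j
    using \<Delta> that by (simp add: pencil_supp_def)
  have z12: "?T 1 i (q + j) = 0" and z12': "i < u \<Longrightarrow> ?T 0 i (q + j) = 0" if "i < p" "j < l" for i j
  proof -
    have "?T 1 i (q + j) = \<Delta>12t 1 j i + (X12 j i + (if m \<le> i then Y32 j (i - m) else 0))"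
      using that by (simp add: linear_defect_def lmul_col2 rmul_row1 x12 y22 y32 y32m um \<Delta>12t_def \<Delta>12_def blk_def
          del: One_nat_def)
    then show "?T 1 i (q + j) = 0" using e12(2)[OF that(2,1)] by simp
    assume i: "i < u"
    have "?T 0 i (q + j) = \<Delta>12t 0 j i - (Y32 j i + (\<Sum>a<l. A a j * X12 a i))"
      using that i by (simp add: linear_defect_def lmul_col2 rmul_row1 x1 x12 y22 y32 Cp \<Delta>12t_def \<Delta>12_def blk_def
          mult.commute)
    then show "?T 0 i (q + j) = 0" using e12(1)[OF that(2) i] by simp
  qed
  have z21: "?T 1 (p + i) j = 0" and z21': "j < v \<Longrightarrow> ?T 0 (p + i) j = 0" if "i < l" "j < q" for i j
  proof -
    have "?T 1 (p + i) j = \<Delta>21 1 i j + (Y21 i j + (if n \<le> j then X23 i (j - n) else 0))"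
      using that by (simp add: linear_defect_def lmul_col1 rmul_row2 x22 x23 x23n y21 vn \<Delta>21_def blk_def
          del: One_nat_def)
    then show "?T 1 (p + i) j = 0" using e21(2)[OF that] by simp
    assume j: "j < v"
    have "?T 0 (p + i) j = \<Delta>21 0 i j - (X23 i j + (\<Sum>a<l. A i a * Y21 a j))"
      using that j by (simp add: linear_defect_def lmul_col1 rmul_row2 x22 x23 y1 y21 Bq \<Delta>21_def blk_def)
    then show "?T 0 (p + i) j = 0" using e21(1)[OF that(1) j] by simp
  qed
  have z13: "?T k i (q + l + c) = 0" if "k < 2" "i < p" "c < u" for k i c
  proof -
    have "\<Delta> k i (q + l + c) = 0" by (rule zero) (use that in \<open>auto simp: normalized_mask_def\<close>)
    then show ?thesis using that less_2_cases_nat[OF that(1)]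
      by (auto simp: linear_defect_def lmul_col3 rmul_row1 x1 y3 up simp del: One_nat_def)
  qed
  have z23: "?T k (p + i) (q + l + c) = 0" if "k < 2" "i < l" "c < u" for k i c
  proof -
    have "\<Delta> k (p + i) (q + l + c) = 0" by (rule zero) (use that in \<open>auto simp: normalized_mask_def\<close>)
    then show ?thesis using that less_2_cases_nat[OF that(1)]
      by (auto simp: linear_defect_def lmul_col3 rmul_row2 x1 y3 up simp del: One_nat_def)
  qed
  have z31: "?T k (p + l + r) j = 0" if "k < 2" "r < v" "j < q" for k r j
  proof -
    have "\<Delta> k (p + l + r) j = 0" by (rule zero) (use that in \<open>auto simp: normalized_mask_def\<close>)
    then show ?thesis using that less_2_cases_nat[OF that(1)]
      by (auto simp: linear_defect_def lmul_col1 rmul_row3 x3 y1 vq simp del: One_nat_def)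
  qed
  have z32: "?T k (p + l + r) (q + j) = 0" if "k < 2" "r < v" "j < l" for k r j
  proof -
    have "\<Delta> k (p + l + r) (q + j) = 0" by (rule zero) (use that in \<open>auto simp: normalized_mask_def\<close>)
    then show ?thesis using that less_2_cases_nat[OF that(1)]
      by (auto simp: linear_defect_def lmul_col2 rmul_row3 x3 y1 vq simp del: One_nat_def)
  qed
  have z33: "?T k (p + l + r) (q + l + c) = 0" if "k < 2" "r < v" "c < u" for k r c
  proof -
    have "\<Delta> k (p + l + r) (q + l + c) = 0" by (rule zero) (use that in \<open>auto simp: normalized_mask_def\<close>)
    then show ?thesis using that less_2_cases_nat[OF that(1)]
      by (auto simp: linear_defect_def lmul_col3 rmul_row3 x3 y3 simp del: One_nat_def)
  qed
  have z22: "?T 1 (p + i) (q + j) = 0" if "i < l" "j < l" for i j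
  proof -
    have "\<Delta> 1 (p + i) (q + j) = 0" by (rule zero) (use that in \<open>auto simp: normalized_mask_def\<close>)
    then show ?thesis using that
      by (simp add: linear_defect_def lmul_col2 rmul_row2 x22 y22 del: One_nat_def)
  qed
  have supp: "pencil_supp R K (Kronecker_mask p q l u v) ?T"
    unfolding pencil_supp_def
  proof (intro allI impI)
    fix k i j assume k: "k < 2" and i: "i < R" and j: "j < K" and nz: "\<not> Kronecker_mask p q l u v k i j"
    show "?T k i j = 0"
      using i
    proof (cases rule: split_index)
      case 1 show ?thesis
        using j by (cases rule: split_index)
          (use 1 nz less_2_cases_nat[OF k] vq' z12 z12' z13 in \<open>auto simp: Kronecker_mask_def\<close>)
    next
      case (2 i') show ?thesis
        using j by (cases rule: split_index)
          (use 2 nz less_2_cases_nat[OF k] vq' z21 z21' z22 z23 in \<open>auto simp: Kronecker_mask_def\<close>)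
    next
      case (3 i') show ?thesis
        using j by (cases rule: split_index) (use 3 nz k z31 z32 z33 in \<open>auto simp: Kronecker_mask_def\<close>)
    qed
  qed
  have X_eq: "lmul R X S k i j = lmul R X' S k i j" if "i < p" for k i j
  proof -
    have "X i a = X' i a" for a using that by (simp add: X_def place_def)
    then show ?thesis by (simp add: lmul_def)
  qed
  have Y_eq: "rmul K S Y k i j = rmul K S Y' k i j" if "j < q" for k i j
  proof -
    have "Y b j = Y' b j" for b using that by (simp add: Y_def place_def)
    then show ?thesis by (simp add: rmul_def)
  qed
  have lX': "lmul R X' S k (p + i) j = 0" for k i j by (simp add: lmul_def x2')
  have rY': "rmul K S Y' k i (q + j) = 0" for k i j by (simp add: rmul_def y2')
  have "pfro R K ?T \<le> pfro R K (linear_defect R K S \<Delta> X' Y')"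
  proof (rule pfro_mono)
    fix k i j assume kij: "k < (2::nat)" "i < R" "j < K"
    show "norm (?T k i j) \<le> norm (linear_defect R K S \<Delta> X' Y' k i j)"
    proof (cases "Kronecker_mask p q l u v k i j")
      case True
      have "lmul R X S k i j = lmul R X' S k i j"
        using kij(2)
      proof (cases rule: split_index)
        case (2 i')
        have k0: "k = 0" and vj: "v \<le> j" using True 2 by (auto simp: Kronecker_mask_def)
        have "lmul R X S 0 (p + i') j = 0"
          using kij(3)
        proof (cases rule: split_index)
          case 1 then show ?thesis using vj 2 by (simp add: lmul_col1 x22)
        next
          case (2 j') then show ?thesis using \<open>i' < l\<close> by (simp add: lmul_col2 x22 Cp trans_less_add1)
        qed (use True in \<open>auto simp: Kronecker_mask_def\<close>)
        then show ?thesis using 2 k0 lX' by simp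
      qed (use True X_eq in \<open>auto simp: Kronecker_mask_def\<close>)
      moreover have "rmul K S Y k i j = rmul K S Y' k i j"
        using kij(3)
      proof (cases rule: split_index)
        case (2 j')
        have k0: "k = 0" and ui: "u \<le> i" using True 2 by (auto simp: Kronecker_mask_def)
        have "rmul K S Y 0 i (q + j') = 0"
          using kij(2)
        proof (cases rule: split_index)
          case 1 then show ?thesis using ui 2 by (simp add: rmul_row1 y22)
        next
          case (2 i') then show ?thesis by (simp add: rmul_row2 y22 Bq trans_less_add1)
        qed (use True in \<open>auto simp: Kronecker_mask_def\<close>)
        then show ?thesis using 2 k0 rY' by simp
      qed (use True Y_eq in \<open>auto simp: Kronecker_mask_def\<close>)
      ultimately show ?thesis by (simp add: linear_defect_def)
    next
      case False
      then show ?thesis using supp kij by (simp add: pencil_supp_def)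
    qed
  qed
  also have "\<dots> \<le> ?d + (fro R R X' + fro K K Y') * \<Sigma>" by (rule pfro_linear_defect)
  also have "\<dots> \<le> ?d + (sqrt 2 * w * ?d) * \<Sigma>" by (intro add_left_mono mult_right_mono b5) simp
  finally have "pfro R K ?T \<le> (1 + sqrt 2 * w * \<Sigma>) * ?d" by (simp add: algebra_simps)
  then show ?thesis using suppX suppY norm supp by blast
qed

end

section \<open>Composition of the stages\<close>

context perturbation_stage
begin

text \<open>The threshold also keeps the factors below \<open>1 / 2\<close>, which makes \<open>I - X\<close> and \<open>I - Y\<close> invertible.\<close>

lemma exists_small_transform:
  "\<exists>\<tau>>0. \<exists>\<kappa>\<ge>0. \<forall>\<Delta>. pencil_supp r c D \<Delta> \<longrightarrow> pfro r c \<Delta> < \<tau> \<longrightarrow>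
     (\<exists>X Y. mat_supp r r VX X \<and> mat_supp c c VY Y \<and> fro r r X \<le> 1 / 2 \<and> fro c c Y \<le> 1 / 2 \<and>
      pencil_supp r c W (\<lambda>k i j. transform r c X (\<lambda>k i j. S k i j + \<Delta> k i j) Y k i j - S k i j) \<and>
      pfro r c (\<lambda>k i j. transform r c X (\<lambda>k i j. S k i j + \<Delta> k i j) Y k i j - S k i j)
        \<le> f * pfro r c \<Delta> + \<kappa> * (pfro r c \<Delta>)\<^sup>2)"
proof -
  let ?\<tau> = "1 / (2 * rate + 4 * b + 1)"
  have den: "0 < 2 * rate + 4 * b + 1" using rate_nonneg b by linarith
  have \<tau>: "0 < ?\<tau>" using den by simp
  have \<kappa>: "0 \<le> 2 * f * rate" using f rate_nonneg by simp
  have main: "\<exists>X Y. mat_supp r r VX X \<and> mat_supp c c VY Y \<and> fro r r X \<le> 1 / 2 \<and> fro c c Y \<le> 1 / 2 \<and>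
      pencil_supp r c W (\<lambda>k i j. transform r c X (\<lambda>k i j. S k i j + \<Delta> k i j) Y k i j - S k i j) \<and>
      pfro r c (\<lambda>k i j. transform r c X (\<lambda>k i j. S k i j + \<Delta> k i j) Y k i j - S k i j)
        \<le> f * pfro r c \<Delta> + 2 * f * rate * (pfro r c \<Delta>)\<^sup>2"
    if \<Delta>: "pencil_supp r c D \<Delta>" "pfro r c \<Delta> < ?\<tau>" for \<Delta>
  proof -
    let ?d = "pfro r c \<Delta>"
    have "?d * (2 * rate + 4 * b + 1) < 1" using \<Delta>(2) den by (simp add: pos_less_divide_eq)
    then have sum: "2 * (rate * ?d) + 2 * (2 * b * ?d) + ?d \<le> 1" by (simp add: algebra_simps)
    have nn: "0 \<le> rate * ?d" "0 \<le> 2 * b * ?d" "0 \<le> ?d" using rate_nonneg b by simp_all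
    have small: "?d \<le> 1" "rate * ?d \<le> 1 / 2" "2 * b * ?d \<le> 1 / 2" using sum nn by linarith+
    show ?thesis
      using exists_exact_transform[OF \<Delta>(1) small(1,2)] small(3) by (meson order_trans)
  qed
  show ?thesis
    by (rule exI[of _ ?\<tau>], rule conjI[OF \<tau>], rule exI[of _ "2 * f * rate"], rule conjI[OF \<kappa>])
       (use main in blast)
qed

end

lemma pencil_supp_lmul:
  assumes X: "mat_supp r r V X" and T: "pencil_supp r c D T"
    and closed: "\<And>k i a j. V i a \<Longrightarrow> D k a j \<Longrightarrow> D' k i j"
  shows "pencil_supp r c D' (lmul r X T)"
  unfolding pencil_supp_def lmul_def
proof (intro allI impI sum.neutral ballI)
  fix k i j a assume "k < 2" "i < r" "j < c" "\<not> D' k i j" "a \<in> {..<r}"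
  then have a: "a < r" "\<not> D k a j \<or> \<not> V i a" using closed by auto
  show "X i a * T k a j = 0"
  proof (cases "V i a")
    case True
    then have "T k a j = 0" using a T \<open>k < 2\<close> \<open>j < c\<close> unfolding pencil_supp_def by blast
    then show ?thesis by simp
  next
    case False
    then have "X i a = 0" using a X \<open>i < r\<close> unfolding mat_supp_def by blast
    then show ?thesis by simp
  qed
qed

lemma pencil_supp_rmul:
  assumes Y: "mat_supp c c V Y" and T: "pencil_supp r c D T"
    and closed: "\<And>k i b j. D k i b \<Longrightarrow> V b j \<Longrightarrow> D' k i j"
  shows "pencil_supp r c D' (rmul c T Y)"
  unfolding pencil_supp_def rmul_def
proof (intro allI impI sum.neutral ballI)
  fix k i j b assume "k < 2" "i < r" "j < c" "\<not> D' k i j" "b \<in> {..<c}"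
  then have b: "b < c" "\<not> D k i b \<or> \<not> V b j" using closed by auto
  show "T k i b * Y b j = 0"
  proof (cases "V b j")
    case True
    then have "T k i b = 0" using b T \<open>k < 2\<close> \<open>i < r\<close> unfolding pencil_supp_def by blast
    then show ?thesis by simp
  next
    case False
    then have "Y b j = 0" using b Y \<open>j < c\<close> unfolding mat_supp_def by blast
    then show ?thesis by simp
  qed
qed

text \<open>First-order amplification factors multiply when two stages are composed.\<close>

lemma quadratic_bound_compose:
  fixes d d' d'' f f' \<kappa> \<kappa>' :: real
  assumes "0 \<le> d" "d \<le> 1" "0 \<le> d'" "0 \<le> f" "0 \<le> f'" "0 \<le> \<kappa>" "0 \<le> \<kappa>'"
    and d': "d' \<le> f * d + \<kappa> * d\<^sup>2" and d'': "d'' \<le> f' * d' + \<kappa>' * d'\<^sup>2"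
  shows "d' \<le> (f + \<kappa>) * d" "d'' \<le> f' * f * d + (f' * \<kappa> + \<kappa>' * (f + \<kappa>)\<^sup>2) * d\<^sup>2"
proof -
  have "d\<^sup>2 \<le> d" using assms(1,2) by (simp add: power2_eq_square mult_left_le)
  then have "\<kappa> * d\<^sup>2 \<le> \<kappa> * d" using assms(6) by (rule mult_left_mono)
  then show *: "d' \<le> (f + \<kappa>) * d" using d' by (simp add: algebra_simps)
  have "d'\<^sup>2 \<le> ((f + \<kappa>) * d)\<^sup>2" by (rule power_mono[OF * assms(3)])
  then have "\<kappa>' * d'\<^sup>2 \<le> \<kappa>' * ((f + \<kappa>)\<^sup>2 * d\<^sup>2)"
    using assms(7) unfolding power_mult_distrib by (rule mult_left_mono)
  moreover have "f' * d' \<le> f' * (f * d + \<kappa> * d\<^sup>2)" using d' assms(5) by (rule mult_left_mono)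
  ultimately show "d'' \<le> f' * f * d + (f' * \<kappa> + \<kappa>' * (f + \<kappa>)\<^sup>2) * d\<^sup>2"
    using d'' by (simp only: distrib_left distrib_right mult.assoc)
qed

context kron_pencil
begin

lemma s_nonneg: "0 \<le> s"
proof -
  have "0 \<le> \<alpha>" "0 \<le> \<beta>" "0 \<le> \<gamma>" by (simp_all add: \<alpha>_def \<beta>_def \<gamma>_def)
  then show ?thesis using rho_nonneg by (simp add: s_def)
qed

lemma S_supp: "pencil_supp R K (zero_mask p q l) S"
  unfolding pencil_supp_def
proof (intro allI impI)
  fix k i j assume k: "k < 2" and i: "i < R" and j: "j < K" and nz: "\<not> zero_mask p q l k i j"
  show "S k i j = 0"
    using i
  proof (cases rule: split_index)
    case 1 show ?thesis using 1 nz by (auto simp: zero_mask_def)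
  next
    case (2 i') show ?thesis
      using j by (cases rule: split_index) (use 2 nz k s23 in \<open>auto simp: zero_mask_def\<close>)
  next
    case (3 i') show ?thesis
      using j by (cases rule: split_index) (use 3 nz k s32 s33 in \<open>auto simp: zero_mask_def\<close>)
  qed
qed

lemma clear_blocks_stage:
  "perturbation_stage R K S (lower_mask p l) (\<lambda>i j. lower_mask q l j i) (\<lambda>_ _ _. True) (zero_mask p q l)
    (5 * s) (1 + 5 * s * \<Sigma>)"
proof (unfold_locales, goal_cases)
  case (3 \<Delta>)
  obtain X Y where XY: "mat_supp R R (lower_mask p l) X" "mat_supp K K (\<lambda>i j. lower_mask q l j i) Y"
    "fro R R X + fro K K Y \<le> 5 * s * pfro R K \<Delta>" "pencil_supp R K (zero_mask p q l) (linear_defect R K S \<Delta> X Y)"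
    using clear_blocks_solution by blast
  have "pfro R K (linear_defect R K S \<Delta> X Y) \<le> pfro R K \<Delta> + (fro R R X + fro K K Y) * \<Sigma>"
    by (rule pfro_linear_defect)
  also have "\<dots> \<le> pfro R K \<Delta> + (5 * s * pfro R K \<Delta>) * \<Sigma>"
    by (intro add_left_mono mult_right_mono XY) simp
  finally have "pfro R K (linear_defect R K S \<Delta> X Y) \<le> (1 + 5 * s * \<Sigma>) * pfro R K \<Delta>"
    by (simp add: algebra_simps)
  moreover have "fro R R X \<le> 5 * s * pfro R K \<Delta>" "fro K K Y \<le> 5 * s * pfro R K \<Delta>"
    using XY(3) L2_set_nonneg[of _ "{..<R} \<times> {..<R}"] L2_set_nonneg[of _ "{..<K} \<times> {..<K}"]
    by (meson add_increasing add_increasing2 order_trans order_refl)+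
  ultimately show ?case using XY by blast
qed (use s_nonneg in \<open>auto simp: pencil_supp_def\<close>)

text \<open>Block diagonal factors preserve every block zero pattern, in particular that of \<open>S\<close>, so the
  second-order terms vanish on the cleared blocks.\<close>

lemma normalize_blocks_stage:
  assumes "0 < max \<epsilon> \<eta>"
  shows "perturbation_stage R K S (diag_mask p l) (diag_mask q l) (zero_mask p q l) (normalized_mask p q l)
    (20 * real (max \<epsilon> \<eta>)) (1 + 5 * real (max \<epsilon> \<eta>) * \<Sigma>)"
proof (unfold_locales, goal_cases)
  case (3 \<Delta>)
  obtain X Y where XY: "mat_supp R R (diag_mask p l) X" "mat_supp K K (diag_mask q l) Y"
    "fro R R X + fro K K Y \<le> 20 * real (max \<epsilon> \<eta>) * pfro R K \<Delta>"
    "pencil_supp R K (normalized_mask p q l) (linear_defect R K S \<Delta> X Y)"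
    "pfro R K (linear_defect R K S \<Delta> X Y) \<le> (1 + 5 * real (max \<epsilon> \<eta>) * \<Sigma>) * pfro R K \<Delta>"
    using normalize_blocks_solution[OF assms 3] by blast
  moreover have "fro R R X \<le> 20 * real (max \<epsilon> \<eta>) * pfro R K \<Delta>" "fro K K Y \<le> 20 * real (max \<epsilon> \<eta>) * pfro R K \<Delta>"
    using XY(3) L2_set_nonneg[of _ "{..<R} \<times> {..<R}"] L2_set_nonneg[of _ "{..<K} \<times> {..<K}"]
    by (meson add_increasing add_increasing2 order_trans order_refl)+
  ultimately show ?case by blast
next
  case (4 X \<Delta>)
  show ?case by (rule pencil_supp_lmul[OF 4]) (auto simp: diag_mask_def zero_mask_def)
next
  case (5 Y \<Delta>)
  show ?case by (rule pencil_supp_rmul[OF 5]) (auto simp: diag_mask_def zero_mask_def)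
next
  case (6 X Y)
  have "pencil_supp R K (zero_mask p q l) (lmul R X S)"
    by (rule pencil_supp_lmul[OF 6(1) S_supp]) (auto simp: diag_mask_def zero_mask_def)
  from 6(2) this show ?case
    by (rule pencil_supp_rmul) (auto simp: diag_mask_def zero_mask_def)
qed simp_all

text \<open>Multiplication by \<open>X\<close> moves the second block row to the first and the third to the second. In \<open>S\<close> and
  in the perturbation, neither of them has entries in the third block column, and the third has none in
  the second block column, so the blocks \<open>(1,3)\<close>, \<open>(2,3)\<close> and \<open>(2,2)\<close> receive nothing. Multiplication by
  \<open>Y\<close> acts dually on columns.\<close>

lemma collapse_blocks_stage:
  defines "w \<equiv> 1 + 2 * real (max \<eta> \<epsilon>) * max 1 (\<rho>A ^ max \<eta> \<epsilon>)"
  shows "perturbation_stage R K S (upper_band_mask p l) (\<lambda>i j. upper_band_mask q l j i)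
    (normalized_mask p q l) (Kronecker_mask p q l u v) (4 * w) (1 + sqrt 2 * w * \<Sigma>)"
proof (unfold_locales, goal_cases)
  case (3 \<Delta>)
  obtain X Y where XY: "mat_supp R R (upper_band_mask p l) X" "mat_supp K K (\<lambda>i j. upper_band_mask q l j i) Y"
    "fro R R X + fro K K Y \<le> 4 * w * pfro R K \<Delta>"
    "pencil_supp R K (Kronecker_mask p q l u v) (linear_defect R K S \<Delta> X Y)"
    "pfro R K (linear_defect R K S \<Delta> X Y) \<le> (1 + sqrt 2 * w * \<Sigma>) * pfro R K \<Delta>"
    using collapse_blocks_solution[OF 3, folded w_def] by blast
  moreover have "fro R R X \<le> 4 * w * pfro R K \<Delta>" "fro K K Y \<le> 4 * w * pfro R K \<Delta>"
    using XY(3) L2_set_nonneg[of _ "{..<R} \<times> {..<R}"] L2_set_nonneg[of _ "{..<K} \<times> {..<K}"]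
    by (meson add_increasing add_increasing2 order_trans order_refl)+
  ultimately show ?case by blast
next
  case (4 X \<Delta>)
  show ?case by (rule pencil_supp_lmul[OF 4]) (auto simp: upper_band_mask_def normalized_mask_def)
next
  case (5 Y \<Delta>)
  show ?case by (rule pencil_supp_rmul[OF 5]) (auto simp: upper_band_mask_def normalized_mask_def)
next
  case (6 X Y)
  have "pencil_supp R K (normalized_mask p q l) (lmul R X S)"
    by (rule pencil_supp_lmul[OF 6(1) S_supp]) (auto simp: upper_band_mask_def zero_mask_def normalized_mask_def)
  from 6(2) this show ?case
    by (rule pencil_supp_rmul) (auto simp: upper_band_mask_def normalized_mask_def)
qed (auto simp: w_def)

lemma exists_three_stage_transform:
  assumes "0 < max \<epsilon> \<eta>"
  defines "w \<equiv> 1 + 2 * real (max \<eta> \<epsilon>) * max 1 (\<rho>A ^ max \<eta> \<epsilon>)"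
  defines "F \<equiv> (1 + sqrt 2 * w * \<Sigma>) * ((1 + 5 * real (max \<epsilon> \<eta>) * \<Sigma>) * (1 + 5 * s * \<Sigma>))"
  shows "\<exists>\<tau>>0. \<exists>\<kappa>\<ge>0. \<forall>\<Delta>. pfro R K \<Delta> < \<tau> \<longrightarrow> (\<exists>X1 X2 X3 Y1 Y2 Y3 T.
      mat_supp R R (lower_mask p l) X1 \<and> mat_supp R R (diag_mask p l) X2 \<and> mat_supp R R (upper_band_mask p l) X3 \<and>
      mat_supp K K (\<lambda>i j. lower_mask q l j i) Y1 \<and> mat_supp K K (diag_mask q l) Y2 \<and>
      mat_supp K K (\<lambda>i j. upper_band_mask q l j i) Y3 \<and>
      (\<forall>X\<in>{X1, X2, X3}. fro R R X \<le> 1 / 2) \<and> (\<forall>Y\<in>{Y1, Y2, Y3}. fro K K Y \<le> 1 / 2) \<and>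
      T = transform R K X3 (transform R K X2 (transform R K X1 (\<lambda>k i j. S k i j + \<Delta> k i j) Y1) Y2) Y3 \<and>
      pencil_supp R K (Kronecker_mask p q l u v) (\<lambda>k i j. T k i j - S k i j) \<and>
      pfro R K (\<lambda>k i j. T k i j - S k i j) \<le> F * pfro R K \<Delta> + \<kappa> * (pfro R K \<Delta>)\<^sup>2)"
proof -
  define f1 where "f1 = 1 + 5 * s * \<Sigma>"
  define f2 where "f2 = 1 + 5 * real (max \<epsilon> \<eta>) * \<Sigma>"
  define f3 where "f3 = 1 + sqrt 2 * w * \<Sigma>"
  have f: "0 \<le> f1" "0 \<le> f2" "0 \<le> f3" using s_nonneg by (simp_all add: f1_def f2_def f3_def w_def)
  let ?diff = "\<lambda>X \<Delta> Y k i j. transform R K X (\<lambda>k i j. S k i j + \<Delta> k i j) Y k i j - S k i j"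
  obtain \<tau>1 \<kappa>1 where t1: "0 < \<tau>1" "0 \<le> \<kappa>1" and
    st1: "\<forall>\<Delta>. pencil_supp R K (\<lambda>_ _ _. True) \<Delta> \<longrightarrow> pfro R K \<Delta> < \<tau>1 \<longrightarrow>
     (\<exists>X Y. mat_supp R R (lower_mask p l) X \<and> mat_supp K K (\<lambda>i j. lower_mask q l j i) Y \<and>
      fro R R X \<le> 1 / 2 \<and> fro K K Y \<le> 1 / 2 \<and> pencil_supp R K (zero_mask p q l) (?diff X \<Delta> Y) \<and>
      pfro R K (?diff X \<Delta> Y) \<le> f1 * pfro R K \<Delta> + \<kappa>1 * (pfro R K \<Delta>)\<^sup>2)"
    using perturbation_stage.exists_small_transform[OF clear_blocks_stage, folded f1_def] by (elim exE conjE)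
  obtain \<tau>2 \<kappa>2 where t2: "0 < \<tau>2" "0 \<le> \<kappa>2" and
    st2: "\<forall>\<Delta>. pencil_supp R K (zero_mask p q l) \<Delta> \<longrightarrow> pfro R K \<Delta> < \<tau>2 \<longrightarrow>
     (\<exists>X Y. mat_supp R R (diag_mask p l) X \<and> mat_supp K K (diag_mask q l) Y \<and>
      fro R R X \<le> 1 / 2 \<and> fro K K Y \<le> 1 / 2 \<and> pencil_supp R K (normalized_mask p q l) (?diff X \<Delta> Y) \<and>
      pfro R K (?diff X \<Delta> Y) \<le> f2 * pfro R K \<Delta> + \<kappa>2 * (pfro R K \<Delta>)\<^sup>2)"
    using perturbation_stage.exists_small_transform[OF normalize_blocks_stage[OF assms(1)], folded f2_def] by (elim exE conjE)
  obtain \<tau>3 \<kappa>3 where t3: "0 < \<tau>3" "0 \<le> \<kappa>3" and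
    st3: "\<forall>\<Delta>. pencil_supp R K (normalized_mask p q l) \<Delta> \<longrightarrow> pfro R K \<Delta> < \<tau>3 \<longrightarrow>
     (\<exists>X Y. mat_supp R R (upper_band_mask p l) X \<and> mat_supp K K (\<lambda>i j. upper_band_mask q l j i) Y \<and>
      fro R R X \<le> 1 / 2 \<and> fro K K Y \<le> 1 / 2 \<and> pencil_supp R K (Kronecker_mask p q l u v) (?diff X \<Delta> Y) \<and>
      pfro R K (?diff X \<Delta> Y) \<le> f3 * pfro R K \<Delta> + \<kappa>3 * (pfro R K \<Delta>)\<^sup>2)"
    using perturbation_stage.exists_small_transform[OF collapse_blocks_stage, folded w_def, folded f3_def] by (elim exE conjE)
  define c1 where "c1 = f1 + \<kappa>1"
  define k2 where "k2 = f2 * \<kappa>1 + \<kappa>2 * c1\<^sup>2"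
  define c2 where "c2 = f2 * f1 + k2"
  define \<kappa> where "\<kappa> = f3 * k2 + \<kappa>3 * c2\<^sup>2"
  define \<tau> where "\<tau> = min (min 1 \<tau>1) (min (\<tau>2 / (c1 + 1)) (\<tau>3 / (c2 + 1)))"
  have c: "0 \<le> c1" "0 \<le> k2" "0 \<le> c2" "0 \<le> \<kappa>"
    using f t1 t2 t3 by (simp_all add: c1_def k2_def c2_def \<kappa>_def)
  have "0 < \<tau>" using t1 t2 t3 c by (simp add: \<tau>_def)
  have main: "\<exists>X1 X2 X3 Y1 Y2 Y3 T.
      mat_supp R R (lower_mask p l) X1 \<and> mat_supp R R (diag_mask p l) X2 \<and> mat_supp R R (upper_band_mask p l) X3 \<and>
      mat_supp K K (\<lambda>i j. lower_mask q l j i) Y1 \<and> mat_supp K K (diag_mask q l) Y2 \<and>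
      mat_supp K K (\<lambda>i j. upper_band_mask q l j i) Y3 \<and>
      (\<forall>X\<in>{X1, X2, X3}. fro R R X \<le> 1 / 2) \<and> (\<forall>Y\<in>{Y1, Y2, Y3}. fro K K Y \<le> 1 / 2) \<and>
      T = transform R K X3 (transform R K X2 (transform R K X1 (\<lambda>k i j. S k i j + \<Delta> k i j) Y1) Y2) Y3 \<and>
      pencil_supp R K (Kronecker_mask p q l u v) (\<lambda>k i j. T k i j - S k i j) \<and>
      pfro R K (\<lambda>k i j. T k i j - S k i j) \<le> F * pfro R K \<Delta> + \<kappa> * (pfro R K \<Delta>)\<^sup>2"
    if small: "pfro R K \<Delta> < \<tau>" for \<Delta> :: "nat \<Rightarrow> nat \<Rightarrow> nat \<Rightarrow> 'a"
  proof -
    let ?d = "pfro R K \<Delta>"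
    have d: "0 \<le> ?d" "?d \<le> 1" "?d < \<tau>1" using small by (simp_all add: \<tau>_def)
    have "?d < \<tau>2 / (c1 + 1)" "?d < \<tau>3 / (c2 + 1)" using small by (simp_all add: \<tau>_def)
    then have "?d * (c1 + 1) < \<tau>2" "?d * (c2 + 1) < \<tau>3" using c by (simp_all add: pos_less_divide_eq)
    moreover have "?d * (c1 + 1) = c1 * ?d + ?d" "?d * (c2 + 1) = c2 * ?d + ?d" by (simp_all add: algebra_simps)
    ultimately have dc: "c1 * ?d < \<tau>2" "c2 * ?d < \<tau>3" using d(1) by linarith+
    have all_supp: "pencil_supp R K (\<lambda>_ _ _. True) \<Delta>" by (simp add: pencil_supp_def)
    obtain X1 Y1 where 1: "mat_supp R R (lower_mask p l) X1" "mat_supp K K (\<lambda>i j. lower_mask q l j i) Y1"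
      "fro R R X1 \<le> 1 / 2" "fro K K Y1 \<le> 1 / 2" "pencil_supp R K (zero_mask p q l) (?diff X1 \<Delta> Y1)"
      "pfro R K (?diff X1 \<Delta> Y1) \<le> f1 * ?d + \<kappa>1 * ?d\<^sup>2"
      using st1[rule_format, OF all_supp d(3)] by blast
    define \<Delta>1 where "\<Delta>1 = ?diff X1 \<Delta> Y1"
    have T1: "(\<lambda>k i j. S k i j + \<Delta>1 k i j) = transform R K X1 (\<lambda>k i j. S k i j + \<Delta> k i j) Y1"
      by (simp add: \<Delta>1_def fun_eq_iff)
    have one': "pencil_supp R K (zero_mask p q l) \<Delta>1" "pfro R K \<Delta>1 \<le> f1 * ?d + \<kappa>1 * ?d\<^sup>2"
      using 1(5,6) by (simp_all add: \<Delta>1_def)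
    have d1: "pfro R K \<Delta>1 \<le> c1 * ?d"
      unfolding c1_def
      by (rule quadratic_bound_compose(1)[OF d(1,2) pfro_nonneg f(1,2) t1(2) t2(2) one'(2) order_refl])
    obtain X2 Y2 where 2: "mat_supp R R (diag_mask p l) X2" "mat_supp K K (diag_mask q l) Y2"
      "fro R R X2 \<le> 1 / 2" "fro K K Y2 \<le> 1 / 2" "pencil_supp R K (normalized_mask p q l) (?diff X2 \<Delta>1 Y2)"
      "pfro R K (?diff X2 \<Delta>1 Y2) \<le> f2 * pfro R K \<Delta>1 + \<kappa>2 * (pfro R K \<Delta>1)\<^sup>2"
      using st2[rule_format, OF one'(1) order_le_less_trans[OF d1 dc(1)]] by blast
    define \<Delta>2 where "\<Delta>2 = ?diff X2 \<Delta>1 Y2"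
    have T2: "(\<lambda>k i j. S k i j + \<Delta>2 k i j) = transform R K X2 (\<lambda>k i j. S k i j + \<Delta>1 k i j) Y2"
      by (simp add: \<Delta>2_def fun_eq_iff)
    have two': "pencil_supp R K (normalized_mask p q l) \<Delta>2" using 2(5) by (simp add: \<Delta>2_def)
    have d2': "pfro R K \<Delta>2 \<le> f2 * f1 * ?d + k2 * ?d\<^sup>2"
      unfolding k2_def c1_def \<Delta>2_def
      by (rule quadratic_bound_compose(2)[OF d(1,2) pfro_nonneg f(1,2) t1(2) t2(2) one'(2) 2(6)])
    have f21: "0 \<le> f2 * f1" using f by simp
    have d2: "pfro R K \<Delta>2 \<le> c2 * ?d"
      unfolding c2_def
      by (rule quadratic_bound_compose(1)[OF d(1,2) pfro_nonneg f21 f(3) c(2) t3(2) d2' order_refl])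
    obtain X3 Y3 where 3: "mat_supp R R (upper_band_mask p l) X3" "mat_supp K K (\<lambda>i j. upper_band_mask q l j i) Y3"
      "fro R R X3 \<le> 1 / 2" "fro K K Y3 \<le> 1 / 2" "pencil_supp R K (Kronecker_mask p q l u v) (?diff X3 \<Delta>2 Y3)"
      "pfro R K (?diff X3 \<Delta>2 Y3) \<le> f3 * pfro R K \<Delta>2 + \<kappa>3 * (pfro R K \<Delta>2)\<^sup>2"
      using st3[rule_format, OF two' order_le_less_trans[OF d2 dc(2)]] by blast
    have d3: "pfro R K (?diff X3 \<Delta>2 Y3) \<le> f3 * (f2 * f1) * ?d + \<kappa> * ?d\<^sup>2"
      unfolding \<kappa>_def c2_def
      by (rule quadratic_bound_compose(2)[OF d(1,2) pfro_nonneg f21 f(3) c(2) t3(2) d2' 3(6)])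
    have F: "F = f3 * (f2 * f1)" by (simp add: F_def f1_def f2_def f3_def)
    show ?thesis
      apply (rule exI[of _ X1], rule exI[of _ X2], rule exI[of _ X3])
      apply (rule exI[of _ Y1], rule exI[of _ Y2], rule exI[of _ Y3])
      apply (rule exI[of _ "transform R K X3 (\<lambda>k i j. S k i j + \<Delta>2 k i j) Y3"])
      using 1(1-4) 2(1-4) 3(1-5) d3 unfolding F T1[symmetric] T2[symmetric] by simp
  qed
  show ?thesis
    by (rule exI[of _ \<tau>], rule conjI[OF \<open>0 < \<tau>\<close>], rule exI[of _ \<kappa>], rule conjI[OF c(4)])
       (use main in blast)
qed

end

section \<open>Minimality is an open condition\<close>

text \<open>Elimination: injectivity gives a pivot in the last column, clearing that column reduces the number
  of columns, and the left inverse of the reduced matrix extends to one of \<open>M\<close>.\<close>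

lemma left_inverse_if_injective:
  fixes M :: "nat \<Rightarrow> nat \<Rightarrow> 'a::field"
  assumes "\<And>v. (\<forall>i<r. (\<Sum>j<l. M i j * v j) = 0) \<Longrightarrow> \<forall>j<l. v j = 0"
  shows "\<exists>G. \<forall>i<l. \<forall>j<l. (\<Sum>a<r. G i a * M a j) = (if i = j then 1 else 0)"
  using assms
proof (induction l arbitrary: M)
  case 0
  then show ?case by simp
next
  case (Suc l)
  have "\<exists>i<r. M i l \<noteq> 0"
  proof (rule ccontr)
    assume "\<not> (\<exists>i<r. M i l \<noteq> 0)"
    then have "\<forall>j<Suc l. (if j = l then 1 else 0 :: 'a) = 0"
      by (intro Suc.prems) auto
    then show False by auto
  qed
  then obtain t where t: "t < r" "M t l \<noteq> 0" by blast
  define M' where "M' i j = M i j - M i l / M t l * M t j" for i j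
  have "\<exists>G. \<forall>i<l. \<forall>j<l. (\<Sum>a<r. G i a * M' a j) = (if i = j then 1 else 0)"
  proof (rule Suc.IH)
    fix v assume v: "\<forall>i<r. (\<Sum>j<l. M' i j * v j) = 0"
    define w where "w j = (if j < l then v j else - (\<Sum>j<l. M t j * v j) / M t l)" for j
    have "(\<Sum>j<Suc l. M i j * w j) = (\<Sum>j<l. M' i j * v j)" for i
      unfolding M'_def w_def
      by (simp add: left_diff_distrib sum_subtractf mult.assoc sum_distrib_left sum_divide_distrib)
    then have "\<forall>j<Suc l. w j = 0" using v by (intro Suc.prems) simp
    then have "w j = 0" if "j < l" for j using that by simp
    then show "\<forall>j<l. v j = 0" by (simp add: w_def)
  qed
  then obtain G' where G': "\<And>i j. i < l \<Longrightarrow> j < l \<Longrightarrow> (\<Sum>a<r. G' i a * M' a j) = (if i = j then 1 else 0)"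
    by blast
  define g where "g i = (\<Sum>b<r. G' i b * M b l) / M t l" for i
  define H where "H i a = G' i a - (if a = t then g i else 0)" for i a
  have H: "(\<Sum>a<r. H i a * M a j) = (\<Sum>a<r. G' i a * M a j) - g i * M t j" for i j
    using t(1) by (simp add: H_def left_diff_distrib sum_subtractf if_distrib[of "\<lambda>x. x * _"] cong: if_cong)
  have H1: "(\<Sum>a<r. H i a * M a j) = (if i = j then 1 else 0)" if "i < l" "j < l" for i j
  proof -
    have "(\<Sum>a<r. G' i a * M' a j) = (\<Sum>a<r. G' i a * M a j) - g i * M t j"
      by (simp add: M'_def g_def right_diff_distrib sum_subtractf sum_distrib_right sum_distrib_left sum_divide_distrib mult_ac)
    then show ?thesis using G'[OF that] by (simp add: H)
  qed
  have H2: "(\<Sum>a<r. H i a * M a l) = 0" for i using t(2) by (simp add: H g_def)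
  define G where "G i a = (if i < l then H i a else ((if a = t then 1 else 0) - (\<Sum>j<l. M t j * H j a)) / M t l)" for i a
  have last: "(\<Sum>a<r. G l a * M a j) = (M t j - (\<Sum>k<l. M t k * (\<Sum>a<r. H k a * M a j))) / M t l" for j
  proof -
    have "(\<Sum>a<r. G l a * M a j)
        = ((\<Sum>a<r. (if a = t then M a j else 0)) - (\<Sum>a<r. \<Sum>k<l. M t k * (H k a * M a j))) / M t l"
      unfolding sum_subtractf[symmetric] sum_divide_distrib
      by (rule sum.cong) (simp_all add: G_def left_diff_distrib sum_distrib_right mult.assoc)
    also have "(\<Sum>a<r. \<Sum>k<l. M t k * (H k a * M a j)) = (\<Sum>k<l. M t k * (\<Sum>a<r. H k a * M a j))"
      by (subst sum.swap) (simp add: sum_distrib_left)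
    finally show ?thesis using t(1) by simp
  qed
  have "(\<Sum>a<r. G i a * M a j) = (if i = j then 1 else 0)" if "i < Suc l" "j < Suc l" for i j
  proof (cases "i < l")
    case True
    then show ?thesis using H1[of i j] H2[of i] that by (cases "j < l") (auto simp: G_def less_Suc_eq)
  next
    case False
    then have i: "i = l" using that by simp
    show ?thesis
    proof (cases "j < l")
      case True
      then have "(\<Sum>k<l. M t k * (\<Sum>a<r. H k a * M a j)) = (\<Sum>k<l. if k = j then M t k else 0)"
        by (intro sum.cong refl) (simp add: H1)
      then show ?thesis using True i by (simp add: last)
    next
      case False
      then have "j = l" using that by simp
      then show ?thesis using i t(2) by (simp add: last H2)
    qed
  qed
  then show ?case by blast
qed

lemma rank_full_column_iff:
  fixes M :: "'a::field mat"
  assumes M: "M \<in> carrier_mat r l"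
  shows "vec_space.rank r M = l \<longleftrightarrow> (\<forall>v\<in>carrier_vec l. M *\<^sub>v v = 0\<^sub>v r \<longrightarrow> v = 0\<^sub>v l)"
proof -
  interpret vec_space "TYPE('a)" r .
  have len: "length (cols M) = l" using M by simp
  show ?thesis
  proof
    assume rank: "rank M = l"
    have "distinct (cols M)"
    proof (rule ccontr)
      assume nd: "\<not> distinct (cols M)"
      obtain S where S: "maximal S (\<lambda>T. T \<subseteq> set (cols M) \<and> lin_indpt T)"
        using maximal_exists_superset[of "set (cols M)" "\<lambda>T. T \<subseteq> set (cols M) \<and> lin_indpt T" "{}"]
        by (auto simp: lin_dep_def)
      have "rank M = card S" by (rule rank_card_indpt[OF M S])
      also have "\<dots> \<le> card (set (cols M))"
        by (rule card_mono) (use S in \<open>auto simp: maximal_def\<close>)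
      also have "\<dots> < l" using nd len card_distinct[of "cols M"] card_length[of "cols M"] by fastforce
      finally show False using rank by simp
    qed
    then show "\<forall>v\<in>carrier_vec l. M *\<^sub>v v = 0\<^sub>v r \<longrightarrow> v = 0\<^sub>v l"
      using full_rank_lin_indpt[OF M rank] lin_depI[OF M] by blast
  next
    assume inj: "\<forall>v\<in>carrier_vec l. M *\<^sub>v v = 0\<^sub>v r \<longrightarrow> v = 0\<^sub>v l"
    have unit: "M *\<^sub>v unit_vec l i = col M i" if "i < l" for i
      using that M by (intro eq_vecI) (auto simp: scalar_prod_right_unit)
    have dist: "distinct (cols M)"
      unfolding distinct_conv_nth
    proof (intro allI impI notI)
      fix i j assume ij: "i < length (cols M)" "j < length (cols M)" "i \<noteq> j" "cols M ! i = cols M ! j"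
      let ?v = "unit_vec l i - unit_vec l j :: 'a Matrix.vec"
      have "M *\<^sub>v ?v = M *\<^sub>v unit_vec l i - M *\<^sub>v unit_vec l j"
        by (rule mult_minus_distrib_mat_vec[OF M]) auto
      also have "\<dots> = col M i - col M j"
        using ij(1,2) len unit by simp
      also have "\<dots> = 0\<^sub>v r" using ij len M by simp
      finally have "?v = 0\<^sub>v l" using inj by simp
      then have "?v $ i = 0" using ij len by simp
      then show False using ij len by simp
    qed
    have "lin_indpt (set (cols M))"
      using lin_depE[OF M _ dist] inj by blast
    then show "rank M = l" by (rule lin_indpt_full_rank[OF M dist])
  qed
qed

lemma rank_full_row_iff:
  fixes M :: "'a::field mat"
  assumes M: "M \<in> carrier_mat l r"
  shows "vec_space.rank l M = l \<longleftrightarrow> (\<forall>y\<in>carrier_vec l. \<exists>x\<in>carrier_vec r. M *\<^sub>v x = y)"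
proof -
  interpret vec_space "TYPE('a)" l .
  have cols: "set (cols M) \<subseteq> carrier_vec l" using M by (auto simp: cols_def)
  have span: "span (set (cols M)) = {y\<in>carrier_vec l. \<exists>x\<in>carrier_vec r. M *\<^sub>v x = y}"
    using col_space_eq[OF M] M by (simp add: col_space_def)
  show ?thesis
  proof
    assume rank: "rank M = l"
    obtain S where S: "maximal S (\<lambda>T. T \<subseteq> set (cols M) \<and> lin_indpt T)"
      using maximal_exists_superset[of "set (cols M)" "\<lambda>T. T \<subseteq> set (cols M) \<and> lin_indpt T" "{}"]
      by (auto simp: lin_dep_def)
    then have S': "S \<subseteq> set (cols M)" "lin_indpt S" by (auto simp: maximal_def)
    have "card S = l" using rank_card_indpt[OF M S] rank by simp
    then have "basis S"
      by (intro dim_li_is_basis fin_dim) (use S' cols finite_subset[OF S'(1)] dim_is_n in auto)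
    then have "carrier_vec l \<subseteq> span (set (cols M))"
      using span_is_monotone[OF S'(1)] by (auto simp: basis_def)
    then show "\<forall>y\<in>carrier_vec l. \<exists>x\<in>carrier_vec r. M *\<^sub>v x = y" unfolding span by blast
  next
    assume "\<forall>y\<in>carrier_vec l. \<exists>x\<in>carrier_vec r. M *\<^sub>v x = y"
    then have "span (set (cols M)) = carrier_vec l" unfolding span by auto
    then have "span_vs (set (cols M)) = V" by simp
    then show "rank M = l" unfolding rank_def using dim_is_n by simp
  qed
qed

text \<open>Openness is shown with sequences, for which convergence of sums, products, powers and determinants is
  immediate from the limit theorems for entries.\<close>

definition mat_tendsto :: "(nat \<Rightarrow> 'a::real_normed_field mat) \<Rightarrow> 'a mat \<Rightarrow> bool" where
  "mat_tendsto X L \<longleftrightarrow> (\<forall>k. X k \<in> carrier_mat (dim_row L) (dim_col L)) \<and>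
     (\<forall>i<dim_row L. \<forall>j<dim_col L. (\<lambda>k. X k $$ (i, j)) \<longlonglongrightarrow> L $$ (i, j))"

lemma mat_tendsto_const: "mat_tendsto (\<lambda>_. L) L"
  by (simp add: mat_tendsto_def)

lemma mat_tendsto_mult:
  assumes X: "mat_tendsto X L" and Y: "mat_tendsto Y N" and dim: "dim_col L = dim_row N"
  shows "mat_tendsto (\<lambda>k. X k * Y k) (L * N)"
  unfolding mat_tendsto_def
proof (intro conjI allI impI)
  have c: "X k \<in> carrier_mat (dim_row L) (dim_col L)" "Y k \<in> carrier_mat (dim_row N) (dim_col N)" for k
    using X Y by (auto simp: mat_tendsto_def)
  show "X k * Y k \<in> carrier_mat (dim_row (L * N)) (dim_col (L * N))" for k
    using c[of k] dim by auto
  fix i j assume ij: "i < dim_row (L * N)" "j < dim_col (L * N)"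
  have "(\<lambda>k. \<Sum>a<dim_row N. X k $$ (i, a) * Y k $$ (a, j)) \<longlonglongrightarrow> (\<Sum>a<dim_row N. L $$ (i, a) * N $$ (a, j))"
    by (intro tendsto_sum tendsto_mult) (use X Y ij dim in \<open>auto simp: mat_tendsto_def\<close>)
  moreover have "(X k * Y k) $$ (i, j) = (\<Sum>a<dim_row N. X k $$ (i, a) * Y k $$ (a, j))" for k
    using c[of k] ij dim by (auto simp: scalar_prod_def row_def col_def lessThan_atLeast0)
  moreover have "(L * N) $$ (i, j) = (\<Sum>a<dim_row N. L $$ (i, a) * N $$ (a, j))"
    using ij dim by (auto simp: scalar_prod_def row_def col_def lessThan_atLeast0)
  ultimately show "(\<lambda>k. (X k * Y k) $$ (i, j)) \<longlonglongrightarrow> (L * N) $$ (i, j)" by simp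
qed

lemma mat_tendsto_pow:
  assumes X: "mat_tendsto X L" and dim: "dim_col L = dim_row L"
  shows "mat_tendsto (\<lambda>k. X k ^\<^sub>m t) (L ^\<^sub>m t)"
proof (induction t)
  case 0
  have "dim_row (X k) = dim_row L" for k using X by (auto simp: mat_tendsto_def)
  then show ?case by (simp add: mat_tendsto_const)
next
  case (Suc t)
  have "dim_col (L ^\<^sub>m t) = dim_row L" using dim by (cases t) simp_all
  then show ?case using mat_tendsto_mult[OF Suc X] by simp
qed

lemma tendsto_det:
  assumes X: "mat_tendsto X L" and dim: "dim_col L = dim_row L"
  shows "(\<lambda>k. det (X k)) \<longlonglongrightarrow> det L"
proof -
  have c: "X k \<in> carrier_mat (dim_row L) (dim_row L)" for k using X dim by (auto simp: mat_tendsto_def)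
  have L: "L \<in> carrier_mat (dim_row L) (dim_row L)" using dim by auto
  show ?thesis
    unfolding det_def'[OF c] det_def'[OF L]
    by (intro tendsto_sum tendsto_mult tendsto_prod tendsto_const)
       (use X dim in \<open>auto simp: mat_tendsto_def permutes_in_image\<close>)
qed


lemma left_inverse_mat:
  fixes M :: "'a::field mat"
  assumes M: "M \<in> carrier_mat r l" and inj: "\<And>v. v \<in> carrier_vec l \<Longrightarrow> M *\<^sub>v v = 0\<^sub>v r \<Longrightarrow> v = 0\<^sub>v l"
  shows "\<exists>G\<in>carrier_mat l r. G * M = 1\<^sub>m l"
proof -
  have "\<exists>G. \<forall>i<l. \<forall>j<l. (\<Sum>a<r. G i a * M $$ (a, j)) = (if i = j then 1 else 0)"
  proof (rule left_inverse_if_injective)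
    fix v :: "nat \<Rightarrow> 'a" assume v: "\<forall>i<r. (\<Sum>j<l. M $$ (i, j) * v j) = 0"
    have "M *\<^sub>v Matrix.vec l v = 0\<^sub>v r"
      using v M by (intro eq_vecI) (auto simp: scalar_prod_def row_def lessThan_atLeast0)
    then have "Matrix.vec l v = 0\<^sub>v l" by (intro inj) simp_all
    then show "\<forall>j<l. v j = 0" by (metis index_vec index_zero_vec(1))
  qed
  then obtain G where G: "\<forall>i<l. \<forall>j<l. (\<Sum>a<r. G i a * M $$ (a, j)) = (if i = j then 1 else 0)" ..
  have "Matrix.mat l r (\<lambda>(i, a). G i a) * M = 1\<^sub>m l"
    using G M by (intro eq_matI) (auto simp: scalar_prod_def row_def col_def lessThan_atLeast0)
  then show ?thesis by (intro bexI[of _ "Matrix.mat l r (\<lambda>(i, a). G i a)"]) simp_all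
qed

lemma right_inverse_mat:
  fixes M :: "'a::field mat"
  assumes M: "M \<in> carrier_mat l r" and surj: "\<forall>y\<in>carrier_vec l. \<exists>x\<in>carrier_vec r. M *\<^sub>v x = y"
  shows "\<exists>G\<in>carrier_mat r l. M * G = 1\<^sub>m l"
proof -
  have "\<forall>j. \<exists>x. x \<in> carrier_vec r \<and> M *\<^sub>v x = unit_vec l j" using surj by auto
  from choice[OF this] obtain g where g: "\<And>j. g j \<in> carrier_vec r" "\<And>j. M *\<^sub>v g j = unit_vec l j" by auto
  let ?G = "Matrix.mat r l (\<lambda>(a, j). g j $ a)"
  have "M * ?G = 1\<^sub>m l"
  proof (rule eq_matI)
    fix i j assume ij: "i < dim_row (1\<^sub>m l :: 'a mat)" "j < dim_col (1\<^sub>m l :: 'a mat)"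
    have "col ?G j = g j" using ij g(1)[of j] by (intro eq_vecI) auto
    then have "(M * ?G) $$ (i, j) = (M *\<^sub>v g j) $ i" using ij M by simp
    then show "(M * ?G) $$ (i, j) = 1\<^sub>m l $$ (i, j)" using ij by (simp add: g(2) unit_vec_def)
  qed (use M in auto)
  then show ?thesis by (intro bexI[of _ ?G]) simp_all
qed

lemma injective_if_det_nonzero:
  fixes G M :: "'a::field mat"
  assumes "G \<in> carrier_mat l r" "M \<in> carrier_mat r l" "det (G * M) \<noteq> 0" "v \<in> carrier_vec l" "M *\<^sub>v v = 0\<^sub>v r"
  shows "v = 0\<^sub>v l"
proof -
  have "G *\<^sub>v 0\<^sub>v r = 0\<^sub>v l"
    using assms(1) by (intro eq_vecI) (auto simp: scalar_prod_def)
  then have "(G * M) *\<^sub>v v = 0\<^sub>v l"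
    using assms by (simp add: assoc_mult_mat_vec[of G l r M l v])
  then show ?thesis
    using det_0_iff_vec_prod_zero_field[of "G * M" l] assms by auto
qed

lemma surjective_if_det_nonzero:
  fixes G M :: "'a::field mat"
  assumes M: "M \<in> carrier_mat l r" and G: "G \<in> carrier_mat r l" and det: "det (M * G) \<noteq> 0" and y: "y \<in> carrier_vec l"
  shows "\<exists>x\<in>carrier_vec r. M *\<^sub>v x = y"
proof -
  have MG: "M * G \<in> carrier_mat l l" using M G by auto
  from left_inverse_mat[OF MG] obtain H where H: "H \<in> carrier_mat l l" "H * (M * G) = 1\<^sub>m l"
    using det_0_iff_vec_prod_zero_field[OF MG] det by blast
  then have "(M * G) * H = 1\<^sub>m l" using mat_mult_left_right_inverse[OF H(1) MG] by simp
  moreover have Hy: "H *\<^sub>v y \<in> carrier_vec l" using H(1) y by auto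
  ultimately have "M *\<^sub>v (G *\<^sub>v (H *\<^sub>v y)) = y"
    using assoc_mult_mat_vec[OF M G Hy] assoc_mult_mat_vec[OF MG H(1) y] y by simp
  then show ?thesis using G H(1) y by (intro bexI[of _ "G *\<^sub>v (H *\<^sub>v y)"]) auto
qed

lemma controllability_carrier:
  "controllability_mat A B \<in> carrier_mat (dim_row A) (dim_row A * dim_col B)"
  by (simp add: controllability_mat_def)

lemma observability_carrier:
  "observability_mat A C \<in> carrier_mat (dim_row A * dim_row C) (dim_row A)"
  by (simp add: observability_mat_def)

lemma mat_tendsto_observability:
  assumes X: "mat_tendsto X A" and Y: "mat_tendsto Y C" and dim: "dim_col A = dim_row A" "dim_col C = dim_row A"
  shows "mat_tendsto (\<lambda>k. observability_mat (X k) (Y k)) (observability_mat A C)"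
proof -
  have c: "dim_row (X k) = dim_row A" "dim_row (Y k) = dim_row C" for k
    using X Y by (auto simp: mat_tendsto_def)
  have pow: "mat_tendsto (\<lambda>k. Y k * X k ^\<^sub>m t) (C * A ^\<^sub>m t)" for t
    by (rule mat_tendsto_mult[OF Y mat_tendsto_pow[OF X dim(1)]]) (use dim in \<open>cases t; simp\<close>)
  have dc: "dim_col (A ^\<^sub>m t) = dim_row A" for t using dim by (cases t) simp_all
  have mod: "i mod dim_row C < dim_row C" if "i < dim_row A * dim_row C" for i
    using that by (cases "dim_row C = 0") auto
  show ?thesis
    unfolding mat_tendsto_def
  proof (intro conjI allI impI)
    fix i j assume ij: "i < dim_row (observability_mat A C)" "j < dim_col (observability_mat A C)"
    then show "(\<lambda>k. observability_mat (X k) (Y k) $$ (i, j)) \<longlonglongrightarrow> observability_mat A C $$ (i, j)"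
      using pow[of "i div dim_row C"] mod[of i] by (simp add: observability_mat_def c mat_tendsto_def dim)
  qed (simp add: observability_mat_def c)
qed

lemma mat_tendsto_controllability:
  assumes X: "mat_tendsto X A" and Y: "mat_tendsto Y B" and dim: "dim_col A = dim_row A" "dim_row B = dim_row A"
  shows "mat_tendsto (\<lambda>k. controllability_mat (X k) (Y k)) (controllability_mat A B)"
proof -
  have c: "dim_row (X k) = dim_row A" "dim_col (Y k) = dim_col B" for k
    using X Y by (auto simp: mat_tendsto_def)
  have pow: "mat_tendsto (\<lambda>k. X k ^\<^sub>m t * Y k) (A ^\<^sub>m t * B)" for t
    by (rule mat_tendsto_mult[OF mat_tendsto_pow[OF X dim(1)] Y]) (use dim in \<open>cases t; simp\<close>)
  have dr: "dim_row (A ^\<^sub>m t) = dim_row A" for t by (induction t) simp_all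
  have mod: "j mod dim_col B < dim_col B" if "j < dim_row A * dim_col B" for j
    using that by (cases "dim_col B = 0") auto
  show ?thesis
    unfolding mat_tendsto_def
  proof (intro conjI allI impI)
    fix i j assume ij: "i < dim_row (controllability_mat A B)" "j < dim_col (controllability_mat A B)"
    then show "(\<lambda>k. controllability_mat (X k) (Y k) $$ (i, j)) \<longlonglongrightarrow> controllability_mat A B $$ (i, j)"
      using pow[of "j div dim_col B"] mod[of j] by (simp add: controllability_mat_def c mat_tendsto_def dr)
  qed (simp add: controllability_mat_def c)
qed

text \<open>Full rank of the limit is witnessed by a one-sided inverse. Multiplied by this fixed inverse, the
  approximating matrices give square matrices whose determinants tend to \<open>1\<close>, so these are
  eventually nonzero, and the approximating matrices have full rank as well.\<close>

lemma eventually_minimal: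
  fixes A B C :: "'a::real_normed_field mat"
  assumes A: "A \<in> carrier_mat l l" and B: "B \<in> carrier_mat l n" and C: "C \<in> carrier_mat m l"
    and min: "minimal_triple A B C"
    and X: "mat_tendsto X A" and Y: "mat_tendsto Y B" and Z: "mat_tendsto Z C"
  shows "\<forall>\<^sub>F k in sequentially. minimal_triple (X k) (Y k) (Z k)"
proof -
  let ?Co = "controllability_mat A B" and ?Ob = "observability_mat A C"
  have c: "X k \<in> carrier_mat l l" "Y k \<in> carrier_mat l n" "Z k \<in> carrier_mat m l" for k
    using X Y Z A B C by (auto simp: mat_tendsto_def)
  have Co: "controllability_mat A' B' \<in> carrier_mat l (l * n)" if "A' \<in> carrier_mat l l" "B' \<in> carrier_mat l n" for A' B' :: "'a mat"
    using controllability_carrier[of A' B'] that by auto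
  have Ob: "observability_mat A' C' \<in> carrier_mat (l * m) l" if "A' \<in> carrier_mat l l" "C' \<in> carrier_mat m l" for A' C' :: "'a mat"
    using observability_carrier[of A' C'] that by auto
  have ctr: "controllable A' B' \<longleftrightarrow> (\<forall>y\<in>carrier_vec l. \<exists>x\<in>carrier_vec (l * n). controllability_mat A' B' *\<^sub>v x = y)"
    if "A' \<in> carrier_mat l l" "B' \<in> carrier_mat l n" for A' B' :: "'a mat"
    using rank_full_row_iff[OF Co[OF that]] Co[OF that] that by (simp add: controllable_def)
  have obs: "observable A' C' \<longleftrightarrow> (\<forall>v\<in>carrier_vec l. observability_mat A' C' *\<^sub>v v = 0\<^sub>v (l * m) \<longrightarrow> v = 0\<^sub>v l)"
    if "A' \<in> carrier_mat l l" "C' \<in> carrier_mat m l" for A' C' :: "'a mat"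
    using rank_full_column_iff[OF Ob[OF that]] Ob[OF that] that by (simp add: observable_def)
  obtain G where G: "G \<in> carrier_mat (l * n) l" "?Co * G = 1\<^sub>m l"
    using right_inverse_mat[OF Co[OF A B]] ctr[OF A B] min by (auto simp: minimal_triple_def)
  obtain H where H: "H \<in> carrier_mat l (l * m)" "H * ?Ob = 1\<^sub>m l"
    using left_inverse_mat[OF Ob[OF A C]] obs[OF A C] min by (auto simp: minimal_triple_def)
  have "mat_tendsto (\<lambda>k. controllability_mat (X k) (Y k) * G) (?Co * G)"
    by (rule mat_tendsto_mult[OF mat_tendsto_controllability[OF X Y] mat_tendsto_const])
       (use A B G Co[OF A B] in auto)
  from tendsto_det[OF this] have "(\<lambda>k. det (controllability_mat (X k) (Y k) * G)) \<longlonglongrightarrow> 1"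
    using G by simp
  then have 1: "\<forall>\<^sub>F k in sequentially. det (controllability_mat (X k) (Y k) * G) \<noteq> 0"
    by (rule tendsto_imp_eventually_ne) simp
  have "mat_tendsto (\<lambda>k. H * observability_mat (X k) (Z k)) (H * ?Ob)"
    by (rule mat_tendsto_mult[OF mat_tendsto_const mat_tendsto_observability[OF X Z]])
       (use A C H Ob[OF A C] in auto)
  from tendsto_det[OF this] have "(\<lambda>k. det (H * observability_mat (X k) (Z k))) \<longlonglongrightarrow> 1"
    using H by simp
  then have 2: "\<forall>\<^sub>F k in sequentially. det (H * observability_mat (X k) (Z k)) \<noteq> 0"
    by (rule tendsto_imp_eventually_ne) simp
  show ?thesis
    using 1 2
  proof eventually_elim
    case (elim k)
    have "controllable (X k) (Y k)"
      unfolding ctr[OF c(1,2)] using surjective_if_det_nonzero[OF Co[OF c(1,2)] G(1) elim(1)] by blast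
    moreover have "observable (X k) (Z k)"
      unfolding obs[OF c(1,3)] using injective_if_det_nonzero[OF H(1) Ob[OF c(1,3)] elim(2)] by blast
    ultimately show ?case by (simp add: minimal_triple_def)
  qed
qed

definition mat_near :: "real \<Rightarrow> 'a::real_normed_field mat \<Rightarrow> 'a mat \<Rightarrow> bool" where
  "mat_near \<rho> X L \<longleftrightarrow> X \<in> carrier_mat (dim_row L) (dim_col L) \<and>
     (\<forall>i<dim_row L. \<forall>j<dim_col L. norm (X $$ (i, j) - L $$ (i, j)) < \<rho>)"

lemma mat_near_tendsto:
  assumes "\<And>k. mat_near (inverse (real (Suc k))) (X k) L"
  shows "mat_tendsto X L"
  unfolding mat_tendsto_def
proof (intro conjI allI impI)
  show "X k \<in> carrier_mat (dim_row L) (dim_col L)" for k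
    using assms[of k] by (simp add: mat_near_def)
  fix i j assume "i < dim_row L" "j < dim_col L"
  then have "norm (X k $$ (i, j) - L $$ (i, j)) \<le> inverse (real (Suc k))" for k
    using assms[of k] unfolding mat_near_def by (intro less_imp_le) blast
  then have "(\<lambda>k. X k $$ (i, j) - L $$ (i, j)) \<longlonglongrightarrow> 0"
    by (intro Lim_null_comparison[OF _ LIMSEQ_inverse_real_of_nat]) (simp del: of_nat_Suc)
  then show "(\<lambda>k. X k $$ (i, j)) \<longlonglongrightarrow> L $$ (i, j)" by (simp add: LIM_zero_iff)
qed

text \<open>Otherwise there would be triples that are not minimal within every distance \<open>1 / (k + 1)\<close>, contradicting
  the convergence of these triples to the minimal one.\<close>

lemma minimal_open:
  fixes A B C :: "'a::real_normed_field mat"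
  assumes A: "A \<in> carrier_mat l l" and B: "B \<in> carrier_mat l n" and C: "C \<in> carrier_mat m l"
    and min: "minimal_triple A B C"
  shows "\<exists>\<rho>>0. \<forall>A' B' C'. mat_near \<rho> A' A \<longrightarrow> mat_near \<rho> B' B \<longrightarrow> mat_near \<rho> C' C \<longrightarrow> minimal_triple A' B' C'"
proof (rule ccontr)
  define bad where "bad k T \<longleftrightarrow> mat_near (inverse (real (Suc k))) (fst T) A \<and>
    mat_near (inverse (real (Suc k))) (fst (snd T)) B \<and> mat_near (inverse (real (Suc k))) (snd (snd T)) C \<and>
    \<not> minimal_triple (fst T) (fst (snd T)) (snd (snd T))" for k T
  assume contra: "\<not> ?thesis"
  have "\<forall>k. \<exists>T. bad k T"
  proof
    fix k
    have "0 < inverse (real (Suc k))" by simp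
    with contra obtain A' B' C' where "mat_near (inverse (real (Suc k))) A' A"
      "mat_near (inverse (real (Suc k))) B' B" "mat_near (inverse (real (Suc k))) C' C"
      "\<not> minimal_triple A' B' C'" by blast
    then have "bad k (A', B', C')" by (simp only: bad_def fst_conv snd_conv not_False_eq_True simp_thms)
    then show "\<exists>T. bad k T" ..
  qed
  from choice[OF this] obtain T where T: "\<And>k. bad k (T k)" by blast
  have "\<forall>\<^sub>F k in sequentially. minimal_triple (fst (T k)) (fst (snd (T k))) (snd (snd (T k)))"
    by (rule eventually_minimal[OF A B C min]; rule mat_near_tendsto; use T in \<open>simp only: bad_def\<close>)
  then obtain k where "minimal_triple (fst (T k)) (fst (snd (T k))) (snd (snd (T k)))"
    by (auto simp: eventually_sequentially)
  then show False using T[of k] by (simp only: bad_def simp_thms)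
qed

section \<open>Entries of block Kronecker pencils\<close>

lemma append_cols_carrier:
  "X \<in> carrier_mat r c \<Longrightarrow> Y \<in> carrier_mat r c' \<Longrightarrow> append_cols X Y \<in> carrier_mat r (c + c')"
  by (auto simp: append_cols_def)

lemma append_cols_index:
  assumes "X \<in> carrier_mat r c" "Y \<in> carrier_mat r c'" "i < r" "j < c + c'"
  shows "append_cols X Y $$ (i, j) = (if j < c then X $$ (i, j) else Y $$ (i, j - c))"
  using assms by (auto simp: append_cols_def)

lemma append_rows_index:
  assumes "X \<in> carrier_mat r c" "Y \<in> carrier_mat r' c" "i < r + r'" "j < c"
  shows "(X @\<^sub>r Y) $$ (i, j) = (if i < r then X $$ (i, j) else Y $$ (i - r, j))"
  using assms by (auto simp: append_rows_def)

lemma block_mat_3_entry: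
  assumes "X11 \<in> carrier_mat p q" "X12 \<in> carrier_mat p l'" "X13 \<in> carrier_mat p u"
    "X21 \<in> carrier_mat l q" "X22 \<in> carrier_mat l l'" "X23 \<in> carrier_mat l u"
    "X31 \<in> carrier_mat v q" "X32 \<in> carrier_mat v l'" "X33 \<in> carrier_mat v u"
  defines "Z \<equiv> block_mat_3 X11 X12 X13 X21 X22 X23 X31 X32 X33"
  shows "Z \<in> carrier_mat (p + l + v) (q + l' + u)"
    and "i < p \<Longrightarrow> j < q \<Longrightarrow> Z $$ (i, j) = X11 $$ (i, j)"
    and "i < p \<Longrightarrow> j < l' \<Longrightarrow> Z $$ (i, q + j) = X12 $$ (i, j)"
    and "i < p \<Longrightarrow> j < u \<Longrightarrow> Z $$ (i, q + l' + j) = X13 $$ (i, j)"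
    and "i < l \<Longrightarrow> j < q \<Longrightarrow> Z $$ (p + i, j) = X21 $$ (i, j)"
    and "i < l \<Longrightarrow> j < l' \<Longrightarrow> Z $$ (p + i, q + j) = X22 $$ (i, j)"
    and "i < l \<Longrightarrow> j < u \<Longrightarrow> Z $$ (p + i, q + l' + j) = X23 $$ (i, j)"
    and "i < v \<Longrightarrow> j < q \<Longrightarrow> Z $$ (p + l + i, j) = X31 $$ (i, j)"
    and "i < v \<Longrightarrow> j < l' \<Longrightarrow> Z $$ (p + l + i, q + j) = X32 $$ (i, j)"
    and "i < v \<Longrightarrow> j < u \<Longrightarrow> Z $$ (p + l + i, q + l' + j) = X33 $$ (i, j)"
proof -
  note c = assms(1-9)
  have r1: "append_cols X11 (append_cols X12 X13) \<in> carrier_mat p (q + l' + u)"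
    and r2: "append_cols X21 (append_cols X22 X23) \<in> carrier_mat l (q + l' + u)"
    and r3: "append_cols X31 (append_cols X32 X33) \<in> carrier_mat v (q + l' + u)"
    using append_cols_carrier[OF c(1) append_cols_carrier[OF c(2,3)]]
      append_cols_carrier[OF c(4) append_cols_carrier[OF c(5,6)]]
      append_cols_carrier[OF c(7) append_cols_carrier[OF c(8,9)]] by (simp_all add: add.assoc)
  have r23: "append_cols X21 (append_cols X22 X23) @\<^sub>r append_cols X31 (append_cols X32 X33)
      \<in> carrier_mat (l + v) (q + l' + u)"
    using carrier_append_rows[OF r2 r3] .
  show "Z \<in> carrier_mat (p + l + v) (q + l' + u)"
    unfolding Z_def block_mat_3_def using carrier_append_rows[OF r1 r23] by (simp add: add.assoc)
  have e: "Z $$ (i, j) = (if i < p then append_cols X11 (append_cols X12 X13) $$ (i, j)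
      else if i < p + l then append_cols X21 (append_cols X22 X23) $$ (i - p, j)
      else append_cols X31 (append_cols X32 X33) $$ (i - (p + l), j))"
    if "i < p + l + v" "j < q + l' + u" for i j
    unfolding Z_def block_mat_3_def using that
    by (auto simp: append_rows_index[OF r1 r23] append_rows_index[OF r2 r3] diff_diff_add)
  have a1: "append_cols X11 (append_cols X12 X13) $$ (i, j)
      = (if j < q then X11 $$ (i, j) else if j < q + l' then X12 $$ (i, j - q) else X13 $$ (i, j - (q + l')))"
    if "i < p" "j < q + l' + u" for i j
    using that by (auto simp: append_cols_index[OF c(1) append_cols_carrier[OF c(2,3)]]
        append_cols_index[OF c(2,3)] diff_diff_add)
  have a2: "append_cols X21 (append_cols X22 X23) $$ (i, j)
      = (if j < q then X21 $$ (i, j) else if j < q + l' then X22 $$ (i, j - q) else X23 $$ (i, j - (q + l')))"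
    if "i < l" "j < q + l' + u" for i j
    using that by (auto simp: append_cols_index[OF c(4) append_cols_carrier[OF c(5,6)]]
        append_cols_index[OF c(5,6)] diff_diff_add)
  have a3: "append_cols X31 (append_cols X32 X33) $$ (i, j)
      = (if j < q then X31 $$ (i, j) else if j < q + l' then X32 $$ (i, j - q) else X33 $$ (i, j - (q + l')))"
    if "i < v" "j < q + l' + u" for i j
    using that by (auto simp: append_cols_index[OF c(7) append_cols_carrier[OF c(8,9)]]
        append_cols_index[OF c(8,9)] diff_diff_add)
  show "i < p \<Longrightarrow> j < q \<Longrightarrow> Z $$ (i, j) = X11 $$ (i, j)"
    "i < p \<Longrightarrow> j < l' \<Longrightarrow> Z $$ (i, q + j) = X12 $$ (i, j)"
    "i < p \<Longrightarrow> j < u \<Longrightarrow> Z $$ (i, q + l' + j) = X13 $$ (i, j)"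
    "i < l \<Longrightarrow> j < q \<Longrightarrow> Z $$ (p + i, j) = X21 $$ (i, j)"
    "i < l \<Longrightarrow> j < l' \<Longrightarrow> Z $$ (p + i, q + j) = X22 $$ (i, j)"
    "i < l \<Longrightarrow> j < u \<Longrightarrow> Z $$ (p + i, q + l' + j) = X23 $$ (i, j)"
    "i < v \<Longrightarrow> j < q \<Longrightarrow> Z $$ (p + l + i, j) = X31 $$ (i, j)"
    "i < v \<Longrightarrow> j < l' \<Longrightarrow> Z $$ (p + l + i, q + j) = X32 $$ (i, j)"
    "i < v \<Longrightarrow> j < u \<Longrightarrow> Z $$ (p + l + i, q + l' + j) = X33 $$ (i, j)"
    by (simp_all add: e a1 a2 a3)
qed

lemma block_mat_3_eqI:
  assumes c: "X11 \<in> carrier_mat p q" "X12 \<in> carrier_mat p l'" "X13 \<in> carrier_mat p u"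
    "X21 \<in> carrier_mat l q" "X22 \<in> carrier_mat l l'" "X23 \<in> carrier_mat l u"
    "X31 \<in> carrier_mat v q" "X32 \<in> carrier_mat v l'" "X33 \<in> carrier_mat v u"
    and Z: "Z \<in> carrier_mat (p + l + v) (q + l' + u)"
    and e: "\<And>i j. i < p \<Longrightarrow> j < q \<Longrightarrow> Z $$ (i, j) = X11 $$ (i, j)"
      "\<And>i j. i < p \<Longrightarrow> j < l' \<Longrightarrow> Z $$ (i, q + j) = X12 $$ (i, j)"
      "\<And>i j. i < p \<Longrightarrow> j < u \<Longrightarrow> Z $$ (i, q + l' + j) = X13 $$ (i, j)"
      "\<And>i j. i < l \<Longrightarrow> j < q \<Longrightarrow> Z $$ (p + i, j) = X21 $$ (i, j)"
      "\<And>i j. i < l \<Longrightarrow> j < l' \<Longrightarrow> Z $$ (p + i, q + j) = X22 $$ (i, j)"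
      "\<And>i j. i < l \<Longrightarrow> j < u \<Longrightarrow> Z $$ (p + i, q + l' + j) = X23 $$ (i, j)"
      "\<And>i j. i < v \<Longrightarrow> j < q \<Longrightarrow> Z $$ (p + l + i, j) = X31 $$ (i, j)"
      "\<And>i j. i < v \<Longrightarrow> j < l' \<Longrightarrow> Z $$ (p + l + i, q + j) = X32 $$ (i, j)"
      "\<And>i j. i < v \<Longrightarrow> j < u \<Longrightarrow> Z $$ (p + l + i, q + l' + j) = X33 $$ (i, j)"
  shows "Z = block_mat_3 X11 X12 X13 X21 X22 X23 X31 X32 X33"
proof (rule eq_matI)
  note b = block_mat_3_entry[OF c]
  show "dim_row Z = dim_row (block_mat_3 X11 X12 X13 X21 X22 X23 X31 X32 X33)"
    "dim_col Z = dim_col (block_mat_3 X11 X12 X13 X21 X22 X23 X31 X32 X33)" using b(1) Z by auto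
  fix i j assume "i < dim_row (block_mat_3 X11 X12 X13 X21 X22 X23 X31 X32 X33)"
    "j < dim_col (block_mat_3 X11 X12 X13 X21 X22 X23 X31 X32 X33)"
  then have i: "i < p + l + v" and j: "j < q + l' + u" using b(1) by auto
  show "Z $$ (i, j) = block_mat_3 X11 X12 X13 X21 X22 X23 X31 X32 X33 $$ (i, j)"
    using i
  proof (cases rule: split_index)
    case 1 show ?thesis using j by (cases rule: split_index) (use 1 in \<open>simp_all add: b e\<close>)
  next
    case (2 i') show ?thesis using j by (cases rule: split_index) (use 2 in \<open>simp_all add: b e\<close>)
  next
    case (3 i') show ?thesis using j by (cases rule: split_index) (use 3 in \<open>simp_all add: b e\<close>)
  qed
qed

lemma div_mod_eq_iff:
  fixes i j n :: nat
  assumes "0 < n"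
  shows "j div n = i div n \<and> i mod n = j mod n \<longleftrightarrow> j = i"
    and "j div n = i div n + 1 \<and> i mod n = j mod n \<longleftrightarrow> j = i + n"
proof -
  show "j div n = i div n \<and> i mod n = j mod n \<longleftrightarrow> j = i"
    by (metis div_mult_mod_eq)
  show "j div n = i div n + 1 \<and> i mod n = j mod n \<longleftrightarrow> j = i + n"
  proof
    assume *: "j div n = i div n + 1 \<and> i mod n = j mod n"
    have "j = j div n * n + j mod n" by simp
    also have "\<dots> = (i div n * n + i mod n) + n" using * by simp
    finally show "j = i + n" by simp
  qed (use assms in simp)
qed

lemma K_pencil_carrier: "K_pencil k n \<in> carrier_mat (k * n) ((k + 1) * n)"
  by (simp add: K_pencil_def kronecker_mat_def L_pencil_def E_mat_def F_mat_def)

lemma K_pencil_coeff: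
  fixes n :: nat
  assumes n: "0 < n" and i: "i < k * n" and j: "j < (k + 1) * n"
  shows "coeff (K_pencil k n $$ (i, j) :: 'a::comm_ring_1 poly) t =
    (if t = 0 then (if j = i then 1 else 0) else if t = 1 then (if j = i + n then - 1 else 0) else 0)"
proof -
  have id: "i div n < k" using i by (rule less_mult_imp_div_less)
  have jd: "j div n < k + 1" using j by (rule less_mult_imp_div_less)
  have im: "i mod n < n" "j mod n < n" using n by simp_all
  have "K_pencil k n $$ (i, j) = ([:if j div n = i div n then 1 else 0:]
      - [:0, 1:] * [:if j div n = i div n + 1 then 1 else 0:]) * (if i mod n = j mod n then 1 else 0 :: 'a poly)"
    using i j id jd im by (simp add: K_pencil_def kronecker_mat_def L_pencil_def E_mat_def F_mat_def)
  also have "\<dots> = [:if j div n = i div n \<and> i mod n = j mod n then 1 else 0,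
      if j div n = i div n + 1 \<and> i mod n = j mod n then - 1 else 0:]"
    by simp
  finally show ?thesis
    unfolding div_mod_eq_iff[OF n] by (cases t) (auto simp: coeff_pCons split: nat.split)
qed

lemma K_hat_carrier: "K_hat k n \<in> carrier_mat n ((k + 1) * n)"
  by (simp add: K_hat_def kronecker_mat_def last_unit_col_def)

lemma K_hat_index:
  assumes n: "0 < n" and i: "i < n" and j: "j < (k + 1) * n"
  shows "K_hat k n $$ (i, j) = (if k * n \<le> j \<and> i = j - k * n then 1 else 0 :: 'a::comm_ring_1)"
proof -
  have jd: "j div n < k + 1" using j by (rule less_mult_imp_div_less)
  have jm: "j mod n < n" using n by simp
  have iff: "j div n = k \<and> i = j mod n \<longleftrightarrow> k * n \<le> j \<and> i = j - k * n"
  proof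
    assume "j div n = k \<and> i = j mod n"
    then show "k * n \<le> j \<and> i = j - k * n"
      by (metis div_times_less_eq_dividend minus_div_mult_eq_mod)
  next
    assume *: "k * n \<le> j \<and> i = j - k * n"
    then have "j = k * n + i" by simp
    then show "j div n = k \<and> i = j mod n" using i by simp
  qed
  have "K_hat k n $$ (i, j) = (if j div n + 1 = k + 1 then 1 else 0) * (if i = j mod n then 1 else 0 :: 'a)"
    using i j jd jm by (simp add: K_hat_def kronecker_mat_def last_unit_col_def)
  also have "\<dots> = (if j div n = k \<and> i = j mod n then 1 else 0)" by simp
  finally show ?thesis unfolding iff .
qed

lemma mult_K_hat_index:
  fixes B :: "'a::comm_ring_1 mat"
  assumes n: "0 < n" and B: "B \<in> carrier_mat l n" and i: "i < l" and j: "j < (k + 1) * n"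
  shows "(B * K_hat k n) $$ (i, j) = (if k * n \<le> j then B $$ (i, j - k * n) else 0)"
proof -
  have "(B * K_hat k n) $$ (i, j) = (\<Sum>b<n. B $$ (i, b) * K_hat k n $$ (b, j))"
    using B i j K_hat_carrier[of k n, where 'a = 'a]
    by (simp add: scalar_prod_def row_def col_def lessThan_atLeast0)
  also have "\<dots> = (\<Sum>b<n. if b = j - k * n then (if k * n \<le> j then B $$ (i, b) else 0) else 0)"
    by (rule sum.cong) (use n j in \<open>auto simp: K_hat_index\<close>)
  finally show ?thesis using j by auto
qed

lemma K_hat_transpose_mult_index:
  fixes C :: "'a::comm_ring_1 mat"
  assumes m: "0 < m" and C: "C \<in> carrier_mat m l" and i: "i < (k + 1) * m" and j: "j < l"
  shows "(transpose_mat (K_hat k m) * C) $$ (i, j) = (if k * m \<le> i then C $$ (i - k * m, j) else 0)"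
proof -
  have "(transpose_mat (K_hat k m) * C) $$ (i, j) = (\<Sum>b<m. K_hat k m $$ (b, i) * C $$ (b, j))"
    using C i j K_hat_carrier[of k m, where 'a = 'a]
    by (simp add: scalar_prod_def row_def col_def lessThan_atLeast0)
  also have "\<dots> = (\<Sum>b<m. if b = i - k * m then (if k * m \<le> i then C $$ (b, j) else 0) else 0)"
    by (rule sum.cong) (use m i in \<open>auto simp: K_hat_index\<close>)
  finally show ?thesis using i by auto
qed

lemma pencil_coeff:
  "pencil P \<Longrightarrow> i < dim_row P \<Longrightarrow> j < dim_col P \<Longrightarrow> 1 < k \<Longrightarrow> coeff (P $$ (i, j)) k = 0"
proof -
  assume *: "pencil P" "i < dim_row P" "j < dim_col P" "1 < k"
  then have "coeff_mat k P $$ (i, j) = 0\<^sub>m (dim_row P) (dim_col P) $$ (i, j)" by (simp add: pencil_def)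
  then show ?thesis using * by (simp add: coeff_mat_def)
qed

lemma pencilI:
  assumes "\<And>k i j. 1 < k \<Longrightarrow> i < dim_row P \<Longrightarrow> j < dim_col P \<Longrightarrow> coeff (P $$ (i, j)) k = 0"
  shows "pencil P"
  unfolding pencil_def coeff_mat_def using assms by (auto intro!: eq_matI)

lemma Kronecker_blocks_carrier:
  fixes A B C :: "'a::comm_ring_1 mat" and M :: "'a poly mat"
  assumes A: "A \<in> carrier_mat l l" and B: "B \<in> carrier_mat l n" and C: "C \<in> carrier_mat m l"
  shows "const_mat (transpose_mat (K_hat \<eta> m) * C) \<in> carrier_mat ((\<eta> + 1) * m) l"
    "transpose_mat (K_pencil \<eta> m :: 'a poly mat) \<in> carrier_mat ((\<eta> + 1) * m) (\<eta> * m)"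
    "const_mat (B * K_hat \<epsilon> n) \<in> carrier_mat l ((\<epsilon> + 1) * n)"
    "const_mat A - [:0, 1:] \<cdot>\<^sub>m 1\<^sub>m l \<in> carrier_mat l l"
  using A B C K_hat_carrier[of \<eta> m, where 'a = 'a] K_hat_carrier[of \<epsilon> n, where 'a = 'a]
    K_pencil_carrier[of \<eta> m, where 'a = 'a]
  by (auto intro!: carrier_matI)

lemma const_mat_index:
  "X \<in> carrier_mat r c \<Longrightarrow> i < r \<Longrightarrow> j < c \<Longrightarrow> const_mat X $$ (i, j) = [:X $$ (i, j):]"
  by simp

lemma block_Kronecker_pencil_coeff:
  fixes A B C :: "'a::comm_ring_1 mat" and M :: "'a poly mat" and m n l \<epsilon> \<eta> k :: nat
  assumes A: "A \<in> carrier_mat l l" and B: "B \<in> carrier_mat l n" and C: "C \<in> carrier_mat m l"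
    and M: "M \<in> carrier_mat ((\<eta> + 1) * m) ((\<epsilon> + 1) * n)" and mn: "0 < m" "0 < n"
  defines "p \<equiv> (\<eta> + 1) * m" and "q \<equiv> (\<epsilon> + 1) * n" and "u \<equiv> \<eta> * m" and "v \<equiv> \<epsilon> * n"
  defines "Z \<equiv> block_Kronecker_pencil m n l \<epsilon> \<eta> M A B C"
  shows "Z \<in> carrier_mat (p + l + v) (q + l + u)"
    and "\<And>i j. i < p \<Longrightarrow> j < q \<Longrightarrow> Z $$ (i, j) = M $$ (i, j)"
    and "\<And>i j. i < p \<Longrightarrow> j < l \<Longrightarrow> coeff (Z $$ (i, q + j)) k = (if k = 0 \<and> u \<le> i then C $$ (i - u, j) else 0)"
    and "\<And>i j. i < p \<Longrightarrow> j < u \<Longrightarrow> coeff (Z $$ (i, q + l + j)) k =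
      (if k = 0 then (if i = j then 1 else 0) else if k = 1 then (if i = j + m then - 1 else 0) else 0)"
    and "\<And>i j. i < l \<Longrightarrow> j < q \<Longrightarrow> coeff (Z $$ (p + i, j)) k = (if k = 0 \<and> v \<le> j then B $$ (i, j - v) else 0)"
    and "\<And>i j. i < l \<Longrightarrow> j < l \<Longrightarrow> coeff (Z $$ (p + i, q + j)) k =
      (if k = 0 then A $$ (i, j) else if k = 1 then (if i = j then - 1 else 0) else 0)"
    and "\<And>i j. i < l \<Longrightarrow> j < u \<Longrightarrow> Z $$ (p + i, q + l + j) = 0"
    and "\<And>i j. i < v \<Longrightarrow> j < q \<Longrightarrow> coeff (Z $$ (p + l + i, j)) k =
      (if k = 0 then (if j = i then 1 else 0) else if k = 1 then (if j = i + n then - 1 else 0) else 0)"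
    and "\<And>i j. i < v \<Longrightarrow> j < l \<Longrightarrow> Z $$ (p + l + i, q + j) = 0"
    and "\<And>i j. i < v \<Longrightarrow> j < u \<Longrightarrow> Z $$ (p + l + i, q + l + j) = 0"
proof -
  note c = Kronecker_blocks_carrier(1,2)[OF A B C, where \<eta> = \<eta>]
    Kronecker_blocks_carrier(3)[OF A B C, where \<epsilon> = \<epsilon>] Kronecker_blocks_carrier(4)[OF A B C]
  note b = block_mat_3_entry[OF M c(1,2) c(3,4) zero_carrier_mat K_pencil_carrier zero_carrier_mat zero_carrier_mat,
      folded block_Kronecker_pencil_def Z_def p_def q_def u_def v_def]
  show "Z \<in> carrier_mat (p + l + v) (q + l + u)" by (rule b(1))
  show "Z $$ (i, j) = M $$ (i, j)" if "i < p" "j < q" for i j by (rule b(2)[OF that])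
  show "coeff (Z $$ (i, q + j)) k = (if k = 0 \<and> u \<le> i then C $$ (i - u, j) else 0)" if "i < p" "j < l" for i j
  proof -
    have "Z $$ (i, q + j) = [:(transpose_mat (K_hat \<eta> m) * C) $$ (i, j):]"
      using b(3)[OF that] that const_mat_index[OF c(1)[unfolded map_carrier_mat], of i j] by (simp add: p_def)
    then show ?thesis
      using K_hat_transpose_mult_index[OF mn(1) C, of i \<eta> j] that
      by (simp add: p_def u_def coeff_pCons split: nat.split)
  qed
  show "coeff (Z $$ (i, q + l + j)) k =
      (if k = 0 then (if i = j then 1 else 0) else if k = 1 then (if i = j + m then - 1 else 0) else 0)"
    if "i < p" "j < u" for i j
    using b(4)[OF that] that K_pencil_carrier[of \<eta> m, where 'a = 'a] K_pencil_coeff[OF mn(1), of j \<eta> i k, where 'a = 'a]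
    by (simp add: p_def u_def)
  show "coeff (Z $$ (p + i, j)) k = (if k = 0 \<and> v \<le> j then B $$ (i, j - v) else 0)" if "i < l" "j < q" for i j
  proof -
    have "Z $$ (p + i, j) = [:(B * K_hat \<epsilon> n) $$ (i, j):]"
      using b(5)[OF that] that const_mat_index[OF c(3)[unfolded map_carrier_mat], of i j] by (simp add: q_def)
    then show ?thesis
      using mult_K_hat_index[OF mn(2) B, of i j \<epsilon>] that
      by (simp add: q_def v_def coeff_pCons split: nat.split)
  qed
  show "coeff (Z $$ (p + i, q + j)) k =
      (if k = 0 then A $$ (i, j) else if k = 1 then (if i = j then - 1 else 0) else 0)" if "i < l" "j < l" for i j
  proof -
    have "Z $$ (p + i, q + j) = [:A $$ (i, j), if i = j then - 1 else 0:]"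
      using b(6)[OF that] that A by (auto simp: one_pCons)
    then show ?thesis by (auto simp: coeff_pCons split: nat.split)
  qed
  show "Z $$ (p + i, q + l + j) = 0" if "i < l" "j < u" for i j using b(7)[OF that] that by (simp add: u_def)
  show "coeff (Z $$ (p + l + i, j)) k =
      (if k = 0 then (if j = i then 1 else 0) else if k = 1 then (if j = i + n then - 1 else 0) else 0)"
    if "i < v" "j < q" for i j
    using b(8)[OF that] that K_pencil_coeff[OF mn(2), of i \<epsilon> j k, where 'a = 'a] by (simp add: q_def v_def)
  show "Z $$ (p + l + i, q + j) = 0" if "i < v" "j < l" for i j using b(9)[OF that] that by (simp add: v_def)
  show "Z $$ (p + l + i, q + l + j) = 0" if "i < v" "j < u" for i j using b(10)[OF that] that by (simp add: u_def v_def)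
qed

lemma eq_block_Kronecker_pencilI:
  fixes A B C :: "'a::comm_ring_1 mat" and M Z :: "'a poly mat" and m n l \<epsilon> \<eta> :: nat
  assumes A: "A \<in> carrier_mat l l" and B: "B \<in> carrier_mat l n" and C: "C \<in> carrier_mat m l"
    and M: "M \<in> carrier_mat ((\<eta> + 1) * m) ((\<epsilon> + 1) * n)" and mn: "0 < m" "0 < n"
    and Z: "Z \<in> carrier_mat ((\<eta> + 1) * m + l + \<epsilon> * n) ((\<epsilon> + 1) * n + l + \<eta> * m)"
    and eq: "\<And>k i j. i < (\<eta> + 1) * m + l + \<epsilon> * n \<Longrightarrow> j < (\<epsilon> + 1) * n + l + \<eta> * m \<Longrightarrow>
      coeff (Z $$ (i, j)) k = coeff (block_Kronecker_pencil m n l \<epsilon> \<eta> M A B C $$ (i, j)) k"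
  shows "Z = block_Kronecker_pencil m n l \<epsilon> \<eta> M A B C"
proof -
  note b = block_Kronecker_pencil_coeff(1)[OF A B C M mn]
  show ?thesis
    by (rule eq_matI) (use b Z eq in \<open>auto simp: poly_eq_iff\<close>)
qed

lemma pencil_frobenius_norm_eq:
  assumes "P \<in> carrier_mat r c"
  shows "pencil_frobenius_norm P = pfro r c (\<lambda>k i j. coeff (P $$ (i, j)) k)"
proof -
  have "frobenius_norm (coeff_mat k P) = fro r c (\<lambda>i j. coeff (P $$ (i, j)) k)" for k
    unfolding frobenius_norm_def by (rule L2_set_cong) (use assms in \<open>auto simp: coeff_mat_def\<close>)
  then show ?thesis by (simp add: pencil_frobenius_norm_def pfro_eq_sqrt)
qed

lemma pencil_spectral_norm_eq:
  "pencil_spectral_norm P = L2_set (\<lambda>k. spectral_norm (coeff_mat k P)) {..<2}"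
  by (simp add: pencil_spectral_norm_def L2_set_def numeral_2_eq_2)

text \<open>The link between matrices with polynomial entries and the entrywise analysis above.\<close>

lemma kron_pencil_block_Kronecker:
  fixes A B C :: "'a::{real_normed_field, banach} mat" and M :: "'a poly mat" and m n l \<epsilon> \<eta> :: nat
  assumes A: "A \<in> carrier_mat l l" and B: "B \<in> carrier_mat l n" and C: "C \<in> carrier_mat m l"
    and M: "M \<in> carrier_mat ((\<eta> + 1) * m) ((\<epsilon> + 1) * n)" and mn: "0 < m" "0 < n"
  defines "Z \<equiv> block_Kronecker_pencil m n l \<epsilon> \<eta> M A B C"
  shows "kron_pencil m n l (\<eta> * m) (\<epsilon> * n) ((\<eta> + 1) * m) ((\<epsilon> + 1) * n) \<epsilon> \<eta>
    (\<lambda>k i j. coeff (Z $$ (i, j)) k) (\<lambda>i j. A $$ (i, j)) (\<lambda>i j. B $$ (i, j)) (\<lambda>i j. C $$ (i, j))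
    (spectral_norm A) (spectral_norm B) (spectral_norm C) (\<lambda>k. spectral_norm (coeff_mat k Z))"
proof -
  note c = block_Kronecker_pencil_coeff[OF A B C M mn, folded Z_def]
  have bound: "op_bound ((\<eta> + 1) * m + l + \<epsilon> * n) ((\<epsilon> + 1) * n + l + \<eta> * m)
      (\<lambda>i j. coeff (Z $$ (i, j)) k) (spectral_norm (coeff_mat k Z))" for k
  proof -
    let ?r = "(\<eta> + 1) * m + l + \<epsilon> * n" and ?c = "(\<epsilon> + 1) * n + l + \<eta> * m"
    have "coeff_mat k Z \<in> carrier_mat ?r ?c" using c(1) by (simp add: coeff_mat_def)
    from op_bound_spectral_norm[OF this]
    have "op_bound ?r ?c (\<lambda>i j. coeff_mat k Z $$ (i, j)) (spectral_norm (coeff_mat k Z))" .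
    moreover have "(\<Sum>a<?c. coeff_mat k Z $$ (i, a) * x a) = (\<Sum>a<?c. coeff (Z $$ (i, a)) k * x a)"
      if "i < ?r" for i and x :: "nat \<Rightarrow> 'a"
      by (rule sum.cong) (use that c(1) in \<open>auto simp: coeff_mat_def\<close>)
    ultimately show ?thesis unfolding op_bound_def by (simp cong: L2_set_cong_simp)
  qed
  show ?thesis
    by unfold_locales
      (use mn c(3-10) bound op_bound_spectral_norm[OF A] op_bound_spectral_norm[OF B] op_bound_spectral_norm[OF C]
       in \<open>simp_all\<close>)
qed

lemma mult_mat_index_sum:
  fixes X Y :: "'a::semiring_0 mat"
  assumes "X \<in> carrier_mat r k" "Y \<in> carrier_mat k c" "i < r" "j < c"
  shows "(X * Y) $$ (i, j) = (\<Sum>a<k. X $$ (i, a) * Y $$ (a, j))"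
  using assms by (simp add: scalar_prod_def row_def col_def lessThan_atLeast0)

section \<open>Translation between matrices and entries\<close>

lemma transform_coeff:
  fixes P :: "'a::comm_ring_1 poly mat"
  assumes P: "P \<in> carrier_mat r c" and X: "X \<in> carrier_mat r r" and Y: "Y \<in> carrier_mat c c"
  defines "Q \<equiv> const_mat (1\<^sub>m r - X) * P * const_mat (1\<^sub>m c - Y)"
  shows "Q \<in> carrier_mat r c"
    and "i < r \<Longrightarrow> j < c \<Longrightarrow> coeff (Q $$ (i, j)) k =
      transform r c (\<lambda>i j. X $$ (i, j)) (\<lambda>k i j. coeff (P $$ (i, j)) k) (\<lambda>i j. Y $$ (i, j)) k i j"
proof -
  have CX: "const_mat (1\<^sub>m r - X) \<in> carrier_mat r r" and CY: "const_mat (1\<^sub>m c - Y) \<in> carrier_mat c c"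
    using minus_carrier_mat[OF X] minus_carrier_mat[OF Y] by simp_all
  have CXP: "const_mat (1\<^sub>m r - X) * P \<in> carrier_mat r c" by (rule mult_carrier_mat[OF CX P])
  show "Q \<in> carrier_mat r c" unfolding Q_def by (rule mult_carrier_mat[OF CXP CY])
  assume ij: "i < r" "j < c"
  let ?T = "\<lambda>i j. coeff (P $$ (i, j)) k"
  have L: "(const_mat (1\<^sub>m r - X) * P) $$ (i, b) = (\<Sum>a<r. [:(if i = a then 1 else 0) - X $$ (i, a):] * P $$ (a, b))"
    if "b < c" for b
    unfolding mult_mat_index_sum[OF CX P ij(1) that] using X ij by (intro sum.cong) auto
  have "Q $$ (i, j) = (\<Sum>b<c. (const_mat (1\<^sub>m r - X) * P) $$ (i, b) * [:(if b = j then 1 else 0) - Y $$ (b, j):])"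
    unfolding Q_def mult_mat_index_sum[OF CXP CY ij] using Y ij by (intro sum.cong) auto
  then have "coeff (Q $$ (i, j)) k = (\<Sum>b<c. (\<Sum>a<r. ((if i = a then 1 else 0) - X $$ (i, a)) * ?T a b)
      * ((if b = j then 1 else 0) - Y $$ (b, j)))"
    by (simp add: L coeff_sum mult.commute)
  also have "\<dots> = (\<Sum>b<c. (?T i b - (\<Sum>a<r. X $$ (i, a) * ?T a b)) * ((if b = j then 1 else 0) - Y $$ (b, j)))"
  proof (rule sum.cong[OF refl])
    fix b
    have "(\<Sum>a<r. ((if i = a then 1 else 0) - X $$ (i, a)) * ?T a b)
        = (\<Sum>a<r. if i = a then ?T a b else 0) - (\<Sum>a<r. X $$ (i, a) * ?T a b)"
      unfolding sum_subtractf[symmetric] by (rule sum.cong) (auto simp: left_diff_distrib)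
    then show "(\<Sum>a<r. ((if i = a then 1 else 0) - X $$ (i, a)) * ?T a b) * ((if b = j then 1 else 0) - Y $$ (b, j))
      = (?T i b - (\<Sum>a<r. X $$ (i, a) * ?T a b)) * ((if b = j then 1 else 0) - Y $$ (b, j))"
      using ij by simp
  qed
  also have "\<dots> = (\<Sum>b<c. if b = j then ?T i b - (\<Sum>a<r. X $$ (i, a) * ?T a b) else 0)
      - (\<Sum>b<c. ?T i b * Y $$ (b, j)) + (\<Sum>b<c. (\<Sum>a<r. X $$ (i, a) * ?T a b) * Y $$ (b, j))"
    unfolding sum_subtractf[symmetric] sum.distrib[symmetric]
    by (rule sum.cong) (auto simp: algebra_simps)
  also have "\<dots> = transform r c (\<lambda>i j. X $$ (i, j)) (\<lambda>k i j. coeff (P $$ (i, j)) k) (\<lambda>i j. Y $$ (i, j)) k i j"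
    using ij by (simp add: transform_def lmul_def rmul_def)
  finally show "coeff (Q $$ (i, j)) k =
      transform r c (\<lambda>i j. X $$ (i, j)) (\<lambda>k i j. coeff (P $$ (i, j)) k) (\<lambda>i j. Y $$ (i, j)) k i j" .
qed

lemma transform_cong:
  assumes "\<And>i j. i < r \<Longrightarrow> j < r \<Longrightarrow> X i j = X' i j" "\<And>i j. i < c \<Longrightarrow> j < c \<Longrightarrow> Y i j = Y' i j"
    "\<And>i j. i < r \<Longrightarrow> j < c \<Longrightarrow> T k i j = T' k i j" "i < r" "j < c"
  shows "transform r c X T Y k i j = transform r c X' T' Y' k i j"
  unfolding transform_def lmul_def rmul_def using assms by (auto intro!: arg_cong2[of _ _ _ _ "(+)"] arg_cong2[of _ _ _ _ "(-)"] sum.cong)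

text \<open>A kernel vector \<open>v\<close> satisfies \<open>v = X v\<close>, hence \<open>norm v \<le> norm v / 2\<close>.\<close>

lemma invertible_one_minus:
  fixes X :: "'a::real_normed_field mat"
  assumes X: "X \<in> carrier_mat r r" and small: "fro r r (\<lambda>i j. X $$ (i, j)) \<le> 1 / 2"
  shows "invertible_mat (1\<^sub>m r - X)"
proof -
  let ?M = "1\<^sub>m r - X"
  have M: "?M \<in> carrier_mat r r" by (rule minus_carrier_mat[OF X])
  have inj: "v = 0\<^sub>v r" if v: "v \<in> carrier_vec r" "?M *\<^sub>v v = 0\<^sub>v r" for v
  proof -
    have fixed: "v $ i = (\<Sum>a<r. X $$ (i, a) * v $ a)" if i: "i < r" for i
    proof -
      have "(?M *\<^sub>v v) $ i = v $ i - (\<Sum>a<r. X $$ (i, a) * v $ a)"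
      proof -
        have "(?M *\<^sub>v v) $ i = (\<Sum>a<r. ((if i = a then 1 else 0) - X $$ (i, a)) * v $ a)"
          using i X v(1) by (auto simp: scalar_prod_def row_def lessThan_atLeast0 intro!: sum.cong)
        also have "\<dots> = (\<Sum>a<r. if i = a then v $ a else 0) - (\<Sum>a<r. X $$ (i, a) * v $ a)"
          unfolding sum_subtractf[symmetric] by (rule sum.cong) (auto simp: left_diff_distrib)
        finally show ?thesis using i by simp
      qed
      then show ?thesis using v(2) i by simp
    qed
    have "L2_set (\<lambda>i. norm (v $ i)) {..<r} = L2_set (\<lambda>i. norm (\<Sum>a<r. X $$ (i, a) * v $ a)) {..<r}"
      by (rule L2_set_cong[OF refl], rule arg_cong[where f = norm], rule fixed) simp
    also have "\<dots> \<le> fro r r (\<lambda>i j. X $$ (i, j)) * L2_set (\<lambda>i. norm (v $ i)) {..<r}"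
      using op_bound_frobenius[of r r "\<lambda>i j. X $$ (i, j)"] by (simp add: op_bound_def)
    also have "\<dots> \<le> 1 / 2 * L2_set (\<lambda>i. norm (v $ i)) {..<r}"
      by (rule mult_right_mono[OF small]) simp
    finally have "L2_set (\<lambda>i. norm (v $ i)) {..<r} = 0"
      using L2_set_nonneg[of "\<lambda>i. norm (v $ i)" "{..<r}"] by linarith
    then show ?thesis using v(1) by (intro eq_vecI) (auto simp: L2_set_eq_0_iff)
  qed
  from left_inverse_mat[OF M inj] obtain G where G: "G \<in> carrier_mat r r" "G * ?M = 1\<^sub>m r" ..
  have "?M * G = 1\<^sub>m r" by (rule mat_mult_left_right_inverse[OF G(1) M G(2)])
  then show ?thesis
    unfolding invertible_mat_def inverts_mat_def using G M carrier_matD[OF M] carrier_matD[OF G(1)]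
    by (intro conjI exI[of _ G]) (simp_all only: square_mat.simps)
qed

section \<open>The degree of the polynomial part\<close>

lemma coeff_monom_sandwich:
  fixes f :: "'a::comm_ring_1 poly"
  assumes f: "\<And>k. 1 < k \<Longrightarrow> coeff f k = 0" and xy: "x \<le> a" "y \<le> b" and t: "a + b + 1 \<le> t"
  shows "coeff (monom 1 x * f * monom 1 y) t = (if x = a \<and> y = b \<and> t = a + b + 1 then coeff f 1 else 0)"
proof -
  have "coeff (monom 1 x * f * monom 1 y) t = coeff f (t - x - y)"
    using xy t by (simp add: mult.commute[of _ "monom 1 y"] coeff_monom_mult)
      (simp add: add.commute diff_diff_left)
  moreover have "1 < t - x - y" if "\<not> (x = a \<and> y = b \<and> t = a + b + 1)" using that xy t by auto
  ultimately show ?thesis using f by auto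
qed

lemma Lambda_Kronecker_index:
  fixes m :: nat
  assumes m: "0 < m" and a: "a < (k + 1) * m" and i: "i < m"
  shows "(Lambda_col k \<otimes>\<^sub>K 1\<^sub>m m) $$ (a, i) = (if a mod m = i then monom 1 (k - a div m) else (0 :: 'a::comm_ring_1 poly))"
proof -
  have "a div m < k + 1" using a by (rule less_mult_imp_div_less)
  then show ?thesis using a i m by (simp add: kronecker_mat_def Lambda_col_def)
qed

lemma Lambda_Kronecker_carrier: "Lambda_col k \<otimes>\<^sub>K 1\<^sub>m m \<in> carrier_mat ((k + 1) * m) m"
  by (simp add: kronecker_mat_def Lambda_col_def)

text \<open>Block \<open>(a, b)\<close> of the pencil \<open>M\<close> is multiplied by \<open>\<lambda>\<close> to the power \<open>\<eta> - a + \<epsilon> - b\<close>, and it has degree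
  at most one, so the degree \<open>\<epsilon> + \<eta> + 1\<close> is reached by the first block alone.\<close>

lemma leading_coeff_compressed_pencil:
  fixes M :: "'a::comm_ring_1 poly mat" and m n \<epsilon> \<eta> t :: nat
  assumes M: "M \<in> carrier_mat ((\<eta> + 1) * m) ((\<epsilon> + 1) * n)" and pen: "pencil M" and mn: "0 < m" "0 < n"
  defines "D \<equiv> transpose_mat (Lambda_col \<eta> \<otimes>\<^sub>K 1\<^sub>m m) * M * (Lambda_col \<epsilon> \<otimes>\<^sub>K 1\<^sub>m n)"
  shows "D \<in> carrier_mat m n"
    and "i < m \<Longrightarrow> j < n \<Longrightarrow> \<epsilon> + \<eta> + 1 \<le> t \<Longrightarrow>
      coeff (D $$ (i, j)) t = (if t = \<epsilon> + \<eta> + 1 then coeff (M $$ (i, j)) 1 else 0)"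
proof -
  let ?p = "(\<eta> + 1) * m" and ?q = "(\<epsilon> + 1) * n"
  let ?L = "Lambda_col \<eta> \<otimes>\<^sub>K 1\<^sub>m m :: 'a poly mat" and ?R = "Lambda_col \<epsilon> \<otimes>\<^sub>K 1\<^sub>m n :: 'a poly mat"
  have L: "transpose_mat ?L \<in> carrier_mat m ?p" by (simp only: transpose_carrier_mat Lambda_Kronecker_carrier)
  have LM: "transpose_mat ?L * M \<in> carrier_mat m ?q" by (rule mult_carrier_mat[OF L M])
  show "D \<in> carrier_mat m n" unfolding D_def by (rule mult_carrier_mat[OF LM Lambda_Kronecker_carrier])
  have first_block: "x mod d = y \<and> N - x div d = N \<longleftrightarrow> x = y" if "x div d \<le> N" "y < d" for x y d N :: nat
  proof
    assume "x mod d = y \<and> N - x div d = N"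
    then have "x mod d = y" "x div d = 0" using that(1) by linarith+
    then show "x = y" using div_mult_mod_eq[of x d] by simp
  qed (use that(2) in simp)
  assume ij: "i < m" "j < n" and t: "\<epsilon> + \<eta> + 1 \<le> t"
  have ip: "i < ?p" and jq: "j < ?q" using ij by (simp_all add: trans_less_add1)
  have compressed: "coeff (transpose_mat ?L $$ (i, a) * M $$ (a, b) * ?R $$ (b, j)) t = (if a = i then (if b = j then
      (if t = \<epsilon> + \<eta> + 1 then coeff (M $$ (i, j)) 1 else 0) else 0) else 0)"
    if ab: "a < ?p" "b < ?q" for a b
  proof -
    have Lam: "?L \<in> carrier_mat ?p m" by (rule Lambda_Kronecker_carrier)
    have ad: "a div m \<le> \<eta>" "b div n \<le> \<epsilon>"
      using less_mult_imp_div_less[OF ab(1)] less_mult_imp_div_less[OF ab(2)] by simp_all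
    have a_iff: "a mod m = i \<and> \<eta> - a div m = \<eta> \<longleftrightarrow> a = i" by (rule first_block[OF ad(1) ij(1)])
    have b_iff: "b mod n = j \<and> \<epsilon> - b div n = \<epsilon> \<longleftrightarrow> b = j" by (rule first_block[OF ad(2) ij(2)])
    have Lia: "transpose_mat ?L $$ (i, a) = (if a mod m = i then monom 1 (\<eta> - a div m) else 0)"
      using Lambda_Kronecker_index[OF mn(1) ab(1) ij(1), where 'a = 'a] carrier_matD[OF Lam] ab(1) ij(1)
      by (simp only: index_transpose_mat)
    have Rbj: "?R $$ (b, j) = (if b mod n = j then monom 1 (\<epsilon> - b div n) else 0)"
      by (rule Lambda_Kronecker_index[OF mn(2) ab(2) ij(2)])
    have low: "coeff (M $$ (a, b)) k = 0" if "1 < k" for k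
      by (rule pencil_coeff[OF pen _ _ that]) (simp_all only: carrier_matD[OF M] ab)
    note sandwich = coeff_monom_sandwich[of "M $$ (a, b)" "\<eta> - a div m" \<eta> "\<epsilon> - b div n" \<epsilon> t]
    show ?thesis
    proof (cases "a mod m = i \<and> b mod n = j")
      case True
      have L1: "transpose_mat ?L $$ (i, a) = monom 1 (\<eta> - a div m)" using Lia True by metis
      have R1: "?R $$ (b, j) = monom 1 (\<epsilon> - b div n)" using Rbj True by metis
      have t': "\<eta> + \<epsilon> + 1 \<le> t" using t by linarith
      have e: "\<eta> - a div m = \<eta> \<longleftrightarrow> a = i" "\<epsilon> - b div n = \<epsilon> \<longleftrightarrow> b = j" using a_iff b_iff True by blast+
      have "coeff (monom 1 (\<eta> - a div m) * M $$ (a, b) * monom 1 (\<epsilon> - b div n)) t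
          = (if a = i \<and> b = j \<and> t = \<eta> + \<epsilon> + 1 then coeff (M $$ (a, b)) 1 else 0)"
        unfolding e[symmetric] by (rule sandwich[OF low diff_le_self diff_le_self t'])
      moreover have "t = \<eta> + \<epsilon> + 1 \<longleftrightarrow> t = \<epsilon> + \<eta> + 1" by linarith
      ultimately show ?thesis unfolding L1 R1 by (cases "a = i"; cases "b = j") (simp_all only: simp_thms if_True if_False)
    next
      case False
      then have "transpose_mat ?L $$ (i, a) = 0 \<or> ?R $$ (b, j) = 0" using Lia Rbj by metis
      then have "transpose_mat ?L $$ (i, a) * M $$ (a, b) * ?R $$ (b, j) = 0" by (elim disjE) (simp_all only: mult_zero_left mult_zero_right)
      moreover have "\<not> (a = i \<and> b = j)" using False a_iff b_iff by blast
      ultimately show ?thesis by (cases "a = i"; cases "b = j") (simp_all only: simp_thms if_True if_False coeff_0)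
    qed
  qed
  have "D $$ (i, j) = (\<Sum>b<?q. (\<Sum>a<?p. transpose_mat ?L $$ (i, a) * M $$ (a, b)) * ?R $$ (b, j))"
    unfolding D_def mult_mat_index_sum[OF LM Lambda_Kronecker_carrier ij]
    by (rule sum.cong[OF refl]) (simp only: lessThan_iff mult_mat_index_sum[OF L M ij(1)])
  also have "\<dots> = (\<Sum>b<?q. \<Sum>a<?p. transpose_mat ?L $$ (i, a) * M $$ (a, b) * ?R $$ (b, j))"
    by (simp only: sum_distrib_right)
  finally have "coeff (D $$ (i, j)) t = (\<Sum>b<?q. \<Sum>a<?p. coeff (transpose_mat ?L $$ (i, a) * M $$ (a, b) * ?R $$ (b, j)) t)"
    by (simp only: coeff_sum)
  also have "\<dots> = (\<Sum>b<?q. \<Sum>a<?p. if a = i then (if b = j then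
      (if t = \<epsilon> + \<eta> + 1 then coeff (M $$ (i, j)) 1 else 0) else 0) else 0)"
    by (rule sum.cong[OF refl], rule sum.cong[OF refl], rule compressed) (simp_all only: lessThan_iff)
  also have "\<dots> = (if t = \<epsilon> + \<eta> + 1 then coeff (M $$ (i, j)) 1 else 0)"
    using ip jq by (simp only: sum.delta finite_lessThan lessThan_iff if_True)
  finally show "coeff (D $$ (i, j)) t = (if t = \<epsilon> + \<eta> + 1 then coeff (M $$ (i, j)) 1 else 0)" .
qed

lemma degree_compressed_pencil_iff:
  fixes M :: "'a::comm_ring_1 poly mat" and m n \<epsilon> \<eta> :: nat
  assumes M: "M \<in> carrier_mat ((\<eta> + 1) * m) ((\<epsilon> + 1) * n)" and pen: "pencil M" and mn: "0 < m" "0 < n"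
  shows "poly_mat_has_degree (transpose_mat (Lambda_col \<eta> \<otimes>\<^sub>K 1\<^sub>m m) * M * (Lambda_col \<epsilon> \<otimes>\<^sub>K 1\<^sub>m n)) (\<epsilon> + \<eta> + 1)
    \<longleftrightarrow> (\<exists>i<m. \<exists>j<n. coeff (M $$ (i, j)) 1 \<noteq> 0)"
proof -
  define D where "D = transpose_mat (Lambda_col \<eta> \<otimes>\<^sub>K 1\<^sub>m m) * M * (Lambda_col \<epsilon> \<otimes>\<^sub>K 1\<^sub>m n)"
  note lead = leading_coeff_compressed_pencil[OF M pen mn, folded D_def]
  have D: "dim_row D = m" "dim_col D = n" using lead(1) by auto
  have "coeff_mat k D = 0\<^sub>m m n" if "\<epsilon> + \<eta> + 1 < k" for k
    using that lead(2)[of _ _ k] D by (intro eq_matI) (auto simp: coeff_mat_def)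
  moreover have "coeff_mat (\<epsilon> + \<eta> + 1) D \<noteq> 0\<^sub>m m n \<longleftrightarrow> (\<exists>i<m. \<exists>j<n. coeff (M $$ (i, j)) 1 \<noteq> 0)"
  proof -
    have e: "coeff_mat (\<epsilon> + \<eta> + 1) D $$ (i, j) = coeff (M $$ (i, j)) 1" if "i < m" "j < n" for i j
      using lead(2)[OF that, of "\<epsilon> + \<eta> + 1"] that D by (simp add: coeff_mat_def)
    have c: "coeff_mat (\<epsilon> + \<eta> + 1) D \<in> carrier_mat m n" unfolding coeff_mat_def using lead(1) by (simp only: map_carrier_mat)
    have "coeff_mat (\<epsilon> + \<eta> + 1) D = 0\<^sub>m m n \<longleftrightarrow> (\<forall>i<m. \<forall>j<n. coeff (M $$ (i, j)) 1 = 0)"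
    proof
      assume z: "coeff_mat (\<epsilon> + \<eta> + 1) D = 0\<^sub>m m n"
      show "\<forall>i<m. \<forall>j<n. coeff (M $$ (i, j)) 1 = 0"
      proof (intro allI impI)
        fix i j assume "i < m" "j < n"
        then show "coeff (M $$ (i, j)) 1 = 0" using e[of i j] unfolding z by simp
      qed
    next
      assume "\<forall>i<m. \<forall>j<n. coeff (M $$ (i, j)) 1 = 0"
      then show "coeff_mat (\<epsilon> + \<eta> + 1) D = 0\<^sub>m m n" using c e by (intro eq_matI) auto
    qed
    then show ?thesis by blast
  qed
  ultimately show ?thesis unfolding poly_mat_has_degree_def D D_def[symmetric] by blast
qed

section \<open>The perturbation theorem\<close>

lemma strictly_block_lowerI:
  assumes "mat_supp (x + y + z) (x + y + z) (lower_mask x y) X"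
  shows "strictly_block_lower x y z (Matrix.mat (x + y + z) (x + y + z) (\<lambda>(i, j). X i j))"
  unfolding strictly_block_lower_def
proof (intro bexI)
  show "Matrix.mat (x + y + z) (x + y + z) (\<lambda>(i, j). X i j) = block_mat_3 (0\<^sub>m x x) (0\<^sub>m x y) (0\<^sub>m x z)
     (Matrix.mat y x (\<lambda>(i, j). X (x + i) j)) (0\<^sub>m y y) (0\<^sub>m y z)
     (Matrix.mat z x (\<lambda>(i, j). X (x + y + i) j)) (Matrix.mat z y (\<lambda>(i, j). X (x + y + i) (x + j))) (0\<^sub>m z z)"
    by (rule block_mat_3_eqI) (use assms in \<open>auto simp: mat_supp_def lower_mask_def\<close>)
qed auto

lemma strictly_block_upperI:
  assumes "mat_supp (x + y + z) (x + y + z) (\<lambda>i j. lower_mask x y j i) X"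
  shows "strictly_block_upper x y z (Matrix.mat (x + y + z) (x + y + z) (\<lambda>(i, j). X i j))"
  unfolding strictly_block_upper_def
proof (intro bexI)
  show "Matrix.mat (x + y + z) (x + y + z) (\<lambda>(i, j). X i j) = block_mat_3
     (0\<^sub>m x x) (Matrix.mat x y (\<lambda>(i, j). X i (x + j))) (Matrix.mat x z (\<lambda>(i, j). X i (x + y + j)))
     (0\<^sub>m y x) (0\<^sub>m y y) (Matrix.mat y z (\<lambda>(i, j). X (x + i) (x + y + j)))
     (0\<^sub>m z x) (0\<^sub>m z y) (0\<^sub>m z z)"
    by (rule block_mat_3_eqI) (use assms in \<open>auto simp: mat_supp_def lower_mask_def\<close>)
qed auto

lemma block_diagonalI:
  assumes "mat_supp (x + y + z) (x + y + z) (diag_mask x y) X"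
  shows "block_diagonal x y z (Matrix.mat (x + y + z) (x + y + z) (\<lambda>(i, j). X i j))"
  unfolding block_diagonal_def
proof (intro bexI)
  show "Matrix.mat (x + y + z) (x + y + z) (\<lambda>(i, j). X i j) = block_mat_3
     (Matrix.mat x x (\<lambda>(i, j). X i j)) (0\<^sub>m x y) (0\<^sub>m x z)
     (0\<^sub>m y x) (Matrix.mat y y (\<lambda>(i, j). X (x + i) (x + j))) (0\<^sub>m y z)
     (0\<^sub>m z x) (0\<^sub>m z y) (Matrix.mat z z (\<lambda>(i, j). X (x + y + i) (x + y + j)))"
    by (rule block_mat_3_eqI) (use assms in \<open>auto simp: mat_supp_def diag_mask_def\<close>)
qed auto

lemma strictly_block_upper_no_cornerI:
  assumes "mat_supp (x + y + z) (x + y + z) (upper_band_mask x y) X"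
  shows "strictly_block_upper_no_corner x y z (Matrix.mat (x + y + z) (x + y + z) (\<lambda>(i, j). X i j))"
  unfolding strictly_block_upper_no_corner_def
proof (intro bexI)
  show "Matrix.mat (x + y + z) (x + y + z) (\<lambda>(i, j). X i j) = block_mat_3
     (0\<^sub>m x x) (Matrix.mat x y (\<lambda>(i, j). X i (x + j))) (0\<^sub>m x z)
     (0\<^sub>m y x) (0\<^sub>m y y) (Matrix.mat y z (\<lambda>(i, j). X (x + i) (x + y + j)))
     (0\<^sub>m z x) (0\<^sub>m z y) (0\<^sub>m z z)"
    by (rule block_mat_3_eqI) (use assms in \<open>auto simp: mat_supp_def upper_band_mask_def\<close>)
qed auto

lemma strictly_block_lower_no_cornerI:
  assumes "mat_supp (x + y + z) (x + y + z) (\<lambda>i j. upper_band_mask x y j i) X"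
  shows "strictly_block_lower_no_corner x y z (Matrix.mat (x + y + z) (x + y + z) (\<lambda>(i, j). X i j))"
  unfolding strictly_block_lower_no_corner_def
proof (intro bexI)
  show "Matrix.mat (x + y + z) (x + y + z) (\<lambda>(i, j). X i j) = block_mat_3
     (0\<^sub>m x x) (0\<^sub>m x y) (0\<^sub>m x z)
     (Matrix.mat y x (\<lambda>(i, j). X (x + i) j)) (0\<^sub>m y y) (0\<^sub>m y z)
     (0\<^sub>m z x) (Matrix.mat z y (\<lambda>(i, j). X (x + y + i) (x + j))) (0\<^sub>m z z)"
    by (rule block_mat_3_eqI) (use assms in \<open>auto simp: mat_supp_def upper_band_mask_def\<close>)
qed auto

lemma transform_zero:
  assumes "\<And>i j. i < r \<Longrightarrow> j < c \<Longrightarrow> T k i j = 0" "i < r" "j < c"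
  shows "transform r c X T Y k i j = 0"
  unfolding transform_def lmul_def rmul_def using assms by simp

lemma factor_product_assoc:
  fixes P :: "'a::semiring_0 mat"
  assumes A: "A1 \<in> carrier_mat r r" "A2 \<in> carrier_mat r r" "A3 \<in> carrier_mat r r"
    and P: "P \<in> carrier_mat r c"
    and B: "B1 \<in> carrier_mat c c" "B2 \<in> carrier_mat c c" "B3 \<in> carrier_mat c c"
  shows "A3 * A2 * A1 * P * B1 * B2 * B3 = A3 * (A2 * (A1 * P * B1) * B2) * B3"
proof -
  have c: "A1 * P \<in> carrier_mat r c" "A1 * P * B1 \<in> carrier_mat r c" "A2 * (A1 * P * B1) \<in> carrier_mat r c"
    "A3 * A2 \<in> carrier_mat r r"
    using assms by (auto intro: mult_carrier_mat)
  have "A3 * A2 * A1 * P = A3 * A2 * (A1 * P)" by (rule assoc_mult_mat[OF c(4) A(1) P])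
  also have "\<dots> * B1 = A3 * A2 * (A1 * P * B1)" by (rule assoc_mult_mat[OF c(4) c(1) B(1)])
  also have "\<dots> = A3 * (A2 * (A1 * P * B1))" by (rule assoc_mult_mat[OF A(3,2) c(2)])
  also have "\<dots> * B2 = A3 * (A2 * (A1 * P * B1) * B2)" by (rule assoc_mult_mat[OF A(3) c(3) B(2)])
  finally show ?thesis by simp
qed

text \<open>With \<open>7 / 5 \<le> sqrt 2\<close> and \<open>17 / 10 \<le> sqrt 3\<close> one gets \<open>f1 \<ge> 18 * s\<close> and \<open>f2 \<ge> 7 / 5 * N\<close>. As polynomials in
  \<open>S\<close>, the products of the first two factors then compare coefficientwise: \<open>5 * 5 \<le> 18 * 7 / 5\<close> for the
  quadratic one, and \<open>N \<le> s\<close> for the linear one.\<close>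

lemma amplification_le:
  fixes N s S w :: real
  assumes N: "0 \<le> N" and s: "N \<le> s" and S: "0 \<le> S" and w: "0 \<le> w"
    and f1: "f1 = 4 * sqrt 2 * s / (2 - sqrt 3)" and f2: "sqrt 2 * N \<le> f2"
  shows "(1 + w * S) * ((1 + 5 * N * S) * (1 + 5 * s * S)) \<le> (1 + f1 * S) * (1 + f2 * S) * (1 + w * S)"
proof -
  have s2: "7 / 5 \<le> sqrt 2" by (rule real_le_rsqrt) (simp add: power2_eq_square)
  have s3: "sqrt 3 < 2" "17 / 10 \<le> sqrt 3" by (rule real_less_lsqrt; simp) (rule real_le_rsqrt, simp add: power2_eq_square)
  have s0: "0 \<le> s" using N s by simp
  have "18 * s * (2 - sqrt 3) \<le> 18 * s * (3 / 10)" by (rule mult_left_mono) (use s3 s0 in auto)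
  also have "\<dots> \<le> 4 * (7 / 5) * s" using s0 by simp
  also have "\<dots> \<le> 4 * sqrt 2 * s" using s2 s0 by (intro mult_right_mono) auto
  finally have f1_ge: "18 * s \<le> f1" unfolding f1 using s3 by (simp add: pos_le_divide_eq)
  have f2_ge: "7 / 5 * N \<le> f2" using mult_right_mono[OF s2 N] f2 by linarith
  have "5 * N * (5 * s) \<le> f1 * f2"
  proof -
    have "5 * N * (5 * s) \<le> 18 * s * (7 / 5 * N)" using mult_nonneg_nonneg[OF N s0] by (simp add: algebra_simps)
    also have "\<dots> \<le> f1 * f2" by (rule mult_mono[OF f1_ge f2_ge]) (use N s0 f1_ge in auto)
    finally show ?thesis .
  qed
  then have "5 * N * (5 * s) * S\<^sup>2 \<le> f1 * f2 * S\<^sup>2" by (rule mult_right_mono) simp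
  moreover have "(5 * N + 5 * s) * S \<le> (f1 + f2) * S"
    by (rule mult_right_mono[OF _ S]) (use f1_ge f2_ge N s in linarith)
  ultimately have "(1 + 5 * N * S) * (1 + 5 * s * S) \<le> (1 + f1 * S) * (1 + f2 * S)"
    by (simp add: algebra_simps power2_eq_square)
  then have "(1 + w * S) * ((1 + 5 * N * S) * (1 + 5 * s * S)) \<le> (1 + w * S) * ((1 + f1 * S) * (1 + f2 * S))"
    by (rule mult_left_mono) (use w S in simp)
  then show ?thesis by (simp only: mult_ac)
qed

lemma pfro_cong:
  assumes "\<And>k i j. k < 2 \<Longrightarrow> i < r \<Longrightarrow> j < c \<Longrightarrow> T k i j = U k i j"
  shows "pfro r c T = pfro r c U"
  by (rule antisym; rule pfro_mono) (use assms in simp_all)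

lemma three_stage_product_coeff:
  fixes P :: "'a::comm_ring_1 poly mat" and X1 X2 X3 Y1 Y2 Y3 :: "nat \<Rightarrow> nat \<Rightarrow> 'a" and r c i j k :: nat
  assumes P: "P \<in> carrier_mat r c"
  defines "E X \<equiv> const_mat (1\<^sub>m r - Matrix.mat r r (\<lambda>(i, j). X i j))"
    and "F Y \<equiv> const_mat (1\<^sub>m c - Matrix.mat c c (\<lambda>(i, j). Y i j))"
  defines "Q \<equiv> E X3 * E X2 * E X1 * P * F Y1 * F Y2 * F Y3"
  shows "Q \<in> carrier_mat r c"
    and "i < r \<Longrightarrow> j < c \<Longrightarrow> coeff (Q $$ (i, j)) k =
      transform r c X3 (transform r c X2 (transform r c X1 (\<lambda>k i j. coeff (P $$ (i, j)) k) Y1) Y2) Y3 k i j"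
proof -
  have E: "E X \<in> carrier_mat r r" for X by (simp add: E_def minus_carrier_mat)
  have F: "F Y \<in> carrier_mat c c" for Y by (simp add: F_def minus_carrier_mat)
  have step: "E X * T * F Y \<in> carrier_mat r c"
    "\<And>i j. i < r \<Longrightarrow> j < c \<Longrightarrow> coeff ((E X * T * F Y) $$ (i, j)) k = transform r c X (\<lambda>k i j. coeff (T $$ (i, j)) k) Y k i j"
    if T: "T \<in> carrier_mat r c" for X Y T
  proof -
    note t = transform_coeff[OF T, of "Matrix.mat r r (\<lambda>(i, j). X i j)" "Matrix.mat c c (\<lambda>(i, j). Y i j)",
        OF mat_carrier mat_carrier, folded E_def F_def]
    show "E X * T * F Y \<in> carrier_mat r c" by (rule t(1))
    fix i j assume ij: "i < r" "j < c"
    show "coeff ((E X * T * F Y) $$ (i, j)) k = transform r c X (\<lambda>k i j. coeff (T $$ (i, j)) k) Y k i j"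
      unfolding t(2)[OF ij] by (rule transform_cong) (use ij in auto)
  qed
  define Q1 where "Q1 = E X1 * P * F Y1"
  define Q2 where "Q2 = E X2 * Q1 * F Y2"
  have Q1: "Q1 \<in> carrier_mat r c" unfolding Q1_def by (rule step(1)[OF P])
  have Q2: "Q2 \<in> carrier_mat r c" unfolding Q2_def by (rule step(1)[OF Q1])
  have Q: "Q = E X3 * Q2 * F Y3"
    unfolding Q_def Q2_def Q1_def by (rule factor_product_assoc[OF E E E P F F F])
  show "Q \<in> carrier_mat r c" unfolding Q by (rule step(1)[OF Q2])
  assume ij: "i < r" "j < c"
  have "coeff (Q $$ (i, j)) k = transform r c X3 (\<lambda>k i j. coeff (Q2 $$ (i, j)) k) Y3 k i j"
    unfolding Q by (rule step(2)[OF Q2 ij])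
  also have "\<dots> = transform r c X3 (transform r c X2 (\<lambda>k i j. coeff (Q1 $$ (i, j)) k) Y2) Y3 k i j"
    by (rule transform_cong[OF refl refl _ ij]) (simp only: Q2_def step(2)[OF Q1])
  also have "\<dots> = transform r c X3 (transform r c X2 (transform r c X1 (\<lambda>k i j. coeff (P $$ (i, j)) k) Y1) Y2) Y3 k i j"
    by (rule transform_cong[OF refl refl _ ij], rule transform_cong[OF refl refl]) (simp_all only: Q1_def step(2)[OF P])
  finally show "coeff (Q $$ (i, j)) k =
      transform r c X3 (transform r c X2 (transform r c X1 (\<lambda>k i j. coeff (P $$ (i, j)) k) Y1) Y2) Y3 k i j" .
qed

text \<open>A pencil that differs from a block Kronecker pencil only in \<open>M\<close> and at the places of \<open>A\<close>, \<open>B\<close> and \<open>C\<close>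
  has the same shape, and its parameters can be read off.\<close>

lemma block_Kronecker_of_support:
  fixes A B C A' B' C' :: "'a::comm_ring_1 mat" and M Z M' :: "'a poly mat" and m n l \<epsilon> \<eta> :: nat
  assumes A: "A \<in> carrier_mat l l" and B: "B \<in> carrier_mat l n" and C: "C \<in> carrier_mat m l"
    and M: "M \<in> carrier_mat ((\<eta> + 1) * m) ((\<epsilon> + 1) * n)" and mn: "0 < m" "0 < n"
  defines "p \<equiv> (\<eta> + 1) * m" and "q \<equiv> (\<epsilon> + 1) * n" and "u \<equiv> \<eta> * m" and "v \<equiv> \<epsilon> * n"
  defines "S \<equiv> block_Kronecker_pencil m n l \<epsilon> \<eta> M A B C"
  assumes Z: "Z \<in> carrier_mat (p + l + v) (q + l + u)"
    and high: "\<And>k i j. 1 < k \<Longrightarrow> i < p + l + v \<Longrightarrow> j < q + l + u \<Longrightarrow> coeff (Z $$ (i, j)) k = 0"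
    and supp: "pencil_supp (p + l + v) (q + l + u) (Kronecker_mask p q l u v)
      (\<lambda>k i j. coeff (Z $$ (i, j)) k - coeff (S $$ (i, j)) k)"
    and M': "M' = Matrix.mat p q (\<lambda>(i, j). Z $$ (i, j))"
    and A': "A' = Matrix.mat l l (\<lambda>(i, j). coeff (Z $$ (p + i, q + j)) 0)"
    and B': "B' = Matrix.mat l n (\<lambda>(i, j). coeff (Z $$ (p + i, v + j)) 0)"
    and C': "C' = Matrix.mat m l (\<lambda>(i, j). coeff (Z $$ (u + i, q + j)) 0)"
  shows "Z = block_Kronecker_pencil m n l \<epsilon> \<eta> M' A' B' C'"
proof (rule eq_block_Kronecker_pencilI[OF _ _ _ _ mn])
  show c: "A' \<in> carrier_mat l l" "B' \<in> carrier_mat l n" "C' \<in> carrier_mat m l"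
    "M' \<in> carrier_mat ((\<eta> + 1) * m) ((\<epsilon> + 1) * n)"
    by (simp_all only: M' A' B' C' p_def q_def mat_carrier)
  have e: "\<And>i j. i < p \<Longrightarrow> j < q \<Longrightarrow> M' $$ (i, j) = Z $$ (i, j)"
    "\<And>i j. i < l \<Longrightarrow> j < l \<Longrightarrow> A' $$ (i, j) = coeff (Z $$ (p + i, q + j)) 0"
    "\<And>i j. i < l \<Longrightarrow> j < n \<Longrightarrow> B' $$ (i, j) = coeff (Z $$ (p + i, v + j)) 0"
    "\<And>i j. i < m \<Longrightarrow> j < l \<Longrightarrow> C' $$ (i, j) = coeff (Z $$ (u + i, q + j)) 0"
    by (simp_all add: M' A' B' C')
  show "Z \<in> carrier_mat ((\<eta> + 1) * m + l + \<epsilon> * n) ((\<epsilon> + 1) * n + l + \<eta> * m)"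
    using Z unfolding p_def q_def u_def v_def .
  note s = block_Kronecker_pencil_coeff[OF A B C M mn, folded p_def q_def u_def v_def S_def]
  note t = block_Kronecker_pencil_coeff[OF c mn, folded p_def q_def u_def v_def]
  have pq: "p = u + m" "q = v + n" by (simp_all add: p_def q_def u_def v_def)
  fix k i j assume "i < (\<eta> + 1) * m + l + \<epsilon> * n" "j < (\<epsilon> + 1) * n + l + \<eta> * m"
  then have i: "i < p + l + v" and j: "j < q + l + u" by (simp_all only: p_def q_def u_def v_def)
  have eq: "coeff (Z $$ (i, j)) k = coeff (S $$ (i, j)) k" if "k < 2" "\<not> Kronecker_mask p q l u v k i j"
    using supp i j that unfolding pencil_supp_def by (metis eq_iff_diff_eq_0)
  have hi: "coeff (Z $$ (i, j)) k = 0" if "\<not> k < 2" using high[OF _ i j, of k] that by simp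
  show "coeff (Z $$ (i, j)) k = coeff (block_Kronecker_pencil m n l \<epsilon> \<eta> M' A' B' C' $$ (i, j)) k"
    using i
  proof (cases rule: split_index)
    case 1
    show ?thesis using j
    proof (cases rule: split_index)
      case j1: 1
      then show ?thesis using 1 by (simp add: t e)
    next
      case j2: (2 j')
      show ?thesis
      proof (cases "k = 0 \<and> u \<le> i")
        case True
        then have "i - u < m" "u + (i - u) = i" using 1 pq by auto
        then show ?thesis using True 1 j2 by (simp add: t e)
      next
        case False
        then have "\<not> Kronecker_mask p q l u v k i j" using j2 by (auto simp: Kronecker_mask_def)
        then show ?thesis using eq hi False 1 j2 by (cases "k < 2") (auto simp: t s)
      qed
    next
      case j3: (3 j')
      have "\<not> Kronecker_mask p q l u v k i j" using j3 by (auto simp: Kronecker_mask_def)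
      then show ?thesis using eq hi 1 j3 by (cases "k < 2") (auto simp: t s)
    qed
  next
    case (2 i')
    show ?thesis using j
    proof (cases rule: split_index)
      case j1: 1
      show ?thesis
      proof (cases "k = 0 \<and> v \<le> j")
        case True
        then have "j - v < n" "v + (j - v) = j" using j1 pq by auto
        then show ?thesis using True 2 j1 by (simp add: t e)
      next
        case False
        then have "\<not> Kronecker_mask p q l u v k i j" using 2 by (auto simp: Kronecker_mask_def)
        then show ?thesis using eq hi False 2 j1 by (cases "k < 2") (auto simp: t s)
      qed
    next
      case j2: (2 j')
      show ?thesis
      proof (cases "k = 0")
        case True
        then show ?thesis using 2 j2 by (simp add: t e)
      next
        case False
        then have "\<not> Kronecker_mask p q l u v k i j" using 2 by (auto simp: Kronecker_mask_def)
        then show ?thesis using eq hi False 2 j2 by (cases "k < 2") (auto simp: t s)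
      qed
    next
      case j3: (3 j')
      have "\<not> Kronecker_mask p q l u v k i j" using 2 j3 by (auto simp: Kronecker_mask_def)
      then show ?thesis using eq hi 2 j3 by (cases "k < 2") (auto simp: t s)
    qed
  next
    case (3 i')
    then have nk: "\<not> Kronecker_mask p q l u v k i j" by (auto simp: Kronecker_mask_def)
    show ?thesis using j
      by (cases rule: split_index; cases "k < 2") (use 3 nk eq hi in \<open>auto simp: t s\<close>)
  qed
qed

theorem theorem4p13:
  fixes A B C :: "'a::{real_normed_field, euclidean_space} mat"
    and D M S :: "'a poly mat"
    and R :: "'a poly fract mat"
    and m n l \<epsilon> \<eta> :: nat
    and \<alpha> \<beta> \<gamma> s f\<^sub>1 f\<^sub>2 f\<^sub>3 :: real
  assumes dims: "m \<ge> 1" "n \<ge> 1" "l \<ge> 1"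
    and params: "max \<epsilon> \<eta> > 0"
    and S: "block_Kronecker_linearization m n l \<epsilon> \<eta> R A B C D M S"
    and \<alpha>: "\<alpha> = 1 + 2 * real \<epsilon> * max 1 (spectral_norm A ^ \<epsilon>)"
    and \<beta>: "\<beta> = 1 + 2 * real \<eta> * max 1 (spectral_norm A ^ \<eta>)"
    and \<gamma>: "\<gamma> = real (\<epsilon> + \<eta>) / (2 * sqrt 2)"
    and s: "s = max \<alpha> (max \<beta> \<gamma>) + \<gamma> * (\<beta> * spectral_norm B + \<alpha> * spectral_norm C)"
    and f1: "f\<^sub>1 = 4 * sqrt 2 * s / (2 - sqrt 3)"
    and f2: "f\<^sub>2 = sqrt 2 * (4 * real (max \<epsilon> \<eta>) - 1) / 3"
    and f3: "f\<^sub>3 = sqrt 2 * (1 + 2 * real (max \<eta> \<epsilon>) * max 1 (spectral_norm A ^ max \<eta> \<epsilon>))"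
  shows "\<exists>\<tau>>0. \<exists>K>0. \<forall>\<Delta>\<^sub>S \<in> carrier_mat (dim_row S) (dim_col S).
    pencil \<Delta>\<^sub>S \<and> pencil_frobenius_norm \<Delta>\<^sub>S < \<tau> \<longrightarrow>
    (\<exists>X\<^sub>1 X\<^sub>2 X\<^sub>3 Y\<^sub>1 Y\<^sub>2 Y\<^sub>3 R' A' B' C' D' M' S'.
       strictly_block_lower ((\<eta> + 1) * m) l (\<epsilon> * n) X\<^sub>1 \<and>
       block_diagonal ((\<eta> + 1) * m) l (\<epsilon> * n) X\<^sub>2 \<and>
       strictly_block_upper_no_corner ((\<eta> + 1) * m) l (\<epsilon> * n) X\<^sub>3 \<and>
       strictly_block_upper ((\<epsilon> + 1) * n) l (\<eta> * m) Y\<^sub>1 \<and>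
       block_diagonal ((\<epsilon> + 1) * n) l (\<eta> * m) Y\<^sub>2 \<and>
       strictly_block_lower_no_corner ((\<epsilon> + 1) * n) l (\<eta> * m) Y\<^sub>3 \<and>
       (\<forall>X \<in> {X\<^sub>1, X\<^sub>2, X\<^sub>3}. invertible_mat (1\<^sub>m (dim_row S) - X)) \<and>
       (\<forall>Y \<in> {Y\<^sub>1, Y\<^sub>2, Y\<^sub>3}. invertible_mat (1\<^sub>m (dim_col S) - Y)) \<and>
       S' = const_mat (1\<^sub>m (dim_row S) - X\<^sub>3) * const_mat (1\<^sub>m (dim_row S) - X\<^sub>2)
          * const_mat (1\<^sub>m (dim_row S) - X\<^sub>1) * (S + \<Delta>\<^sub>S)
          * const_mat (1\<^sub>m (dim_col S) - Y\<^sub>1) * const_mat (1\<^sub>m (dim_col S) - Y\<^sub>2)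
          * const_mat (1\<^sub>m (dim_col S) - Y\<^sub>3) \<and>
       block_Kronecker_linearization m n l \<epsilon> \<eta> R' A' B' C' D' M' S' \<and>
       pencil_frobenius_norm (S' - S)
         \<le> (1 + f\<^sub>1 * pencil_spectral_norm S) * (1 + f\<^sub>2 * pencil_spectral_norm S)
             * (1 + f\<^sub>3 * pencil_spectral_norm S) * pencil_frobenius_norm \<Delta>\<^sub>S
           + K * (pencil_frobenius_norm \<Delta>\<^sub>S / pencil_frobenius_norm S)\<^sup>2)"
proof -
  define p where "p = (\<eta> + 1) * m"
  define q where "q = (\<epsilon> + 1) * n"
  define u where "u = \<eta> * m"
  define v where "v = \<epsilon> * n"
  have mn: "0 < m" "0 < n" using dims by simp_all
  have A: "A \<in> carrier_mat l l" and B: "B \<in> carrier_mat l n" and C: "C \<in> carrier_mat m l"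
    and min: "minimal_triple A B C" and D: "poly_mat_has_degree D (\<epsilon> + \<eta> + 1)"
    and M: "M \<in> carrier_mat ((\<eta> + 1) * m) ((\<epsilon> + 1) * n)" and pM: "pencil M"
    and D_eq: "D = transpose_mat (Lambda_col \<eta> \<otimes>\<^sub>K 1\<^sub>m m) * M * (Lambda_col \<epsilon> \<otimes>\<^sub>K 1\<^sub>m n)"
    and S_eq: "S = block_Kronecker_pencil m n l \<epsilon> \<eta> M A B C"
    using S unfolding block_Kronecker_linearization_def by blast+
  define Sf where "Sf = (\<lambda>k i j. coeff (S $$ (i, j)) k)"
  interpret K: kron_pencil m n l u v p q \<epsilon> \<eta> Sf "\<lambda>i j. A $$ (i, j)" "\<lambda>i j. B $$ (i, j)" "\<lambda>i j. C $$ (i, j)"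
    "spectral_norm A" "spectral_norm B" "spectral_norm C" "\<lambda>k. spectral_norm (coeff_mat k S)"
    using kron_pencil_block_Kronecker[OF A B C M mn] unfolding Sf_def p_def q_def u_def v_def S_eq .
  note sc = block_Kronecker_pencil_coeff[OF A B C M mn, folded p_def q_def u_def v_def S_eq]
  let ?r = "p + l + v" and ?c = "q + l + u"
  have Sc: "S \<in> carrier_mat ?r ?c" by (rule sc(1))
  have Sdim: "dim_row S = ?r" "dim_col S = ?c" using Sc by auto
  let ?\<Sigma> = "pencil_spectral_norm S" and ?nS = "pencil_frobenius_norm S"
  have nS_eq: "?nS = pfro ?r ?c Sf" unfolding Sf_def by (rule pencil_frobenius_norm_eq[OF Sc])
  have "norm (Sf 1 (p + 0) (q + 0)) \<le> pfro ?r ?c Sf" by (rule norm_le_pfro) (use dims in auto)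
  then have nS: "0 < ?nS" unfolding nS_eq using K.s22(2)[of 0 0] dims by simp
  \<comment> \<open>An entry that witnesses the degree of \<open>D\<close>; it stays nonzero for small perturbations.\<close>
  obtain i0 j0 where ij0: "i0 < m" "j0 < n" "coeff (M $$ (i0, j0)) 1 \<noteq> 0"
    using D degree_compressed_pencil_iff[OF M pM mn] unfolding D_eq by blast
  have ij0': "i0 < p" "j0 < q" using ij0 K.dims by auto
  have lead: "Sf 1 i0 j0 \<noteq> 0" using ij0 sc(2)[OF ij0'] by (simp add: Sf_def)
  obtain \<rho> where \<rho>: "0 < \<rho>" and open_min: "\<And>A' B' C'. mat_near \<rho> A' A \<Longrightarrow> mat_near \<rho> B' B \<Longrightarrow>
      mat_near \<rho> C' C \<Longrightarrow> minimal_triple A' B' C'"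
    using minimal_open[OF A B C min] by blast
  define w where "w = 1 + 2 * real (max \<eta> \<epsilon>) * max 1 (spectral_norm A ^ max \<eta> \<epsilon>)"
  define F where "F = (1 + sqrt 2 * w * K.\<Sigma>) * ((1 + 5 * real (max \<epsilon> \<eta>) * K.\<Sigma>) * (1 + 5 * K.s * K.\<Sigma>))"
  have max_pos: "0 < max \<epsilon> \<eta>" using params by simp
  obtain \<tau> \<kappa> where \<tau>: "0 < \<tau>" and \<kappa>: "0 \<le> \<kappa>" and main: "\<forall>\<Delta>. pfro ?r ?c \<Delta> < \<tau> \<longrightarrow> (\<exists>X1 X2 X3 Y1 Y2 Y3 T.
      mat_supp ?r ?r (lower_mask p l) X1 \<and> mat_supp ?r ?r (diag_mask p l) X2 \<and> mat_supp ?r ?r (upper_band_mask p l) X3 \<and>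
      mat_supp ?c ?c (\<lambda>i j. lower_mask q l j i) Y1 \<and> mat_supp ?c ?c (diag_mask q l) Y2 \<and>
      mat_supp ?c ?c (\<lambda>i j. upper_band_mask q l j i) Y3 \<and>
      (\<forall>X\<in>{X1, X2, X3}. fro ?r ?r X \<le> 1 / 2) \<and> (\<forall>Y\<in>{Y1, Y2, Y3}. fro ?c ?c Y \<le> 1 / 2) \<and>
      T = transform ?r ?c X3 (transform ?r ?c X2 (transform ?r ?c X1 (\<lambda>k i j. Sf k i j + \<Delta> k i j) Y1) Y2) Y3 \<and>
      pencil_supp ?r ?c (Kronecker_mask p q l u v) (\<lambda>k i j. T k i j - Sf k i j) \<and>
      pfro ?r ?c (\<lambda>k i j. T k i j - Sf k i j) \<le> F * pfro ?r ?c \<Delta> + \<kappa> * (pfro ?r ?c \<Delta>)\<^sup>2)"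
    using K.exists_three_stage_transform[OF max_pos] unfolding F_def w_def by (elim exE conjE)
  have \<Sigma>_eq: "K.\<Sigma> = ?\<Sigma>" by (rule pencil_spectral_norm_eq[symmetric])
  have \<Sigma>0: "0 \<le> ?\<Sigma>" unfolding \<Sigma>_eq[symmetric] by simp
  have w0: "0 \<le> w" by (simp add: w_def)
  have s_eq: "K.s = s"
    unfolding K.s_def K.\<alpha>_def K.\<beta>_def K.\<gamma>_def s \<alpha> \<beta> \<gamma> by simp
  have N_le: "real (max \<epsilon> \<eta>) \<le> s"
  proof -
    have "real N \<le> 1 + 2 * real N * max 1 a" for N and a :: real
    proof -
      have "real N * 1 \<le> real N * max 1 a" by (rule mult_left_mono) auto
      then show ?thesis by linarith
    qed
    then have "real \<epsilon> \<le> \<alpha>" "real \<eta> \<le> \<beta>" unfolding \<alpha> \<beta> by blast+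
    moreover have "0 \<le> \<gamma> * (\<beta> * spectral_norm B + \<alpha> * spectral_norm C)"
      using K.rho_nonneg unfolding \<alpha> \<beta> \<gamma> by simp
    ultimately show ?thesis unfolding s by linarith
  qed
  have f2_ge: "sqrt 2 * real (max \<epsilon> \<eta>) \<le> f\<^sub>2"
    unfolding f2 using max_pos by (simp add: field_simps)
  have f3_eq: "f\<^sub>3 = sqrt 2 * w" unfolding f3 w_def by simp
  \<comment> \<open>\<open>F\<close> is the amplification that the three stages achieve, \<open>G\<close> the one that is claimed.\<close>
  define G where "G = (1 + f\<^sub>1 * ?\<Sigma>) * (1 + f\<^sub>2 * ?\<Sigma>) * (1 + f\<^sub>3 * ?\<Sigma>)"
  have F_le: "F \<le> G"
    unfolding F_def G_def \<Sigma>_eq s_eq f3_eq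
    by (rule amplification_le[OF _ N_le \<Sigma>0 _ f1 f2_ge]) (use w0 in simp_all)
  have F0: "0 \<le> F" unfolding F_def \<Sigma>_eq s_eq using \<Sigma>0 w0 K.s_nonneg[unfolded s_eq] by simp
  \<comment> \<open>Entrywise changes below \<open>\<rho>'\<close> keep both the minimality and the degree.\<close>
  define \<rho>' where "\<rho>' = min \<rho> (norm (Sf 1 i0 j0))"
  have \<rho>': "0 < \<rho>'" using \<rho> lead by (simp add: \<rho>'_def)
  define \<tau>' where "\<tau>' = min (min 1 \<tau>) (\<rho>' / (F + \<kappa> + 1))"
  have den: "0 < F + \<kappa> + 1" using F0 \<kappa> by linarith
  have \<tau>': "0 < \<tau>'" using \<tau> \<rho>' den by (simp add: \<tau>'_def)
  \<comment> \<open>The quadratic term is measured relative to \<open>S\<close>; the summand \<open>1\<close> makes the constant positive.\<close>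
  define Kc where "Kc = \<kappa> * ?nS\<^sup>2 + 1"
  have Kc: "0 < Kc" using \<kappa> unfolding Kc_def by (intro add_nonneg_pos mult_nonneg_nonneg) simp_all
  show ?thesis
    unfolding Sdim G_def[symmetric]
  proof (rule exI[of _ \<tau>'], rule conjI[OF \<tau>'], rule exI[of _ Kc], rule conjI[OF Kc], intro ballI impI, elim conjE)
    fix \<Delta>\<^sub>S :: "'a poly mat" assume \<Delta>c: "\<Delta>\<^sub>S \<in> carrier_mat ?r ?c" and p\<Delta>: "pencil \<Delta>\<^sub>S" and small: "pencil_frobenius_norm \<Delta>\<^sub>S < \<tau>'"
    define \<Delta> where "\<Delta> = (\<lambda>k i j. coeff (\<Delta>\<^sub>S $$ (i, j)) k)"
    let ?d = "pfro ?r ?c \<Delta>"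
    have d_eq: "pencil_frobenius_norm \<Delta>\<^sub>S = ?d" unfolding \<Delta>_def by (rule pencil_frobenius_norm_eq[OF \<Delta>c])
    have d: "0 \<le> ?d" "?d \<le> 1" "?d < \<tau>" "?d < \<rho>' / (F + \<kappa> + 1)"
      using small unfolding d_eq \<tau>'_def by simp_all
    from main[rule_format, OF d(3)] obtain X1 X2 X3 Y1 Y2 Y3 T where
      X1: "mat_supp ?r ?r (lower_mask p l) X1" and X2: "mat_supp ?r ?r (diag_mask p l) X2"
      and X3: "mat_supp ?r ?r (upper_band_mask p l) X3"
      and Y1: "mat_supp ?c ?c (\<lambda>i j. lower_mask q l j i) Y1" and Y2: "mat_supp ?c ?c (diag_mask q l) Y2"
      and Y3: "mat_supp ?c ?c (\<lambda>i j. upper_band_mask q l j i) Y3"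
      and nX: "\<forall>X\<in>{X1, X2, X3}. fro ?r ?r X \<le> 1 / 2" and nY: "\<forall>Y\<in>{Y1, Y2, Y3}. fro ?c ?c Y \<le> 1 / 2"
      and T: "T = transform ?r ?c X3 (transform ?r ?c X2 (transform ?r ?c X1 (\<lambda>k i j. Sf k i j + \<Delta> k i j) Y1) Y2) Y3"
      and supp: "pencil_supp ?r ?c (Kronecker_mask p q l u v) (\<lambda>k i j. T k i j - Sf k i j)"
      and nT: "pfro ?r ?c (\<lambda>k i j. T k i j - Sf k i j) \<le> F * ?d + \<kappa> * ?d\<^sup>2"
      by (elim exE conjE)
    define mr where "mr X = Matrix.mat ?r ?r (\<lambda>(i, j). X i j)" for X :: "nat \<Rightarrow> nat \<Rightarrow> 'a"
    define mc where "mc Y = Matrix.mat ?c ?c (\<lambda>(i, j). Y i j)" for Y :: "nat \<Rightarrow> nat \<Rightarrow> 'a"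
    define S' where "S' = const_mat (1\<^sub>m ?r - mr X3) * const_mat (1\<^sub>m ?r - mr X2) * const_mat (1\<^sub>m ?r - mr X1) * (S + \<Delta>\<^sub>S)
      * const_mat (1\<^sub>m ?c - mc Y1) * const_mat (1\<^sub>m ?c - mc Y2) * const_mat (1\<^sub>m ?c - mc Y3)"
    have SD: "S + \<Delta>\<^sub>S \<in> carrier_mat ?r ?c" using \<Delta>c by (rule add_carrier_mat)
    note prod = three_stage_product_coeff[OF SD, where ?X1.0 = X1 and ?X2.0 = X2 and ?X3.0 = X3
        and ?Y1.0 = Y1 and ?Y2.0 = Y2 and ?Y3.0 = Y3, folded mr_def mc_def, folded S'_def]
    have S'c: "S' \<in> carrier_mat ?r ?c" by (rule prod(1))
    have SD_coeff: "coeff ((S + \<Delta>\<^sub>S) $$ (i, j)) k = Sf k i j + \<Delta> k i j" if "i < ?r" "j < ?c" for k i j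
      using that Sc \<Delta>c by (simp add: Sf_def \<Delta>_def)
    have S'_coeff: "coeff (S' $$ (i, j)) k = T k i j" if ij: "i < ?r" "j < ?c" for k i j
      unfolding prod(2)[OF ij] T
      by (rule transform_cong[OF refl refl _ ij], rule transform_cong[OF refl refl], rule transform_cong[OF refl refl])
         (simp_all only: SD_coeff)
    have S_high: "Sf k i j = 0" if "1 < k" "i < ?r" "j < ?c" for k i j
      using that(2)
    proof (cases rule: split_index)
      case 1 show ?thesis
        using that(3) by (cases rule: split_index)
          (use 1 that(1) sc pencil_coeff[OF pM _ _ that(1)] M in \<open>auto simp: Sf_def p_def q_def\<close>)
    next
      case (2 i') show ?thesis
        using that(3) by (cases rule: split_index) (use 2 that(1) sc in \<open>auto simp: Sf_def\<close>)
    next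
      case (3 i') show ?thesis
        using that(3) by (cases rule: split_index) (use 3 that(1) sc in \<open>auto simp: Sf_def\<close>)
    qed
    have T_high: "T k i j = 0" if "1 < k" "i < ?r" "j < ?c" for k i j
      unfolding T
    proof (rule transform_zero[OF transform_zero[OF transform_zero]])
      fix i j assume "i < ?r" "j < ?c"
      then show "Sf k i j + \<Delta> k i j = 0"
        using S_high[OF that(1)] pencil_coeff[OF p\<Delta> _ _ that(1)] \<Delta>c by (simp add: \<Delta>_def)
    qed (use that in simp_all)
    \<comment> \<open>The new parameters are found at the places of the old ones.\<close>
    define M' where "M' = Matrix.mat p q (\<lambda>(i, j). S' $$ (i, j))"
    define A' where "A' = Matrix.mat l l (\<lambda>(i, j). coeff (S' $$ (p + i, q + j)) 0)"
    define B' where "B' = Matrix.mat l n (\<lambda>(i, j). coeff (S' $$ (p + i, v + j)) 0)"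
    define C' where "C' = Matrix.mat m l (\<lambda>(i, j). coeff (S' $$ (u + i, q + j)) 0)"
    have pencil_S': "pencil_supp ?r ?c (Kronecker_mask p q l u v) (\<lambda>k i j. coeff (S' $$ (i, j)) k - coeff (S $$ (i, j)) k)"
      using supp by (simp add: pencil_supp_def S'_coeff Sf_def)
    have S'_eq: "S' = block_Kronecker_pencil m n l \<epsilon> \<eta> M' A' B' C'"
      by (rule block_Kronecker_of_support[OF A B C M mn, folded p_def q_def u_def v_def S_eq,
            OF S'c _ pencil_S' M'_def A'_def B'_def C'_def]) (simp only: S'_coeff T_high)
    have "F * ?d + \<kappa> * ?d\<^sup>2 \<le> (F + \<kappa>) * ?d"
      using quadratic_bound_compose(1)[OF d(1,2) _ F0 order_refl \<kappa> order_refl order_refl order_refl] F0 \<kappa> d by simp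
    also have "\<dots> \<le> (F + \<kappa> + 1) * ?d" using d(1) by (intro mult_right_mono) auto
    also have "\<dots> < \<rho>'" using d(4) den by (simp add: pos_less_divide_eq mult.commute)
    finally have near: "pfro ?r ?c (\<lambda>k i j. T k i j - Sf k i j) < \<rho>'" using nT by linarith
    have entry: "norm (T k i j - Sf k i j) < \<rho>'" if "k < 2" "i < ?r" "j < ?c" for k i j
      using norm_le_pfro[OF that, of "\<lambda>k i j. T k i j - Sf k i j"] near by linarith
    have entry0: "norm (T 0 i j - Sf 0 i j) < \<rho>" if "i < ?r" "j < ?c" for i j
      using entry[OF _ that, of 0] by (simp add: \<rho>'_def)
    have nearA: "mat_near \<rho> A' A"
      unfolding mat_near_def
    proof (intro conjI allI impI)
      show "A' \<in> carrier_mat (dim_row A) (dim_col A)" using A by (auto simp: A'_def)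
      fix i j assume "i < dim_row A" "j < dim_col A"
      then have ij: "i < l" "j < l" using A by auto
      then show "norm (A' $$ (i, j) - A $$ (i, j)) < \<rho>"
        using entry0[of "p + i" "q + j"] K.s22(1)[of i j] by (simp add: A'_def S'_coeff)
    qed
    have nearB: "mat_near \<rho> B' B"
      unfolding mat_near_def
    proof (intro conjI allI impI)
      show "B' \<in> carrier_mat (dim_row B) (dim_col B)" using B by (auto simp: B'_def)
      fix i j assume "i < dim_row B" "j < dim_col B"
      then have ij: "i < l" "j < n" using B by auto
      have "v + j < q" using ij K.dims by simp
      then show "norm (B' $$ (i, j) - B $$ (i, j)) < \<rho>"
        using entry0[of "p + i" "v + j"] K.s21(1)[of i "v + j"] ij by (simp add: B'_def S'_coeff)
    qed
    have nearC: "mat_near \<rho> C' C"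
      unfolding mat_near_def
    proof (intro conjI allI impI)
      show "C' \<in> carrier_mat (dim_row C) (dim_col C)" using C by (auto simp: C'_def)
      fix i j assume "i < dim_row C" "j < dim_col C"
      then have ij: "i < m" "j < l" using C by auto
      have "u + i < p" using ij K.dims by simp
      then show "norm (C' $$ (i, j) - C $$ (i, j)) < \<rho>"
        using entry0[of "u + i" "q + j"] K.s12(1)[of "u + i" j] ij by (simp add: C'_def S'_coeff)
    qed
    have min': "minimal_triple A' B' C'" by (rule open_min[OF nearA nearB nearC])
    have M': "M' \<in> carrier_mat ((\<eta> + 1) * m) ((\<epsilon> + 1) * n)" by (simp only: M'_def p_def q_def mat_carrier)
    have pM': "pencil M'"
      by (rule pencilI) (simp add: M'_def S'_coeff T_high)
    have "T 1 i0 j0 \<noteq> 0"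
      using entry[of 1 i0 j0] ij0' by (auto simp: \<rho>'_def)
    then have lead': "coeff (M' $$ (i0, j0)) 1 \<noteq> 0" using ij0' by (simp add: M'_def S'_coeff)
    define D' where "D' = transpose_mat (Lambda_col \<eta> \<otimes>\<^sub>K 1\<^sub>m m) * M' * (Lambda_col \<epsilon> \<otimes>\<^sub>K 1\<^sub>m n)"
    have D': "D' \<in> carrier_mat m n" unfolding D'_def by (rule leading_coeff_compressed_pencil(1)[OF M' pM' mn])
    have deg': "poly_mat_has_degree D' (\<epsilon> + \<eta> + 1)"
      unfolding D'_def degree_compressed_pencil_iff[OF M' pM' mn] using ij0(1,2) lead' by blast
    have lin: "block_Kronecker_linearization m n l \<epsilon> \<eta> (state_space_rational_mat A' B' C' D') A' B' C' D' M' S'"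
      unfolding block_Kronecker_linearization_def
      by (intro conjI min' D' deg' M' pM' refl D'_def S'_eq) (simp_all add: A'_def B'_def C'_def)
    have diff: "pencil_frobenius_norm (S' - S) = pfro ?r ?c (\<lambda>k i j. T k i j - Sf k i j)"
    proof -
      have "S' - S \<in> carrier_mat ?r ?c" using Sc by (rule minus_carrier_mat)
      then have "pencil_frobenius_norm (S' - S) = pfro ?r ?c (\<lambda>k i j. coeff ((S' - S) $$ (i, j)) k)"
        by (rule pencil_frobenius_norm_eq)
      also have "\<dots> = pfro ?r ?c (\<lambda>k i j. T k i j - Sf k i j)"
        by (rule pfro_cong) (use Sc S'c S'_coeff in \<open>simp add: Sf_def\<close>)
      finally show ?thesis .
    qed
    have "\<kappa> * ?d\<^sup>2 = \<kappa> * ?nS\<^sup>2 * (?d / ?nS)\<^sup>2" using nS by (simp add: power_divide)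
    also have "\<dots> \<le> Kc * (?d / ?nS)\<^sup>2" unfolding Kc_def by (rule mult_right_mono) simp_all
    finally have "\<kappa> * ?d\<^sup>2 \<le> Kc * (?d / ?nS)\<^sup>2" .
    moreover have "F * ?d \<le> G * ?d" by (rule mult_right_mono[OF F_le d(1)])
    ultimately have bound: "pencil_frobenius_norm (S' - S)
        \<le> G * pencil_frobenius_norm \<Delta>\<^sub>S + Kc * (pencil_frobenius_norm \<Delta>\<^sub>S / ?nS)\<^sup>2"
      unfolding diff d_eq using nT by linarith
    have fro_mr: "fro ?r ?r (\<lambda>i j. mr X $$ (i, j)) = fro ?r ?r X" for X
      by (rule L2_set_cong) (auto simp: mr_def)
    have fro_mc: "fro ?c ?c (\<lambda>i j. mc Y $$ (i, j)) = fro ?c ?c Y" for Y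
      by (rule L2_set_cong) (auto simp: mc_def)
    have invX: "invertible_mat (1\<^sub>m ?r - mr X)" if "X \<in> {X1, X2, X3}" for X
      by (rule invertible_one_minus) (use nX that in \<open>simp_all only: fro_mr, simp_all add: mr_def\<close>)
    have invY: "invertible_mat (1\<^sub>m ?c - mc Y)" if "Y \<in> {Y1, Y2, Y3}" for Y
      by (rule invertible_one_minus) (use nY that in \<open>simp_all only: fro_mc, simp_all add: mc_def\<close>)
    have struct: "strictly_block_lower p l v (mr X1)" "block_diagonal p l v (mr X2)"
      "strictly_block_upper_no_corner p l v (mr X3)" "strictly_block_upper q l u (mc Y1)"
      "block_diagonal q l u (mc Y2)" "strictly_block_lower_no_corner q l u (mc Y3)"
      unfolding mr_def mc_def
      by (rule strictly_block_lowerI[OF X1] block_diagonalI[OF X2] strictly_block_upper_no_cornerI[OF X3]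
          strictly_block_upperI[OF Y1] block_diagonalI[OF Y2] strictly_block_lower_no_cornerI[OF Y3])+
    have all_inv: "\<forall>X\<in>{mr X1, mr X2, mr X3}. invertible_mat (1\<^sub>m ?r - X)"
      "\<forall>Y\<in>{mc Y1, mc Y2, mc Y3}. invertible_mat (1\<^sub>m ?c - Y)"
      using invX invY by simp_all
    show "\<exists>X\<^sub>1 X\<^sub>2 X\<^sub>3 Y\<^sub>1 Y\<^sub>2 Y\<^sub>3 R' A' B' C' D' M' S'.
       strictly_block_lower ((\<eta> + 1) * m) l (\<epsilon> * n) X\<^sub>1 \<and>
       block_diagonal ((\<eta> + 1) * m) l (\<epsilon> * n) X\<^sub>2 \<and>
       strictly_block_upper_no_corner ((\<eta> + 1) * m) l (\<epsilon> * n) X\<^sub>3 \<and>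
       strictly_block_upper ((\<epsilon> + 1) * n) l (\<eta> * m) Y\<^sub>1 \<and>
       block_diagonal ((\<epsilon> + 1) * n) l (\<eta> * m) Y\<^sub>2 \<and>
       strictly_block_lower_no_corner ((\<epsilon> + 1) * n) l (\<eta> * m) Y\<^sub>3 \<and>
       (\<forall>X \<in> {X\<^sub>1, X\<^sub>2, X\<^sub>3}. invertible_mat (1\<^sub>m ?r - X)) \<and>
       (\<forall>Y \<in> {Y\<^sub>1, Y\<^sub>2, Y\<^sub>3}. invertible_mat (1\<^sub>m ?c - Y)) \<and>
       S' = const_mat (1\<^sub>m ?r - X\<^sub>3) * const_mat (1\<^sub>m ?r - X\<^sub>2)
          * const_mat (1\<^sub>m ?r - X\<^sub>1) * (S + \<Delta>\<^sub>S)
          * const_mat (1\<^sub>m ?c - Y\<^sub>1) * const_mat (1\<^sub>m ?c - Y\<^sub>2)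
          * const_mat (1\<^sub>m ?c - Y\<^sub>3) \<and>
       block_Kronecker_linearization m n l \<epsilon> \<eta> R' A' B' C' D' M' S' \<and>
       pencil_frobenius_norm (S' - S)
         \<le> G * pencil_frobenius_norm \<Delta>\<^sub>S + Kc * (pencil_frobenius_norm \<Delta>\<^sub>S / ?nS)\<^sup>2"
      by (rule exI[of _ "mr X1"], rule exI[of _ "mr X2"], rule exI[of _ "mr X3"],
          rule exI[of _ "mc Y1"], rule exI[of _ "mc Y2"], rule exI[of _ "mc Y3"],
          rule exI[of _ "state_space_rational_mat A' B' C' D'"], rule exI[of _ A'], rule exI[of _ B'],
          rule exI[of _ C'], rule exI[of _ D'], rule exI[of _ M'], rule exI[of _ S'],
          intro conjI struct[unfolded p_def q_def u_def v_def] all_inv S'_def lin bound)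
  qed
qed

end
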